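(* Let $\epsilon_m>0$, $0<\bar\epsilon<1$, $\delta\in(0,1)$, $\tau\ge 0$, $c>0$, and let $K\ge1$ be an integer. Let $m=\left\lceil \frac{\log(4K/\delta)c^2}{2\epsilon_m^2}\right\rceil$, let $s_1,\dots,s_m$ be states sampled from $d$, and for each $i$ let $\bar v(s_i)$ be the output of Procedure R (defined in the context) run from state $s_i$ with inputs $\left(\bar\epsilon,\frac{\delta}{2m},\tau\right)$. Let $\hat v$ range over the $K$ value functions $\mathcal S\to\mathbb R$ for which the error estimate is computed. Then with probability at least $1-\delta$, for all these $\hat v$, $$\left|\ell(\hat v,v^* )-\frac1m\sum_{i=1}^m \ell_c(\hat v(s_i),\bar v(s_i))\right|\le \epsilon,\qquad\text{where } \epsilon=\epsilon_m+2(1+c)\bar\epsilon.$$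
   Context: Setting: a Markov decision process with state space $\mathcal S$, a probability distribution $d$ on $\mathcal S$, a fixed policy $\pi$, and a discount $\gamma$. $v^*(s)=\mathbb E\left[\sum_{k=0}^\infty\gamma^kR_k\right]$ is the expected discounted sum of rewards starting in $s$ and following $\pi$. A truncated return from $s$ is $g=\sum_{k=0}^{l-1}\gamma^kR_k$, with $l$ the (possibly random) truncation length, and $\bar v^*(s)=\mathbb E[g]$. $V_{\max}$ denotes the maximum absolute value for the policy $\pi$ for any state, e.g. $V_{\max}=\frac{\text{max reward}-\text{min reward}}{1-\gamma}$. Losses: $\ell_c(v_1,v_2)=\min\left(c,\frac{|v_1-v_2|}{|v_2|+\tau}\right)$ and $\ell(\hat v,v^* )=\mathbb E_{S\sim d}\left[\ell_c(\hat v(S),v^*(S))\right]$. Procedure R, with inputs $(\epsilon,\delta,\tau)$ and state $s$ (here $\epsilon,\delta$ are the procedure's own inputs). The truncation length of the sampled returns is such that $|\bar v^*(s)-v^*(s)|\le\epsilon(|v^*(s)|+\tau)$. Initialize $\mathrm{LB}=0$, $\mathrm{UB}=\infty$, $\widehat{\mathrm{LB}}=-\infty$, $\widehat{\mathrm{UB}}=\infty$, $\bar g=0$, $M=0$, $j=1$, $h=0$, $\beta=1.1$, $p=1.1$, $\alpha=1$, $x=1$. While $(1+\epsilon)\mathrm{LB}+2\epsilon\tau<(1-\epsilon)\mathrm{UB}$ or $\mathrm{LB}=0$, do: (1) sample a truncated return $g$ from $s$ (independently of earlier ones); (2) $\Delta\leftarrow g-\bar g$; $\bar g\leftarrow\bar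 g+\Delta/j$; $M\leftarrow M+\Delta(g-\bar g)$; $\sigma\leftarrow\sqrt{M/j}$; (3) if $j\ge\lfloor\beta^h\rfloor$: $h\leftarrow h+1$, $\alpha\leftarrow\lfloor\beta^h\rfloor/\lfloor\beta^{h-1}\rfloor$, $x\leftarrow-\alpha\log\frac{\delta(p-1)}{3ph^p}$; (4) $c_j\leftarrow\sigma\sqrt{2x/j}+3V_{\max}x/j$; (5) $\mathrm{LB}\leftarrow\max(\mathrm{LB},|\bar g|-c_j)$, $\mathrm{UB}\leftarrow\min(\mathrm{UB},|\bar g|+c_j)$, $\widehat{\mathrm{LB}}\leftarrow\max(\widehat{\mathrm{LB}},\bar g-c_j)$, $\widehat{\mathrm{UB}}\leftarrow\min(\widehat{\mathrm{UB}},\bar g+c_j)$; (6) if $(\widehat{\mathrm{UB}}-\widehat{\mathrm{LB}})/2\le\epsilon\tau$, stop and return $(\widehat{\mathrm{UB}}+\widehat{\mathrm{LB}})/2$; (7) $j\leftarrow j+1$. When the while loop exits, return $\frac{\mathrm{sign}(\bar g)}{2}\left((1+\epsilon)\mathrm{LB}+(1-\epsilon)\mathrm{UB}\right)$.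
   Formalization: V_max is taken as a bound on the spread of the sampled truncated returns from each state, since with V_max = max |v*| the claim fails (v* = 0 with noisy rewards); a zero denominator in the loss is read as the limit τ→0+, and a run that never halts outputs 0. *)

theory Defs
  imports "HOL-Probability.Probability" "HOL-Library.While_Combinator"
begin

text \<open>
  A Markov decision process together with a fixed (stationary, possibly randomised) policy:
  \<open>\<kappa> (s, a)\<close> is the joint law of the reward and the next state, \<open>\<pi> s\<close> the law of the action.
\<close>

locale mdp_policy =
  fixes Ms :: "'s measure"
    and Ma :: "'a measure"
    and \<kappa> :: "'s \<times> 'a \<Rightarrow> (real \<times> 's) measure"
    and \<pi> :: "'s \<Rightarrow> 'a measure"
    and \<gamma> :: real
  assumes kernel: "\<kappa> \<in> Ms \<Otimes>\<^sub>M Ma \<rightarrow>\<^sub>M prob_algebra (borel \<Otimes>\<^sub>M Ms)"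
    and policy: "\<pi> \<in> Ms \<rightarrow>\<^sub>M prob_algebra Ma"
    and bounded_rewards:
      "\<exists>r_min r_max. \<forall>s\<in>space Ms. \<forall>a\<in>space Ma. AE y in \<kappa> (s, a). fst y \<in> {r_min..r_max}"
    and discount: "0 \<le> \<gamma>" "\<gamma> < 1"

text \<open>
  A trajectory is \<open>\<omega> :: nat \<Rightarrow> real \<times> 's\<close> with \<open>\<omega> k = (R\<^sub>k, S\<^sub>k\<^sub>+\<^sub>1)\<close>; the actions are integrated
  out.  Its law from the start state \<open>s\<close> is given by the Ionescu-Tulcea extension.
\<close>

definition policy_step ::
    "('s \<times> 'a \<Rightarrow> (real \<times> 's) measure) \<Rightarrow> ('s \<Rightarrow> 'a measure) \<Rightarrow> 's \<Rightarrow> (real \<times> 's) measure" where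
  "policy_step \<kappa> \<pi> s = \<pi> s \<bind> (\<lambda>a. \<kappa> (s, a))"

definition trajectory_kernel ::
    "('s \<times> 'a \<Rightarrow> (real \<times> 's) measure) \<Rightarrow> ('s \<Rightarrow> 'a measure) \<Rightarrow> 's \<Rightarrow>
      nat \<Rightarrow> (nat \<Rightarrow> real \<times> 's) \<Rightarrow> (real \<times> 's) measure" where
  "trajectory_kernel \<kappa> \<pi> s k \<omega> = policy_step \<kappa> \<pi> (if k = 0 then s else snd (\<omega> (k - 1)))"

definition trajectory_law ::
    "'s measure \<Rightarrow> ('s \<times> 'a \<Rightarrow> (real \<times> 's) measure) \<Rightarrow> ('s \<Rightarrow> 'a measure) \<Rightarrow> 's \<Rightarrow>
      (nat \<Rightarrow> real \<times> 's) measure" where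
  "trajectory_law Ms \<kappa> \<pi> s =
    projective_family.lim UNIV
      (Ionescu_Tulcea.CI (trajectory_kernel \<kappa> \<pi> s) (\<lambda>_. borel \<Otimes>\<^sub>M Ms)) (\<lambda>_. borel \<Otimes>\<^sub>M Ms)"

definition true_value ::
    "'s measure \<Rightarrow> ('s \<times> 'a \<Rightarrow> (real \<times> 's) measure) \<Rightarrow> ('s \<Rightarrow> 'a measure) \<Rightarrow> real \<Rightarrow>
      's \<Rightarrow> real" where
  "true_value Ms \<kappa> \<pi> \<gamma> s = (\<integral>\<omega>. (\<Sum>k. \<gamma> ^ k * fst (\<omega> k)) \<partial>trajectory_law Ms \<kappa> \<pi> s)"

text \<open>
  A truncation scheme gives, for each start state, a joint law of the truncation length and the
  trajectory.  This covers fixed lengths, random lengths drawn independently of the trajectory,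
  and lengths that depend on the trajectory.
\<close>

definition truncation_scheme ::
    "'s measure \<Rightarrow> ('s \<times> 'a \<Rightarrow> (real \<times> 's) measure) \<Rightarrow> ('s \<Rightarrow> 'a measure) \<Rightarrow>
      ('s \<Rightarrow> (nat \<times> (nat \<Rightarrow> real \<times> 's)) measure) \<Rightarrow> bool" where
  "truncation_scheme Ms \<kappa> \<pi> T \<longleftrightarrow>
    T \<in> Ms \<rightarrow>\<^sub>M prob_algebra (count_space UNIV \<Otimes>\<^sub>M (\<Pi>\<^sub>M k\<in>UNIV. borel \<Otimes>\<^sub>M Ms)) \<and>
    (\<forall>s\<in>space Ms. distr (T s) (\<Pi>\<^sub>M k\<in>UNIV. borel \<Otimes>\<^sub>M Ms) snd = trajectory_law Ms \<kappa> \<pi> s)"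

definition truncated_return_law ::
    "real \<Rightarrow> ('s \<Rightarrow> (nat \<times> (nat \<Rightarrow> real \<times> 's)) measure) \<Rightarrow> 's \<Rightarrow> real measure" where
  "truncated_return_law \<gamma> T s = distr (T s) borel (\<lambda>(l, \<omega>). \<Sum>k<l. \<gamma> ^ k * fst (\<omega> k))"

definition truncated_value ::
    "real \<Rightarrow> ('s \<Rightarrow> (nat \<times> (nat \<Rightarrow> real \<times> 's)) measure) \<Rightarrow> 's \<Rightarrow> real" where
  "truncated_value \<gamma> T s = (\<integral>g. g \<partial>truncated_return_law \<gamma> T s)"

text \<open>
  \<open>V\<^sub>m\<^sub>a\<^sub>x\<close> enters the procedure as the range in an empirical Bernstein radius, so it bounds the
  spread of the sampled returns from each state.  With rewards in \<open>{r_min..r_max}\<close> and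
  a fixed truncation length (or \<open>r_min \<le> 0 \<le> r_max\<close> and any truncation length), this holds for
  \<open>(r_max - r_min) / (1 - \<gamma>)\<close>.  A bound on the expected returns alone would not do: it
  can be 0 although the returns are noisy, and the first confidence radius is then 0.
\<close>

definition return_spread_bound ::
    "'s measure \<Rightarrow> real \<Rightarrow> ('s \<Rightarrow> (nat \<times> (nat \<Rightarrow> real \<times> 's)) measure) \<Rightarrow> real \<Rightarrow> bool" where
  "return_spread_bound Ms \<gamma> T Vmax \<longleftrightarrow>
    (\<forall>s\<in>space Ms. \<exists>b. AE g in truncated_return_law \<gamma> T s. b \<le> g \<and> g \<le> b + Vmax)"

text \<open>
  For \<open>\<tau> = 0\<close> and \<open>v\<^sub>2 = 0\<close> the relative error is read as its limit for \<open>\<tau> \<rightarrow> 0+\<close>: zero if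
  \<open>v\<^sub>1 = v\<^sub>2\<close>, and infinite (so the loss is \<open>c\<close>) otherwise.  HOL's \<open>x / 0 = 0\<close> would give 0.
\<close>

definition clipped_loss :: "real \<Rightarrow> real \<Rightarrow> real \<Rightarrow> real \<Rightarrow> real" where
  "clipped_loss c \<tau> v1 v2 =
    (if \<bar>v2\<bar> + \<tau> = 0 then (if v1 = v2 then 0 else c)
     else min c (\<bar>v1 - v2\<bar> / (\<bar>v2\<bar> + \<tau>)))"

definition expected_loss ::
    "'s measure \<Rightarrow> real \<Rightarrow> real \<Rightarrow> ('s \<Rightarrow> real) \<Rightarrow> ('s \<Rightarrow> real) \<Rightarrow> real" where
  "expected_loss d c \<tau> vhat vstar = (\<integral>s. clipped_loss c \<tau> (vhat s) (vstar s) \<partial>d)"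

record procR_state =
  pr_LB :: real
  pr_UB :: ereal
  pr_LBhat :: ereal
  pr_UBhat :: ereal
  pr_mean :: real
  pr_M :: real
  pr_j :: nat
  pr_h :: nat
  pr_alpha :: real
  pr_x :: real
  pr_result :: "real option"

definition procR_init :: procR_state where
  "procR_init =
    \<lparr>pr_LB = 0, pr_UB = \<infinity>, pr_LBhat = -\<infinity>, pr_UBhat = \<infinity>, pr_mean = 0, pr_M = 0,
     pr_j = 1, pr_h = 0, pr_alpha = 1, pr_x = 1, pr_result = None\<rparr>"

definition procR_beta :: real where "procR_beta = 11 / 10"

definition procR_p :: real where "procR_p = 11 / 10"

text \<open>
  \<open>G j\<close> is the \<open>j\<close>-th sampled truncated return, \<open>j \<ge> 1\<close> (\<open>G 0\<close> is never read).  The field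
  \<open>pr_result\<close> records a return from inside the loop.
\<close>

definition procR_guard :: "real \<Rightarrow> real \<Rightarrow> procR_state \<Rightarrow> bool" where
  "procR_guard \<epsilon> \<tau> st \<longleftrightarrow>
    pr_result st = None \<and>
    (ereal ((1 + \<epsilon>) * pr_LB st + 2 * \<epsilon> * \<tau>) < ereal (1 - \<epsilon>) * pr_UB st \<or> pr_LB st = 0)"

definition procR_body ::
    "real \<Rightarrow> real \<Rightarrow> real \<Rightarrow> real \<Rightarrow> (nat \<Rightarrow> real) \<Rightarrow> procR_state \<Rightarrow> procR_state" where
  "procR_body \<epsilon> \<delta> \<tau> Vmax G st =
    (let j = pr_j st;
         g = G j;
         \<Delta> = g - pr_mean st;
         mean = pr_mean st + \<Delta> / real j;
         M = pr_M st + \<Delta> * (g - mean);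
         \<sigma> = sqrt (M / real j);
         new_epoch = (\<lfloor>procR_beta ^ pr_h st\<rfloor> \<le> int j);
         h = (if new_epoch then pr_h st + 1 else pr_h st);
         \<alpha> = (if new_epoch
              then real_of_int \<lfloor>procR_beta ^ h\<rfloor> / real_of_int \<lfloor>procR_beta ^ (h - 1)\<rfloor>
              else pr_alpha st);
         x = (if new_epoch
              then - \<alpha> * ln (\<delta> * (procR_p - 1) / (3 * procR_p * real h powr procR_p))
              else pr_x st);
         cj = \<sigma> * sqrt (2 * x / real j) + 3 * Vmax * x / real j;
         LB = max (pr_LB st) (\<bar>mean\<bar> - cj);
         UB = min (pr_UB st) (ereal (\<bar>mean\<bar> + cj));
         LBhat = max (pr_LBhat st) (ereal (mean - cj));
         UBhat = min (pr_UBhat st) (ereal (mean + cj));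
         result = (if (UBhat - LBhat) / 2 \<le> ereal (\<epsilon> * \<tau>)
                   then Some (real_of_ereal ((UBhat + LBhat) / 2)) else None)
     in \<lparr>pr_LB = LB, pr_UB = UB, pr_LBhat = LBhat, pr_UBhat = UBhat, pr_mean = mean, pr_M = M,
         pr_j = j + 1, pr_h = h, pr_alpha = \<alpha>, pr_x = x, pr_result = result\<rparr>)"

text \<open>
  The loop halts almost surely unless \<open>\<tau> = 0\<close> and the truncated value of the state is 0 (and
  hence, under the truncation condition, its true value is 0).  In that case it may run forever,
  and the output is by convention 0, the point to which the confidence intervals shrink.
\<close>

definition procR_output :: "real \<Rightarrow> real \<Rightarrow> real \<Rightarrow> real \<Rightarrow> (nat \<Rightarrow> real) \<Rightarrow> real" where
  "procR_output \<epsilon> \<delta> \<tau> Vmax G =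
    (case while_option (procR_guard \<epsilon> \<tau>) (procR_body \<epsilon> \<delta> \<tau> Vmax G) procR_init of
       None \<Rightarrow> 0
     | Some st \<Rightarrow>
         (case pr_result st of
            Some v \<Rightarrow> v
          | None \<Rightarrow> sgn (pr_mean st) / 2 *
              ((1 + \<epsilon>) * pr_LB st + (1 - \<epsilon>) * real_of_ereal (pr_UB st))))"

text \<open>
  Law of a state drawn from \<open>d\<close> paired with an i.i.d. sequence of truncated returns from that
  state, and of \<open>m\<close> independent such pairs.
\<close>

definition state_sample_law ::
    "'s measure \<Rightarrow> ('s \<Rightarrow> real measure) \<Rightarrow> ('s \<times> (nat \<Rightarrow> real)) measure" where
  "state_sample_law d \<rho> =
    d \<bind> (\<lambda>s. distr (\<Pi>\<^sub>M j\<in>(UNIV :: nat set). \<rho> s)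
                 (d \<Otimes>\<^sub>M (\<Pi>\<^sub>M j\<in>(UNIV :: nat set). borel)) (\<lambda>G. (s, G)))"

definition sample_law ::
    "nat \<Rightarrow> 's measure \<Rightarrow> ('s \<Rightarrow> real measure) \<Rightarrow> (nat \<Rightarrow> 's \<times> (nat \<Rightarrow> real)) measure" where
  "sample_law m d \<rho> = (\<Pi>\<^sub>M i\<in>{..<m}. state_sample_law d \<rho>)"

definition loss_estimate ::
    "nat \<Rightarrow> real \<Rightarrow> real \<Rightarrow> ('s \<Rightarrow> real) \<Rightarrow> ('s \<times> (nat \<Rightarrow> real) \<Rightarrow> real) \<Rightarrow>
      (nat \<Rightarrow> 's \<times> (nat \<Rightarrow> real)) \<Rightarrow> real" where
  "loss_estimate m c \<tau> vhat vbar \<omega> =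
    (1 / real m) * (\<Sum>i<m. clipped_loss c \<tau> (vhat (fst (\<omega> i))) (vbar (\<omega> i)))"

end

theory Submission
  imports Defs
begin

text \<open>
  Within one epoch of the schedule, Ville's inequality for exponential supermartingales bounds
  the deviations of the sample mean (Bernstein) and the lower tail of the sample variance
  uniformly in time; together they give the empirical Bernstein intervals used by the procedure.

  Valid intervals alone do not determine the sign of the returned value: the lower bound may stem
  from an early, large mean, and the mean may have crossed 0 by the time the loop exits.  An
  excursion of the mean above its radius followed by a return to 0 is as unlikely as a violation
  of one confidence bound, which follows from a two-stage version of Ville's inequality with a
  change of drift in between.  This is a fourth event per epoch, while the union bound of the
  procedure provides for three.  The missing budget comes from the first seven epochs, whose
  radii exceed the range of the returns, so that nothing can fail there.

  On the good event the output has relative error \<open>\<epsilon>\<close> with respect to the truncated value, hence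
  relative error \<open>2 \<epsilon>\<close> with respect to the true value if one measures relative to the larger of
  the two; the clipped loss is Lipschitz with constant \<open>1 + c\<close> in this sense.  The remaining
  half of \<open>\<delta>\<close> pays for Hoeffding's inequality over the \<open>K\<close> value functions.
\<close>

section \<open>Exponential estimates and maximal inequalities\<close>

text \<open>The radius contains the sample variance, so it has to dominate Bernstein's bound for the
  unknown variance. Only the lower tail of the sample variance matters for this, and because squares
  are nonnegative that tail is purely sub-Gaussian; the factor 3 in front of \<open>Vmax\<close>
  absorbs the conversion.

  In epoch h each failure event has probability at most \<delta> / 33 * h^(-11/10), where 33 = 3 * p
  / (p - 1). Three events fit over all epochs because the sum of h^(-p) is at most p / (p - 1) = 11;
  four events fit once the sum starts at h = 8, where it is at most 33/4. The number seven also fits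
  the other requirement: the level is at least 7/3, so 3 * Vmax * x / j is at least Vmax for j up to
  7, and these samples form one epoch each.

  Chaining the relative errors of the output and of the truncation against the true value would
  leave a term \<epsilon>^2. Comparing with the larger of the two magnitudes removes it, and the
  loss tolerates this because its perturbation bound holds relative to either denominator.\<close>

lemma borel_measurable_pred_le [measurable (raw)]:
  fixes f g :: "'a \<Rightarrow> 'b::{second_countable_topology, linorder_topology}"
  assumes "f \<in> borel_measurable M" "g \<in> borel_measurable M"
  shows "Measurable.pred M (\<lambda>x. f x \<le> g x)"
  unfolding Measurable.pred_def by (rule borel_measurable_le[OF assms])

text \<open>From the quadratic term on, the exponential series is dominated by a geometric series of
  ratio \<open>w / 3\<close>, because \<open>fact (k + 2)\<close> is at least
  \<open>2 * 3 ^ k\<close>. The term \<open>b * y / 3\<close> of the Bernstein boundary originates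
  here.\<close>

lemma exp_le_quadratic_quotient:
  fixes u w :: real
  assumes "\<bar>u\<bar> \<le> w" "w < 3"
  shows "exp u \<le> 1 + u + u\<^sup>2 / (2 * (1 - w / 3))"
proof -
  have w: "0 \<le> w" using assms by linarith
  have fact_ge: "2 * 3 ^ k \<le> (fact (k + 2) :: real)" for k
  proof (induction k)
    case (Suc k)
    have "2 * 3 ^ Suc k = 3 * (2 * 3 ^ k :: real)" by simp
    also have "\<dots> \<le> real (Suc (k + 2)) * fact (k + 2)"
      using Suc by (intro mult_mono) auto
    finally show ?case by (simp add: fact_Suc)
  qed simp
  have sums: "(\<lambda>k. u ^ (k + 2) /\<^sub>R fact (k + 2)) sums (exp u - (1 + u))"
    using sums_split_initial_segment[OF exp_converges[of u], of 2]
    by (simp add: numeral_2_eq_2)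
  have geo: "(\<lambda>k. u\<^sup>2 / 2 * (w / 3) ^ k) sums (u\<^sup>2 / 2 * (1 / (1 - w / 3)))"
    using w assms(2) by (intro sums_mult geometric_sums) auto
  have "exp u - (1 + u) \<le> u\<^sup>2 / 2 * (1 / (1 - w / 3))"
  proof (rule sums_le[OF _ sums geo])
    fix k
    have "u ^ (k + 2) \<le> u\<^sup>2 * w ^ k"
    proof -
      have "u ^ (k + 2) \<le> \<bar>u ^ (k + 2)\<bar>" by (rule abs_ge_self)
      also have "\<dots> = u\<^sup>2 * \<bar>u\<bar> ^ k"
        by (simp add: power_add abs_mult power_abs mult.commute power2_eq_square)
      also have "\<dots> \<le> u\<^sup>2 * w ^ k" using assms by (intro mult_left_mono power_mono) auto
      finally show ?thesis .
    qed
    then have "u ^ (k + 2) / fact (k + 2) \<le> u\<^sup>2 * w ^ k / (2 * 3 ^ k)"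
      using w fact_ge by (intro frac_le) auto
    then show "u ^ (k + 2) /\<^sub>R fact (k + 2) \<le> u\<^sup>2 / 2 * (w / 3) ^ k"
      by (simp only: power_mult_distrib power_inverse scaleR_conv_of_real of_real_eq_id id_apply
          divide_inverse inverse_mult_distrib mult_ac)
  qed
  then show ?thesis by (simp add: field_simps)
qed

text \<open>On this side no denominator such as \<open>1 - w / 3\<close> appears, which is why the
  boundary in \<open>variance_maximal\<close> has no term linear in \<open>y\<close>.\<close>

lemma exp_minus_le_quadratic:
  fixes u :: real
  assumes "0 \<le> u"
  shows "exp (- u) \<le> 1 - u + u\<^sup>2 / 2"
proof -
  define f where "f = (\<lambda>u::real. 1 - u + u\<^sup>2 / 2 - exp (- u))"
  have "f 0 \<le> f u"
  proof (rule DERIV_nonneg_imp_nondecreasing[OF assms])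
    fix t :: real assume "0 \<le> t" "t \<le> u"
    have "(f has_real_derivative (t - 1 + exp (- t))) (at t)"
      unfolding f_def by (auto intro!: derivative_eq_intros)
    moreover have "0 \<le> t - 1 + exp (- t)"
      using exp_ge_add_one_self[of "- t"] by simp
    ultimately show "\<exists>y. (f has_real_derivative y) (at t) \<and> 0 \<le> y" by blast
  qed
  then show ?thesis by (simp add: f_def)
qed

text \<open>Here \<open>\<sigma>\<close> is the true and \<open>s\<close> the empirical standard
  deviation, \<open>D\<close> the error of the mean, and \<open>r\<close> will be
  \<open>sqrt (x / real n)\<close>. If the empirical radius were the smaller one, \<open>s\<close>
  would fall short of \<open>\<sigma>\<close> by a multiple of \<open>b * r\<close>, which is more
  than the lower tail bound \<open>var\<close> permits.\<close>

lemma bernstein_radius_le_empirical: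
  fixes \<sigma> s b D r :: real
  assumes s: "0 \<le> s" and r: "0 \<le> r" and b: "0 < b" and \<sigma>: "0 < \<sigma>" "\<sigma> \<le> b / 2"
    and D: "\<bar>D\<bar> \<le> sqrt 2 * \<sigma> * r + b * r\<^sup>2 / 3"
    and var: "\<sigma>\<^sup>2 \<le> s\<^sup>2 + D\<^sup>2 + sqrt 2 * b * \<sigma> * r"
  shows "sqrt 2 * \<sigma> * r + b * r\<^sup>2 / 3 \<le> sqrt 2 * s * r + 3 * b * r\<^sup>2"
proof (rule ccontr)
  define q where "q = sqrt (2::real)"
  have q2: "q * q = 2" by (simp add: q_def)
  have q: "1414 / 1000 \<le> q" "q \<le> 1415 / 1000"
    unfolding q_def by (rule real_le_rsqrt real_le_lsqrt; simp add: power2_eq_square)+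
  define y where "y = b * r"
  assume "\<not> ?thesis"
  \<comment> \<open>The coefficient 8/3 is the 3 of the empirical radius minus the 1/3 of
    Bernstein's bound; division by \<open>q\<close> turns it into \<open>4 / 3 * q\<close>, as
    \<open>q * q = 2\<close>.\<close>
  then have *: "q * s * r + 8 / 3 * b * r\<^sup>2 < q * \<sigma> * r" by (simp add: q_def algebra_simps)
  then have "r \<noteq> 0" by auto
  then have rpos: "0 < r" using r by simp
  then have ypos: "0 < y" using b by (simp add: y_def)
  have "(q * s + 8 / 3 * y) * r < (q * \<sigma>) * r" using * by (simp add: y_def power2_eq_square algebra_simps)
  then have "q * s + 8 / 3 * y < q * \<sigma>" using rpos by (simp only: mult_less_cancel_right_pos)
  then have "q * (q * s + 8 / 3 * y) < q * (q * \<sigma>)" using q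
    by (intro mult_strict_left_mono) auto
  then have "(q * q) * s + 8 / 3 * q * y < (q * q) * \<sigma>" by (simp add: algebra_simps)
  then have s_less: "s + 4 / 3 * q * y < \<sigma>" unfolding q2 by simp
  have y\<sigma>: "y \<le> 5305 / 10000 * \<sigma>"
  proof -
    have "4 / 3 * (1414 / 1000) * y \<le> 4 / 3 * q * y" using q ypos by (intro mult_right_mono) auto
    then show ?thesis using s_less s \<sigma> by simp
  qed
  have "s\<^sup>2 \<le> (\<sigma> - 4 / 3 * q * y)\<^sup>2"
    using s s_less by (intro power_mono) auto
  also have "\<dots> = \<sigma>\<^sup>2 - 8 / 3 * q * (y * \<sigma>) + 16 / 9 * (q * q) * y\<^sup>2"
    by (simp add: power2_eq_square algebra_simps)
  finally have s2: "s\<^sup>2 \<le> \<sigma>\<^sup>2 - 8 / 3 * q * (y * \<sigma>) + 32 / 9 * y\<^sup>2" by (simp add: q2)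
  \<comment> \<open>\<open>D\<close> is negligible: each of the two factors
    \<open>r * \<sigma>\<close> is at most \<open>y / 2\<close> by
    \<open>\<sigma> \<le> b / 2\<close>, and one \<open>y\<close> is then exchanged for
    \<open>\<sigma>\<close> by \<open>y\<sigma>\<close>.\<close>
  have "D\<^sup>2 \<le> (q * \<sigma> * r + b * r\<^sup>2 / 3)\<^sup>2"
    using D by (simp add: q_def abs_le_square_iff[symmetric])
  also have "\<dots> = r\<^sup>2 * (q * \<sigma> + y / 3)\<^sup>2"
    by (simp add: y_def power2_eq_square algebra_simps)
  also have "\<dots> \<le> r\<^sup>2 * (1415 / 1000 * \<sigma> + 5305 / 10000 * \<sigma> / 3)\<^sup>2"
    using q y\<sigma> \<sigma> ypos by (intro mult_left_mono power_mono add_mono mult_right_mono) auto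
  also have "\<dots> \<le> r\<^sup>2 * (254 / 100 * \<sigma>\<^sup>2)"
    by (intro mult_left_mono) (auto simp: power2_eq_square field_simps)
  also have "\<dots> = 254 / 100 * (r * \<sigma>)\<^sup>2" by (simp add: power2_eq_square)
  also have "(r * \<sigma>)\<^sup>2 \<le> (r * \<sigma>) * (y / 2)"
    unfolding power2_eq_square
  proof (rule mult_left_mono)
    show "r * \<sigma> \<le> y / 2" using mult_left_mono[OF \<sigma>(2) r] by (simp add: y_def mult_ac)
  qed (use r \<sigma> in auto)
  also have "(r * \<sigma>) * (y / 2) \<le> (r * (b / 2)) * (y / 2)"
    using \<sigma> r ypos by (intro mult_right_mono mult_left_mono) auto
  also have "(r * (b / 2)) * (y / 2) = (y * y) / 4" by (simp add: y_def)
  also have "y * y \<le> y * (5305 / 10000 * \<sigma>)"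
    using y\<sigma> ypos by (intro mult_left_mono) auto
  finally have D2: "D\<^sup>2 \<le> 337 / 1000 * (y * \<sigma>)" using mult_pos_pos[OF ypos \<sigma>(1)] by (simp add: mult_ac)
  have y2: "y\<^sup>2 \<le> 5305 / 10000 * (y * \<sigma>)"
    using mult_left_mono[OF y\<sigma>, of y] ypos by (simp add: power2_eq_square mult_ac)
  have "\<sigma>\<^sup>2 \<le> s\<^sup>2 + D\<^sup>2 + q * (y * \<sigma>)"
    using var by (simp add: q_def y_def mult_ac)
  then have "5 / 3 * (q * (y * \<sigma>)) \<le> 32 / 9 * y\<^sup>2 + D\<^sup>2"
    using s2 by simp
  moreover have "1414 / 1000 * (y * \<sigma>) \<le> q * (y * \<sigma>)"
    using q ypos \<sigma> by (intro mult_right_mono) auto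
  moreover have "0 < y * \<sigma>" using ypos \<sigma> by simp
  \<comment> \<open>In units of \<open>y * \<sigma>\<close> the left side is at least 5/3 * 1.414,
    about 2.36, and the right side at most 32/9 * 0.5305 + 0.337, about 2.22.\<close>
  ultimately show False using D2 y2 by simp
qed

text \<open>Conditioning on the first sample; the rest is again an i.i.d. sequence of the same law.
  The maximal inequalities are inductions along this equation and use no stopping times.\<close>

lemma (in sequence_space) emeasure_S_iter:
  assumes A [measurable]: "A \<in> sets S"
  shows "emeasure S A = (\<integral>\<^sup>+x. emeasure S {\<omega> \<in> space S. case_nat x \<omega> \<in> A} \<partial>M)"
proof -
  have S: "sigma_finite_measure S"
    by (intro prob_space_imp_sigma_finite prob_space_PiM M.prob_space_axioms)
  have [measurable]: "(\<lambda>(s, \<omega>). case_nat s \<omega>) \<in> M \<Otimes>\<^sub>M S \<rightarrow>\<^sub>M S" by measurable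
  have "emeasure S A = emeasure (distr (M \<Otimes>\<^sub>M S) S (\<lambda>(s, \<omega>). case_nat s \<omega>)) A"
    by (simp add: PiM_iter)
  also have "\<dots> = emeasure (M \<Otimes>\<^sub>M S) ((\<lambda>(s, \<omega>). case_nat s \<omega>) -` A \<inter> space (M \<Otimes>\<^sub>M S))"
    by (rule emeasure_distr) (use A in measurable)
  also have "\<dots> = (\<integral>\<^sup>+x. emeasure S (Pair x -` ((\<lambda>(s, \<omega>). case_nat s \<omega>) -` A \<inter> space (M \<Otimes>\<^sub>M S))) \<partial>M)"
    by (rule sigma_finite_measure.emeasure_pair_measure_alt[OF S]) measurable
  also have "\<dots> = (\<integral>\<^sup>+x. emeasure S {\<omega> \<in> space S. case_nat x \<omega> \<in> A} \<partial>M)"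
    by (intro nn_integral_cong arg_cong2[where f = emeasure]) (auto simp: space_pair_measure)
  finally show ?thesis .
qed

section \<open>Ville's inequality for products of independent factors\<close>

context sequence_space
begin

lemma prob_space_S: "prob_space S"
  by (intro prob_space_PiM M.prob_space_axioms)

text \<open>As long as the capital \<open>a\<close> is below 1, the first factor can be absorbed
  into it, and the mean of that factor, at most 1, closes the induction. Both \<open>a\<close> and
  the index-dependent \<open>f\<close> are generalised because the step turns them into
  \<open>a * f 0 x\<close> and \<open>\<lambda>i. f (Suc i)\<close>.\<close>

lemma ville_finite:
  fixes f :: "nat \<Rightarrow> 'a \<Rightarrow> ennreal"
  assumes "\<And>i. f i \<in> borel_measurable M" "\<And>i. (\<integral>\<^sup>+x. f i x \<partial>M) \<le> 1"
  shows "emeasure S {\<omega> \<in> space S. \<exists>t\<le>N. 1 \<le> a * (\<Prod>i<t. f i (\<omega> i))} \<le> a"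
  using assms
proof (induction N arbitrary: a f)
  case 0
  then show ?case using prob_space.emeasure_le_1[OF prob_space_S] order_trans
    by (cases "1 \<le> a") (auto intro: order_trans)
next
  case (Suc N)
  note [measurable] = Suc.prems(1)
  show ?case
  proof (cases "1 \<le> a")
    case True
    then show ?thesis using prob_space.emeasure_le_1[OF prob_space_S] order_trans by blast
  next
    case False
    have "emeasure S {\<omega> \<in> space S. \<exists>t\<le>Suc N. 1 \<le> a * (\<Prod>i<t. f i (\<omega> i))}
        = (\<integral>\<^sup>+x. emeasure S {\<omega> \<in> space S. case_nat x \<omega> \<in>
              {\<omega> \<in> space S. \<exists>t\<le>Suc N. 1 \<le> a * (\<Prod>i<t. f i (\<omega> i))}} \<partial>M)"
      by (rule emeasure_S_iter) measurable
    also have "\<dots> \<le> (\<integral>\<^sup>+x. a * f 0 x \<partial>M)"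
    proof (rule nn_integral_mono)
      fix x assume "x \<in> space M"
      have "{\<omega> \<in> space S. case_nat x \<omega> \<in> {\<omega> \<in> space S. \<exists>t\<le>Suc N. 1 \<le> a * (\<Prod>i<t. f i (\<omega> i))}}
        \<subseteq> {\<omega> \<in> space S. \<exists>t\<le>N. 1 \<le> (a * f 0 x) * (\<Prod>i<t. f (Suc i) (\<omega> i))}"
      proof safe
        fix \<omega> t assume "\<omega> \<in> space S" "t \<le> Suc N" and *: "1 \<le> a * (\<Prod>i<t. f i (case_nat x \<omega> i))"
        then obtain u where "t = Suc u" using False by (cases t) auto
        then show "\<exists>t\<le>N. 1 \<le> (a * f 0 x) * (\<Prod>i<t. f (Suc i) (\<omega> i))"
          using * \<open>t \<le> Suc N\<close> by (auto simp: prod.lessThan_Suc_shift mult.assoc simp del: prod.lessThan_Suc)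
      qed
      then have "emeasure S {\<omega> \<in> space S. case_nat x \<omega> \<in> {\<omega> \<in> space S. \<exists>t\<le>Suc N. 1 \<le> a * (\<Prod>i<t. f i (\<omega> i))}}
        \<le> emeasure S {\<omega> \<in> space S. \<exists>t\<le>N. 1 \<le> (a * f 0 x) * (\<Prod>i<t. f (Suc i) (\<omega> i))}"
        by (rule emeasure_mono) measurable
      also have "\<dots> \<le> a * f 0 x" by (rule Suc.IH) (use Suc.prems in auto)
      finally show "emeasure S {\<omega> \<in> space S. case_nat x \<omega> \<in> {\<omega> \<in> space S. \<exists>t\<le>Suc N. 1 \<le> a * (\<Prod>i<t. f i (\<omega> i))}}
         \<le> a * f 0 x" .
    qed
    also have "\<dots> = a * (\<integral>\<^sup>+x. f 0 x \<partial>M)" by (rule nn_integral_cmult) measurable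
    also have "\<dots> \<le> a * 1" by (intro mult_left_mono Suc.prems) auto
    finally show ?thesis by simp
  qed
qed

text \<open>Play the \<open>f\<close>-product with capital \<open>a\<close> until the
  \<open>g\<close>-product with capital \<open>b\<close> is no larger, then switch to the latter.
  The switch never gains, so the combined process is still a supermartingale starting at
  \<open>a\<close> or below, and it reaches 1 on the event. The case \<open>b \<le> a\<close> of the
  induction is the moment of the switch.\<close>

lemma two_stage_ville_finite:
  fixes f g :: "nat \<Rightarrow> 'a \<Rightarrow> ennreal"
  assumes "\<And>i. f i \<in> borel_measurable M" "\<And>i. (\<integral>\<^sup>+x. f i x \<partial>M) \<le> 1"
    and "\<And>i. g i \<in> borel_measurable M" "\<And>i. (\<integral>\<^sup>+x. g i x \<partial>M) \<le> 1"
  shows "emeasure S {\<omega> \<in> space S. \<exists>n\<le>N. \<exists>j\<le>n.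
      b * (\<Prod>i<j. g i (\<omega> i)) \<le> a * (\<Prod>i<j. f i (\<omega> i)) \<and> 1 \<le> b * (\<Prod>i<n. g i (\<omega> i))} \<le> a"
  using assms
proof (induction N arbitrary: a b f g)
  case 0
  show ?case
  proof (cases "1 \<le> a")
    case True
    then show ?thesis using prob_space.emeasure_le_1[OF prob_space_S] order_trans by blast
  next
    case False
    then have "\<not> (b \<le> a \<and> 1 \<le> b)" by (meson order_trans)
    then have empty: "{\<omega> \<in> space S. b \<le> a \<and> 1 \<le> b} = {}" by blast
    show ?thesis by (simp add: empty)
  qed
next
  case (Suc N)
  note [measurable] = Suc.prems(1,3)
  let ?E = "\<lambda>N (a :: ennreal) b f g. {\<omega> \<in> space S. \<exists>n\<le>N. \<exists>j\<le>n.
      b * (\<Prod>i<j. g i (\<omega> i)) \<le> a * (\<Prod>i<j. f i (\<omega> i)) \<and> 1 \<le> b * (\<Prod>i<n. g i (\<omega> i))}"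
  have meas: "?E N a b f g \<in> sets S"
    if [measurable]: "\<And>i. f i \<in> borel_measurable M" "\<And>i. g i \<in> borel_measurable M" for N a b f g
    by measurable
  show ?case
  proof (cases "b \<le> a")
    case True
    have "emeasure S (?E (Suc N) a b f g) \<le> emeasure S {\<omega> \<in> space S. \<exists>t\<le>Suc N. 1 \<le> b * (\<Prod>i<t. g i (\<omega> i))}"
    proof (rule emeasure_mono)
      show "?E (Suc N) a b f g \<subseteq> {\<omega> \<in> space S. \<exists>t\<le>Suc N. 1 \<le> b * (\<Prod>i<t. g i (\<omega> i))}" by blast
    qed measurable
    also have "\<dots> \<le> b" by (rule ville_finite) (use Suc.prems in auto)
    finally show ?thesis using True by simp
  next
    case False
    have "emeasure S (?E (Suc N) a b f g)
        = (\<integral>\<^sup>+x. emeasure S {\<omega> \<in> space S. case_nat x \<omega> \<in> ?E (Suc N) a b f g} \<partial>M)"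
      by (rule emeasure_S_iter[OF meas]) (use Suc.prems in auto)
    also have "\<dots> \<le> (\<integral>\<^sup>+x. a * f 0 x \<partial>M)"
    proof (rule nn_integral_mono)
      fix x assume "x \<in> space M"
      let ?F = "?E N (a * f 0 x) (b * g 0 x) (\<lambda>i. f (Suc i)) (\<lambda>i. g (Suc i))"
      have "{\<omega> \<in> space S. case_nat x \<omega> \<in> ?E (Suc N) a b f g} \<subseteq> ?F"
      proof safe
        fix \<omega> n j assume *: "n \<le> Suc N" "j \<le> n" "b * (\<Prod>i<j. g i (case_nat x \<omega> i)) \<le> a * (\<Prod>i<j. f i (case_nat x \<omega> i))"
          "1 \<le> b * (\<Prod>i<n. g i (case_nat x \<omega> i))"
        then obtain u where u: "j = Suc u" using False by (cases j) auto
        then obtain v where v: "n = Suc v" using * by (cases n) auto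
        show "\<exists>n\<le>N. \<exists>j\<le>n. (b * g 0 x) * (\<Prod>i<j. g (Suc i) (\<omega> i)) \<le> (a * f 0 x) * (\<Prod>i<j. f (Suc i) (\<omega> i)) \<and>
            1 \<le> (b * g 0 x) * (\<Prod>i<n. g (Suc i) (\<omega> i))"
          using * u v by (intro exI[of _ v] conjI exI[of _ u])
            (auto simp: prod.lessThan_Suc_shift mult.assoc simp del: prod.lessThan_Suc)
      qed
      then have "emeasure S {\<omega> \<in> space S. case_nat x \<omega> \<in> ?E (Suc N) a b f g} \<le> emeasure S ?F"
        by (rule emeasure_mono[OF _ meas]) (use Suc.prems in auto)
      also have "\<dots> \<le> a * f 0 x" by (rule Suc.IH) (use Suc.prems in auto)
      finally show "emeasure S {\<omega> \<in> space S. case_nat x \<omega> \<in> ?E (Suc N) a b f g} \<le> a * f 0 x" .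
    qed
    also have "\<dots> = a * (\<integral>\<^sup>+x. f 0 x \<partial>M)" by (rule nn_integral_cmult) measurable
    also have "\<dots> \<le> a * 1" by (intro mult_left_mono Suc.prems) auto
    finally show ?thesis by simp
  qed
qed

lemma emeasure_bounded_horizon_limit:
  fixes P :: "nat \<Rightarrow> (nat \<Rightarrow> 'a) \<Rightarrow> bool"
  assumes [measurable]: "\<And>n. Measurable.pred S (P n)"
    and le: "\<And>N. emeasure S {\<omega> \<in> space S. \<exists>n\<le>N. P n \<omega>} \<le> a"
  shows "emeasure S {\<omega> \<in> space S. \<exists>n. P n \<omega>} \<le> a"
proof -
  have "{\<omega> \<in> space S. \<exists>n. P n \<omega>} = (\<Union>N::nat. {\<omega> \<in> space S. \<exists>n\<le>N. P n \<omega>})" by auto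
  also have "emeasure S \<dots> = (SUP N. emeasure S {\<omega> \<in> space S. \<exists>n\<le>N. P n \<omega>})"
    by (rule SUP_emeasure_incseq[symmetric]) (auto simp: incseq_def intro: order_trans)
  also have "\<dots> \<le> a" by (rule SUP_least) (rule le)
  finally show ?thesis .
qed

text \<open>The sample with index 0 is skipped, as in the procedure.\<close>

lemma exp_walk_ville:
  fixes Y :: "'a \<Rightarrow> real" and y :: real
  assumes [measurable]: "Y \<in> borel_measurable M" and "(\<integral>\<^sup>+x. ennreal (exp (Y x)) \<partial>M) \<le> 1"
  shows "emeasure S {\<omega> \<in> space S. \<exists>t::nat. y \<le> (\<Sum>i=1..t. Y (\<omega> i))} \<le> ennreal (exp (- y))"
proof -
  define f where "f = (\<lambda>i x. if i = (0::nat) then 1 else ennreal (exp (Y x)))"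
  have f: "f i \<in> borel_measurable M" "(\<integral>\<^sup>+x. f i x \<partial>M) \<le> 1" for i
    using assms(2) M.emeasure_space_1 by (cases "i = 0"; simp add: f_def)+
  note [measurable] = f(1)
  have prod: "(\<Prod>i<Suc t. f i (\<omega> i)) = ennreal (exp (\<Sum>i=1..t. Y (\<omega> i)))" for t and \<omega> :: "nat \<Rightarrow> 'a"
  proof -
    have "(\<Prod>i<Suc t. f i (\<omega> i)) = (\<Prod>i\<in>{1..t}. ennreal (exp (Y (\<omega> i))))"
      unfolding f_def by (rule prod.mono_neutral_cong_right) auto
    then show ?thesis by (simp add: prod_ennreal exp_sum)
  qed
  have "emeasure S {\<omega> \<in> space S. \<exists>t::nat. y \<le> (\<Sum>i=1..t. Y (\<omega> i))}
      \<le> emeasure S {\<omega> \<in> space S. \<exists>t. 1 \<le> ennreal (exp (- y)) * (\<Prod>i<t. f i (\<omega> i))}"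
  proof (rule emeasure_mono, safe)
    fix \<omega> :: "nat \<Rightarrow> 'a" and t assume "y \<le> (\<Sum>i=1..t. Y (\<omega> i))"
    then have "1 \<le> ennreal (exp (- y)) * (\<Prod>i<Suc t. f i (\<omega> i))"
      unfolding prod by (simp flip: ennreal_mult exp_add)
    then show "\<exists>t. 1 \<le> ennreal (exp (- y)) * (\<Prod>i<t. f i (\<omega> i))" by blast
  qed measurable
  also have "\<dots> \<le> ennreal (exp (- y))"
    by (rule emeasure_bounded_horizon_limit) (measurable, rule ville_finite[OF f])
  finally show ?thesis .
qed

text \<open>The first stage starts with capital \<open>exp (- y)\<close> and the second with 1, so
  \<open>y\<close> is the margin by which the first exponent has to lead at the switch.\<close>

lemma exp_walk_two_stage_ville:
  fixes Y Z :: "'a \<Rightarrow> real" and y :: real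
  assumes [measurable]: "Y \<in> borel_measurable M" and Y: "(\<integral>\<^sup>+x. ennreal (exp (Y x)) \<partial>M) \<le> 1"
    and [measurable]: "Z \<in> borel_measurable M" and Z: "(\<integral>\<^sup>+x. ennreal (exp (Z x)) \<partial>M) \<le> 1"
  shows "emeasure S {\<omega> \<in> space S. \<exists>n::nat. \<exists>j\<le>n. y + (\<Sum>i=1..j. Z (\<omega> i)) \<le> (\<Sum>i=1..j. Y (\<omega> i)) \<and>
      0 \<le> (\<Sum>i=1..n. Z (\<omega> i))} \<le> ennreal (exp (- y))"
proof -
  define lift where "lift = (\<lambda>(Y :: 'a \<Rightarrow> real) i x. if i = (0::nat) then 1 else ennreal (exp (Y x)))"
  have lift: "lift Y i \<in> borel_measurable M" "(\<integral>\<^sup>+x. lift Y i x \<partial>M) \<le> 1"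
    "lift Z i \<in> borel_measurable M" "(\<integral>\<^sup>+x. lift Z i x \<partial>M) \<le> 1" for i
    using Y Z M.emeasure_space_1 by (cases "i = 0"; simp add: lift_def)+
  note [measurable] = lift(1,3)
  have prod: "(\<Prod>i<Suc t. lift Y i (\<omega> i)) = ennreal (exp (\<Sum>i=1..t. Y (\<omega> i)))" for t Y and \<omega> :: "nat \<Rightarrow> 'a"
  proof -
    have "(\<Prod>i<Suc t. lift Y i (\<omega> i)) = (\<Prod>i\<in>{1..t}. ennreal (exp (Y (\<omega> i))))"
      unfolding lift_def by (rule prod.mono_neutral_cong_right) auto
    then show ?thesis by (simp add: prod_ennreal exp_sum)
  qed
  let ?P = "\<lambda>(n::nat) (\<omega> :: nat \<Rightarrow> 'a). \<exists>j\<le>n. 1 * (\<Prod>i<j. lift Z i (\<omega> i)) \<le> ennreal (exp (- y)) * (\<Prod>i<j. lift Y i (\<omega> i)) \<and>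
      1 \<le> 1 * (\<Prod>i<n. lift Z i (\<omega> i))"
  have pred [measurable]: "Measurable.pred S (?P n)" for n by measurable
  have "emeasure S {\<omega> \<in> space S. \<exists>n::nat. \<exists>j\<le>n. y + (\<Sum>i=1..j. Z (\<omega> i)) \<le> (\<Sum>i=1..j. Y (\<omega> i)) \<and>
      0 \<le> (\<Sum>i=1..n. Z (\<omega> i))} \<le> emeasure S {\<omega> \<in> space S. \<exists>n. ?P n \<omega>}"
  proof (rule emeasure_mono, safe)
    fix \<omega> :: "nat \<Rightarrow> 'a" and n j assume *: "j \<le> n" "y + (\<Sum>i=1..j. Z (\<omega> i)) \<le> (\<Sum>i=1..j. Y (\<omega> i))"
      "0 \<le> (\<Sum>i=1..n. Z (\<omega> i))"
    have "Suc j \<le> Suc n" using * by simp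
    moreover have "1 * (\<Prod>i<Suc j. lift Z i (\<omega> i)) \<le> ennreal (exp (- y)) * (\<Prod>i<Suc j. lift Y i (\<omega> i))"
      unfolding prod using * by (simp flip: ennreal_mult exp_add)
    moreover have "1 \<le> 1 * (\<Prod>i<Suc n. lift Z i (\<omega> i))"
      unfolding prod using * by simp
    ultimately show "\<exists>n. ?P n \<omega>" by blast
  qed measurable
  also have "\<dots> \<le> ennreal (exp (- y))"
    by (rule emeasure_bounded_horizon_limit[OF pred two_stage_ville_finite[OF lift]])
  finally show ?thesis .
qed

end

text \<open>The compensator \<open>g\<close> absorbs the mean of the majorant through
  \<open>1 + g \<le> exp g\<close>; this produces the factors of mean at most 1 that Ville's
  inequality asks for.\<close>

lemma (in prob_space) nn_integral_exp_le_one: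
  fixes Z W :: "'a \<Rightarrow> real"
  assumes [measurable]: "Z \<in> borel_measurable M" and W: "integrable M W"
    and le: "AE x in M. exp (Z x) \<le> 1 + W x" and g: "expectation W \<le> g"
  shows "(\<integral>\<^sup>+x. ennreal (exp (Z x - g)) \<partial>M) \<le> 1"
proof -
  have nonneg: "AE x in M. 0 \<le> 1 + W x"
    using le by eventually_elim (meson exp_ge_zero order_trans)
  have "(\<integral>\<^sup>+x. ennreal (exp (Z x - g)) \<partial>M) \<le> (\<integral>\<^sup>+x. ennreal (exp (- g) * (1 + W x)) \<partial>M)"
    using le by (intro nn_integral_mono_AE, eventually_elim)
      (auto simp: exp_diff exp_minus divide_inverse mult.commute intro!: ennreal_leI mult_left_mono)
  also have "\<dots> = ennreal (exp (- g) * (1 + expectation W))"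
  proof (subst nn_integral_eq_integral)
    show "AE x in M. 0 \<le> exp (- g) * (1 + W x)" using nonneg by eventually_elim simp
  qed (use W in \<open>auto simp: prob_space\<close>)
  also have "\<dots> \<le> ennreal (exp (- g) * exp g)"
    using g exp_ge_add_one_self[of g] by (intro ennreal_leI mult_left_mono) (linarith, simp)
  finally show ?thesis by (simp flip: exp_add)
qed

section \<open>Bernstein inequalities uniform in time\<close>

locale centered_bounded_walk = sequence_space M for M :: "'a measure" +
  fixes Y :: "'a \<Rightarrow> real" and b v :: real
  assumes Y_measurable [measurable]: "Y \<in> borel_measurable M"
    and Y_bounded: "AE x in M. \<bar>Y x\<bar> \<le> b"
    and Y_centered: "(\<integral>x. Y x \<partial>M) = 0"
    and Y_variance: "(\<integral>x. (Y x)\<^sup>2 \<partial>M) = v"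
    and v_pos: "0 < v"
begin

lemma integrable_Y_power: "integrable M (\<lambda>x. Y x ^ k)"
  by (rule M.integrable_const_bound[where B = "b ^ k"])
    (use Y_bounded in \<open>auto elim!: eventually_mono simp: power_abs intro!: power_mono\<close>)

lemma integrable_Y: "integrable M Y"
  using integrable_Y_power[of 1] by simp

lemma b_pos: "0 < b"
proof (rule ccontr)
  assume "\<not> 0 < b"
  have "AE x in M. (Y x)\<^sup>2 = 0"
    using Y_bounded
  proof eventually_elim
    case (elim x)
    then show ?case using \<open>\<not> 0 < b\<close> by simp
  qed
  then have "(\<integral>x. (Y x)\<^sup>2 \<partial>M) = (\<integral>x. 0 \<partial>M)" by (intro integral_cong_AE) auto
  then show False using Y_variance v_pos by simp
qed

text \<open>Bernstein's bound for the logarithmic moment generating function of \<open>Y\<close> at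
  \<open>\<eta>\<close> and at \<open>- \<eta>\<close>, for \<open>0 \<le> \<eta>\<close> and
  \<open>\<eta> * b < 3\<close>.\<close>

definition rate :: "real \<Rightarrow> real" where
  "rate \<eta> = \<eta>\<^sup>2 * v / (2 * (1 - \<eta> * b / 3))"

text \<open>\<open>Z\<close> only has to lie below the tilted increment, since the increments in
  \<open>excursion_return_maximal\<close> carry a drift as well; \<open>\<eta>\<close> may be
  negative because the second stage there tilts downwards.\<close>

lemma exp_moment:
  assumes "\<bar>\<eta>\<bar> = l" "l * b < 3" "\<And>x. Z x \<le> \<eta> * Y x - rate l" and [measurable]: "Z \<in> borel_measurable M"
  shows "(\<integral>\<^sup>+x. ennreal (exp (Z x)) \<partial>M) \<le> 1"
proof -
  define q where "q = \<eta>\<^sup>2 / (2 * (1 - l * b / 3))"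
  have "(\<integral>\<^sup>+x. ennreal (exp (Z x)) \<partial>M) \<le> (\<integral>\<^sup>+x. ennreal (exp (\<eta> * Y x - rate l)) \<partial>M)"
    using assms(3) by (intro nn_integral_mono ennreal_leI) simp
  also have "\<dots> \<le> 1"
  proof (rule M.nn_integral_exp_le_one[where W = "\<lambda>x. \<eta> * Y x + q * (Y x)\<^sup>2"])
    show "AE x in M. exp (\<eta> * Y x) \<le> 1 + (\<eta> * Y x + q * (Y x)\<^sup>2)"
      using Y_bounded
    proof eventually_elim
      case (elim x)
      have "exp (\<eta> * Y x) \<le> 1 + \<eta> * Y x + (\<eta> * Y x)\<^sup>2 / (2 * (1 - (l * b) / 3))"
        using assms(1,2) elim by (intro exp_le_quadratic_quotient) (auto simp: abs_mult intro!: mult_left_mono)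
      then show ?case by (simp add: q_def power_mult_distrib)
    qed
    have "\<eta>\<^sup>2 = l\<^sup>2" using assms(1) by auto
    then show "(\<integral>x. \<eta> * Y x + q * (Y x)\<^sup>2 \<partial>M) \<le> rate l"
      using integrable_Y integrable_Y_power[of 2] Y_centered Y_variance
      by (simp add: q_def rate_def)
  qed (use integrable_Y integrable_Y_power[of 2] in auto)
  finally show ?thesis .
qed

text \<open>The second-order term contains the fourth power of \<open>Y\<close>, which the range
  reduces to \<open>b\<^sup>2\<close> times the square.\<close>

lemma exp_moment_square:
  assumes "0 \<le> \<eta>"
  shows "(\<integral>\<^sup>+x. ennreal (exp (\<eta> * (v - (Y x)\<^sup>2) - \<eta>\<^sup>2 * b\<^sup>2 * v / 2)) \<partial>M) \<le> 1"
proof -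
  let ?g = "\<eta>\<^sup>2 * b\<^sup>2 * v / 2 - \<eta> * v"
  have "(\<integral>\<^sup>+x. ennreal (exp (- \<eta> * (Y x)\<^sup>2 - ?g)) \<partial>M) \<le> 1"
  proof (rule M.nn_integral_exp_le_one[where W = "\<lambda>x. - \<eta> * (Y x)\<^sup>2 + (\<eta>\<^sup>2 * b\<^sup>2 / 2) * (Y x)\<^sup>2"])
    show "AE x in M. exp (- \<eta> * (Y x)\<^sup>2) \<le> 1 + (- \<eta> * (Y x)\<^sup>2 + (\<eta>\<^sup>2 * b\<^sup>2 / 2) * (Y x)\<^sup>2)"
      using Y_bounded
    proof eventually_elim
      case (elim x)
      have sq: "(Y x)\<^sup>2 \<le> b\<^sup>2" using power_mono[OF elim, of 2] by simp
      have "exp (- (\<eta> * (Y x)\<^sup>2)) \<le> 1 - \<eta> * (Y x)\<^sup>2 + (\<eta> * (Y x)\<^sup>2)\<^sup>2 / 2"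
        using assms by (intro exp_minus_le_quadratic) auto
      also have "(\<eta> * (Y x)\<^sup>2)\<^sup>2 = \<eta>\<^sup>2 * ((Y x)\<^sup>2 * (Y x)\<^sup>2)"
        by (simp add: power_mult_distrib power2_eq_square)
      also have "\<dots> \<le> \<eta>\<^sup>2 * (b\<^sup>2 * (Y x)\<^sup>2)"
        using sq by (intro mult_left_mono mult_right_mono) auto
      finally show ?case by simp
    qed
    show "(\<integral>x. - \<eta> * (Y x)\<^sup>2 + (\<eta>\<^sup>2 * b\<^sup>2 / 2) * (Y x)\<^sup>2 \<partial>M) \<le> ?g"
      using integrable_Y_power[of 2] Y_variance by simp
  qed (use integrable_Y_power[of 2] in auto)
  then show ?thesis by (simp add: algebra_simps)
qed

text \<open>\<open>tilt\<close> minimises \<open>(y + T * rate \<eta>) / \<eta>\<close> over \<open>\<eta>\<close>.\<close>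

definition tilt :: "real \<Rightarrow> real \<Rightarrow> real" where
  "tilt T y = (let m = sqrt (2 * y / (T * v)) in m / (1 + m * b / 3))"

text \<open>By the third claim the minimum is the Bernstein boundary: a walk at that height pays for
  \<open>y\<close> and for the compensator over the whole horizon.\<close>

lemma tilt:
  assumes "0 < T" "0 < y"
  shows "0 < tilt T y" "tilt T y * b < 3"
    and "y + T * rate (tilt T y) = tilt T y * (sqrt (2 * T * v * y) + b * y / 3)"
proof -
  define m where "m = sqrt (2 * y / (T * v))"
  have m: "0 < m" using assms v_pos by (simp add: m_def)
  have den: "0 < 1 + m * b / 3" using m b_pos by (simp add: add_pos_pos)
  have l: "tilt T y = m / (1 + m * b / 3)" by (simp add: tilt_def m_def Let_def)
  show "0 < tilt T y" using m den l by simp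
  show "tilt T y * b < 3" using m den b_pos by (simp add: l field_simps)
  \<comment> \<open>The parametrisation by \<open>m\<close> inverts the denominator of
    \<open>rate\<close>, so that all later expressions are fractions over
    \<open>1 + m * b / 3\<close>.\<close>
  have one: "1 - tilt T y * b / 3 = 1 / (1 + m * b / 3)" using den by (simp add: l field_simps)
  have sq: "m\<^sup>2 * (T * v) = 2 * y" using assms v_pos by (simp add: m_def)
  have rt: "sqrt (2 * T * v * y) = m * (T * v)"
  proof (rule real_sqrt_unique)
    have "(m * (T * v))\<^sup>2 = (m\<^sup>2 * (T * v)) * (T * v)" by (simp add: power2_eq_square)
    then show "(m * (T * v))\<^sup>2 = 2 * T * v * y" by (simp add: sq)
  qed (use m assms v_pos in auto)
  have "T * rate (tilt T y) = T * ((m / (1 + m * b / 3))\<^sup>2 * v / (2 * (1 / (1 + m * b / 3))))"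
    unfolding rate_def one by (simp add: l)
  also have "\<dots> = m\<^sup>2 * (T * v) / 2 / (1 + m * b / 3)"
  proof -
    have "T * ((m / d)\<^sup>2 * v / (2 * (1 / d))) = m\<^sup>2 * (T * v) / 2 / d" if "0 < d" for d
      using that by (simp add: field_simps power2_eq_square)
    then show ?thesis using den by blast
  qed
  also have "\<dots> = y / (1 + m * b / 3)" by (simp add: sq)
  finally have rate: "T * rate (tilt T y) = y / (1 + m * b / 3)" .
  have "tilt T y * (sqrt (2 * T * v * y) + b * y / 3) = (m\<^sup>2 * (T * v) + m * b / 3 * y) / (1 + m * b / 3)"
    unfolding rt l by (simp add: power2_eq_square distrib_left add_divide_distrib)
  also have "\<dots> = (y + (1 + m * b / 3) * y) / (1 + m * b / 3)" unfolding sq by (simp add: algebra_simps)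
  also have "\<dots> = y + y / (1 + m * b / 3)" using den by (simp add: add_divide_distrib)
  finally show "y + T * rate (tilt T y) = tilt T y * (sqrt (2 * T * v * y) + b * y / 3)"
    using rate by simp
qed

lemma rate_nonneg: "\<eta> * b < 3 \<Longrightarrow> 0 \<le> rate \<eta>"
  using v_pos by (simp add: rate_def)

text \<open>The compensator \<open>t * rate l\<close> grows with \<open>t\<close>, so the tilt that
  is optimal at the horizon \<open>T\<close> serves all earlier times at once, without a union bound
  over \<open>t\<close>.\<close>

lemma bernstein_maximal:
  assumes "0 < T" "0 < y"
  shows "emeasure S {\<omega> \<in> space S. \<exists>t. real t \<le> T \<and> sqrt (2 * T * v * y) + b * y / 3 \<le> (\<Sum>i=1..t. Y (\<omega> i))}
    \<le> ennreal (exp (- y))"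
proof -
  note tilt = tilt[OF assms]
  define l where "l = tilt T y"
  have "emeasure S {\<omega> \<in> space S. \<exists>t. real t \<le> T \<and> sqrt (2 * T * v * y) + b * y / 3 \<le> (\<Sum>i=1..t. Y (\<omega> i))}
    \<le> emeasure S {\<omega> \<in> space S. \<exists>t::nat. y \<le> (\<Sum>i=1..t. (\<lambda>x. l * Y x - rate l) (\<omega> i))}"
  proof (rule emeasure_mono, safe)
    fix \<omega> :: "nat \<Rightarrow> 'a" and t assume *: "real t \<le> T" "sqrt (2 * T * v * y) + b * y / 3 \<le> (\<Sum>i=1..t. Y (\<omega> i))"
    have "y + T * rate l \<le> l * (\<Sum>i=1..t. Y (\<omega> i))"
      unfolding tilt(3)[folded l_def] using * tilt(1) by (intro mult_left_mono) (auto simp: l_def)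
    moreover have "real t * rate l \<le> T * rate l"
      using * rate_nonneg tilt(2) by (intro mult_right_mono) (auto simp: l_def)
    ultimately have "y \<le> (\<Sum>i=1..t. l * Y (\<omega> i) - rate l)"
      by (simp add: sum_subtractf sum_distrib_left)
    then show "\<exists>t. y \<le> (\<Sum>i=1..t. (\<lambda>x. l * Y x - rate l) (\<omega> i))" by blast
  qed measurable
  also have "\<dots> \<le> ennreal (exp (- y))"
    by (rule exp_walk_ville) (use tilt in \<open>auto simp: l_def intro!: exp_moment[where \<eta> = l and l = l]\<close>)
  finally show ?thesis .
qed

lemma variance_maximal:
  assumes "0 < T" "0 < y"
  shows "emeasure S {\<omega> \<in> space S. \<exists>t. real t \<le> T \<and> b * sqrt (2 * T * v * y) \<le> (\<Sum>i=1..t. v - (Y (\<omega> i))\<^sup>2)}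
    \<le> ennreal (exp (- y))"
proof -
  \<comment> \<open>The minimiser of \<open>(y + T * l\<^sup>2 * b\<^sup>2 * v / 2) / l\<close>;
    there the compensator over the horizon equals \<open>y\<close>, and the boundary is
    \<open>2 * y / l\<close>.\<close>
  define l where "l = sqrt (2 * y / (T * v)) / b"
  have l: "0 < l" using assms v_pos b_pos by (simp add: l_def)
  have sq: "l\<^sup>2 * b\<^sup>2 * (T * v) = 2 * y" using assms v_pos b_pos by (simp add: l_def power_divide)
  have rt: "b * sqrt (2 * T * v * y) = l * b\<^sup>2 * (T * v)"
  proof -
    have "sqrt (2 * T * v * y) = l * b * (T * v)"
    proof (rule real_sqrt_unique)
      have "(l * b * (T * v))\<^sup>2 = (l\<^sup>2 * b\<^sup>2 * (T * v)) * (T * v)" by (simp add: power2_eq_square)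
      then show "(l * b * (T * v))\<^sup>2 = 2 * T * v * y" by (simp add: sq)
    qed (use l assms v_pos b_pos in auto)
    then show ?thesis by (simp add: power2_eq_square)
  qed
  let ?Y = "\<lambda>x. l * (v - (Y x)\<^sup>2) - l\<^sup>2 * b\<^sup>2 * v / 2"
  have "emeasure S {\<omega> \<in> space S. \<exists>t. real t \<le> T \<and> b * sqrt (2 * T * v * y) \<le> (\<Sum>i=1..t. v - (Y (\<omega> i))\<^sup>2)}
    \<le> emeasure S {\<omega> \<in> space S. \<exists>t::nat. y \<le> (\<Sum>i=1..t. ?Y (\<omega> i))}"
  proof (rule emeasure_mono, safe)
    fix \<omega> :: "nat \<Rightarrow> 'a" and t assume *: "real t \<le> T" "b * sqrt (2 * T * v * y) \<le> (\<Sum>i=1..t. v - (Y (\<omega> i))\<^sup>2)"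
    have "l * (l * b\<^sup>2 * (T * v)) \<le> l * (\<Sum>i=1..t. v - (Y (\<omega> i))\<^sup>2)"
      using * l unfolding rt by (intro mult_left_mono) auto
    moreover have "l * (l * b\<^sup>2 * (T * v)) = 2 * y" using sq by (simp add: power2_eq_square mult_ac)
    moreover have "real t * (l\<^sup>2 * b\<^sup>2 * v / 2) \<le> T * (l\<^sup>2 * b\<^sup>2 * v / 2)"
      using * v_pos by (intro mult_right_mono) auto
    moreover have "T * (l\<^sup>2 * b\<^sup>2 * v / 2) = y" using sq by (simp add: mult_ac)
    moreover have "(\<Sum>i=1..t. ?Y (\<omega> i)) = l * (\<Sum>i=1..t. v - (Y (\<omega> i))\<^sup>2) - real t * (l\<^sup>2 * b\<^sup>2 * v / 2)"
      by (simp add: sum_subtractf right_diff_distrib flip: sum_distrib_left)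
    ultimately have "y \<le> (\<Sum>i=1..t. ?Y (\<omega> i))" by linarith
    then show "\<exists>t. y \<le> (\<Sum>i=1..t. ?Y (\<omega> i))" by blast
  qed measurable
  also have "\<dots> \<le> ennreal (exp (- y))"
    by (rule exp_walk_ville) (use l exp_moment_square[of l] in auto)
  finally show ?thesis .
qed

text \<open>
  Tilting the walk down to \<open>\<eta> - \<theta>\<close> pays for the return below 0, where \<open>\<theta>\<close> is a
  lower bound of the Lundberg exponent of the drift \<open>\<mu>\<close>: the slope \<open>rate u / u\<close> is
  superadditive in \<open>u\<close>.
\<close>

lemma rate_tilt_split:
  assumes "0 < \<eta>" "\<eta> * b < 3" "0 < \<mu>"
  obtains \<theta> where "0 < \<theta>" "\<theta> \<le> \<eta>" "rate \<theta> \<le> \<theta> * \<mu>" "(\<eta> - \<theta>) * \<mu> + rate (\<eta> - \<theta>) \<le> rate \<eta>"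
proof -
  define k where "k = (\<lambda>u. u * v / (2 * (1 - u * b / 3)))"
  have rate: "rate u = u * k u" for u by (simp add: rate_def k_def power2_eq_square)
  have k_le: "k s \<le> s * v / (2 * (1 - u * b / 3))" if "0 \<le> s" "s \<le> u" "u * b < 3" for s u
  proof -
    have "s * b \<le> u * b" using that b_pos by (intro mult_right_mono) auto
    then have "u * b / 3 < 1" "s * b / 3 \<le> u * b / 3"
      using that(3) by (simp_all add: mult.commute)
    then have "0 < 2 * (1 - u * b / 3)" "2 * (1 - u * b / 3) \<le> 2 * (1 - s * b / 3)"
      by (simp_all add: mult.commute)
    then show ?thesis unfolding k_def using that v_pos by (intro frac_le mult_nonneg_nonneg) simp_all
  qed
  have pos: "0 < 1 - u * b / 3" if "u * b < 3" for u using that by (simp add: mult.commute)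
  \<comment> \<open>The positive root of \<open>rate \<theta> = \<theta> * \<mu>\<close>: Lundberg's
    equation with \<open>rate\<close> in place of the logarithmic moment generating
    function.\<close>
  define \<theta>0 where "\<theta>0 = 6 * \<mu> / (3 * v + 2 * \<mu> * b)"
  have den: "0 < 3 * v + 2 * \<mu> * b" using v_pos b_pos assms by (simp add: add_pos_pos)
  have \<theta>0: "0 < \<theta>0" "\<theta>0 * b < 3" "k \<theta>0 = \<mu>"
  proof -
    show "0 < \<theta>0" using den assms by (simp add: \<theta>0_def)
    show "\<theta>0 * b < 3" using den v_pos by (simp add: \<theta>0_def field_simps)
    have "1 - \<theta>0 * b / 3 = 3 * v / (3 * v + 2 * \<mu> * b)" using den by (simp add: \<theta>0_def field_simps)
    moreover have "6 * \<mu> / d * v / (2 * (3 * v / d)) = \<mu>" if "0 < d" for d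
      using that v_pos by (simp add: field_simps)
    ultimately show "k \<theta>0 = \<mu>" using den unfolding k_def by (metis \<theta>0_def)
  qed
  show ?thesis
  proof (cases "\<theta>0 \<le> \<eta>")
    case True
    \<comment> \<open>Both denominators are replaced by the smaller one that belongs to
      \<open>\<eta>\<close>; after that the two slopes add up exactly.\<close>
    have split: "k (\<eta> - \<theta>0) + k \<theta>0 \<le> k \<eta>"
    proof -
      have "k (\<eta> - \<theta>0) + k \<theta>0 \<le> (\<eta> - \<theta>0) * v / (2 * (1 - \<eta> * b / 3)) + \<theta>0 * v / (2 * (1 - \<eta> * b / 3))"
        using \<theta>0 True assms by (intro add_mono k_le) auto
      also have "\<dots> = k \<eta>" by (simp add: k_def left_diff_distrib flip: add_divide_distrib)
      finally show ?thesis .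
    qed
    have "(\<eta> - \<theta>0) * \<mu> + rate (\<eta> - \<theta>0) = (\<eta> - \<theta>0) * (k (\<eta> - \<theta>0) + k \<theta>0)"
      by (simp add: rate \<theta>0(3) algebra_simps)
    also have "\<dots> \<le> (\<eta> - \<theta>0) * k \<eta>" using split True by (intro mult_left_mono) auto
    also have "\<dots> \<le> rate \<eta>"
      unfolding rate using \<theta>0 assms v_pos pos[OF assms(2)] by (intro mult_right_mono) (auto simp: k_def)
    finally show ?thesis using that[of \<theta>0] True \<theta>0 by (simp add: rate)
  next
    \<comment> \<open>The drift is strong compared with \<open>\<eta>\<close>: the whole tilt goes
      into the second stage, and the first keeps none.\<close>
    case False
    have "k \<eta> \<le> \<eta> * v / (2 * (1 - \<theta>0 * b / 3))"
      using False \<theta>0 assms by (intro k_le) auto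
    also have "\<dots> \<le> k \<theta>0"
      unfolding k_def using False pos[OF \<theta>0(2)] v_pos by (intro divide_right_mono mult_right_mono) auto
    finally have "k \<eta> \<le> \<mu>" using \<theta>0 by simp
    then have "rate \<eta> \<le> \<eta> * \<mu>" using assms by (simp add: rate)
    moreover have "rate (\<eta> - \<eta>) \<le> rate \<eta>" using rate_nonneg[OF assms(2)] by (simp add: rate)
    ultimately show ?thesis using that[of \<eta>] assms by simp
  qed
qed

text \<open>With positive drift it is not unlikely to climb over the boundary, only to come back
  afterwards. Write \<open>R\<close> for the walk. The exponents
  \<open>(l - \<theta>) * R - j * rate l\<close> and \<open>- \<theta> * R\<close> of the two stages
  differ by \<open>l * R - j * rate l\<close>, which is at least \<open>y\<close> at the excursion;
  the second exponent is nonnegative exactly when the walk is at or below 0.\<close>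

lemma excursion_return_maximal:
  assumes "0 < T" "0 < y" "0 < \<mu>"
  shows "emeasure S {\<omega> \<in> space S. \<exists>n. \<exists>j\<le>n. real j \<le> T \<and>
      sqrt (2 * T * v * y) + b * y / 3 \<le> (\<Sum>i=1..j. Y (\<omega> i) + \<mu>) \<and> (\<Sum>i=1..n. Y (\<omega> i) + \<mu>) \<le> 0}
    \<le> ennreal (exp (- y))"
proof -
  note tilt = tilt[OF assms(1,2)]
  define l where "l = tilt T y"
  have l: "0 < l" "l * b < 3" using tilt by (auto simp: l_def)
  obtain \<theta> where \<theta>: "0 < \<theta>" "\<theta> \<le> l" "rate \<theta> \<le> \<theta> * \<mu>" "(l - \<theta>) * \<mu> + rate (l - \<theta>) \<le> rate l"
    using rate_tilt_split[OF l assms(3)] .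
  have \<theta>b: "\<theta> * b \<le> l * b" "(l - \<theta>) * b \<le> l * b" using \<theta> b_pos by (auto intro!: mult_right_mono)
  let ?Y = "\<lambda>x. (l - \<theta>) * (Y x + \<mu>) - rate l" and ?Z = "\<lambda>x. - \<theta> * (Y x + \<mu>)"
  have "emeasure S {\<omega> \<in> space S. \<exists>n. \<exists>j\<le>n. real j \<le> T \<and>
      sqrt (2 * T * v * y) + b * y / 3 \<le> (\<Sum>i=1..j. Y (\<omega> i) + \<mu>) \<and> (\<Sum>i=1..n. Y (\<omega> i) + \<mu>) \<le> 0}
    \<le> emeasure S {\<omega> \<in> space S. \<exists>n::nat. \<exists>j\<le>n. y + (\<Sum>i=1..j. ?Z (\<omega> i)) \<le> (\<Sum>i=1..j. ?Y (\<omega> i)) \<and>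
        0 \<le> (\<Sum>i=1..n. ?Z (\<omega> i))}"
  proof (rule emeasure_mono, safe)
    fix \<omega> :: "nat \<Rightarrow> 'a" and n j
    assume *: "j \<le> n" "real j \<le> T" "sqrt (2 * T * v * y) + b * y / 3 \<le> (\<Sum>i=1..j. Y (\<omega> i) + \<mu>)"
      "(\<Sum>i=1..n. Y (\<omega> i) + \<mu>) \<le> 0"
    let ?R = "\<lambda>t. \<Sum>i=1..t. Y (\<omega> i) + \<mu>"
    have "y + T * rate l \<le> l * ?R j"
      unfolding tilt(3)[folded l_def] using * tilt(1) by (intro mult_left_mono) (auto simp: l_def)
    moreover have "real j * rate l \<le> T * rate l"
      using * rate_nonneg l(2) by (intro mult_right_mono) auto
    moreover have "(\<Sum>i=1..j. ?Z (\<omega> i)) = - \<theta> * ?R j" by (simp only: sum_distrib_left)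
    moreover have "(\<Sum>i=1..j. ?Y (\<omega> i)) = (l - \<theta>) * ?R j - real j * rate l"
      by (simp only: sum_subtractf sum_distrib_left sum_constant card_atLeastAtMost) simp
    ultimately have "y + (\<Sum>i=1..j. ?Z (\<omega> i)) \<le> (\<Sum>i=1..j. ?Y (\<omega> i))"
      by (simp add: algebra_simps)
    moreover have "0 \<le> (\<Sum>i=1..n. ?Z (\<omega> i))"
    proof -
      have "(\<Sum>i=1..n. ?Z (\<omega> i)) = - \<theta> * ?R n" by (simp only: sum_distrib_left)
      then show ?thesis using * \<theta> by (simp add: mult_nonneg_nonpos)
    qed
    ultimately show "\<exists>n. \<exists>j\<le>n. y + (\<Sum>i=1..j. ?Z (\<omega> i)) \<le> (\<Sum>i=1..j. ?Y (\<omega> i)) \<and> 0 \<le> (\<Sum>i=1..n. ?Z (\<omega> i))"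
      using *(1) by blast
  qed measurable
  also have "\<dots> \<le> ennreal (exp (- y))"
  proof (rule exp_walk_two_stage_ville)
    \<comment> \<open>Tilting upwards by \<open>l - \<theta>\<close> also collects the drift; the
      reserve of \<open>rate l\<close> over \<open>rate (l - \<theta>)\<close> covers it.\<close>
    show "(\<integral>\<^sup>+x. ennreal (exp (?Y x)) \<partial>M) \<le> 1"
      using \<theta> \<theta>b l by (intro exp_moment[where \<eta> = "l - \<theta>" and l = "l - \<theta>"]) (auto simp: algebra_simps)
    show "(\<integral>\<^sup>+x. ennreal (exp (?Z x)) \<partial>M) \<le> 1"
      using \<theta> \<theta>b l by (intro exp_moment[where \<eta> = "- \<theta>" and l = \<theta>]) (auto simp: algebra_simps)
  qed measurable
  finally show ?thesis .
qed

end

section \<open>The epoch schedule and the confidence radius\<close>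

context centered_bounded_walk
begin

lemma reflected_walk: "centered_bounded_walk M (\<lambda>x. - Y x) b v"
  by unfold_locales (use Y_bounded Y_centered Y_variance v_pos in auto)

definition boundary :: "real \<Rightarrow> real \<Rightarrow> real" where
  "boundary T y = sqrt (2 * T * v * y) + b * y / 3"

text \<open>The two return clauses exclude each other by the sign of \<open>\<mu>\<close>, so
  together they cost one event. In them \<open>n\<close> is not limited by \<open>T\<close>: an
  excursion within the horizon settles the sign for all later epochs too.\<close>

lemma ex_failure_set:
  assumes "0 < T" "0 < y"
  shows "\<exists>N\<in>sets S. emeasure S N \<le> ennreal (4 * exp (- y)) \<and> (\<forall>\<omega>\<in>space S - N. \<forall>t. real t \<le> T \<longrightarrow>
    \<bar>\<Sum>i=1..t. Y (\<omega> i)\<bar> \<le> boundary T y \<and>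
    (\<Sum>i=1..t. v - (Y (\<omega> i))\<^sup>2) \<le> b * sqrt (2 * T * v * y) \<and>
    (\<forall>n\<ge>t. 0 < \<mu> \<longrightarrow> boundary T y \<le> (\<Sum>i=1..t. Y (\<omega> i) + \<mu>) \<longrightarrow> 0 < (\<Sum>i=1..n. Y (\<omega> i) + \<mu>)) \<and>
    (\<forall>n\<ge>t. \<mu> < 0 \<longrightarrow> (\<Sum>i=1..t. Y (\<omega> i) + \<mu>) \<le> - boundary T y \<longrightarrow> (\<Sum>i=1..n. Y (\<omega> i) + \<mu>) < 0))"
proof -
  define up where "up = {\<omega> \<in> space S. \<exists>t. real t \<le> T \<and> boundary T y \<le> (\<Sum>i=1..t. Y (\<omega> i))}"
  define down where "down = {\<omega> \<in> space S. \<exists>t. real t \<le> T \<and> boundary T y \<le> (\<Sum>i=1..t. - Y (\<omega> i))}"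
  define var where "var = {\<omega> \<in> space S. \<exists>t. real t \<le> T \<and> b * sqrt (2 * T * v * y) \<le> (\<Sum>i=1..t. v - (Y (\<omega> i))\<^sup>2)}"
  define ret where "ret = (if 0 < \<mu> then {\<omega> \<in> space S. \<exists>n. \<exists>j\<le>n. real j \<le> T \<and>
      boundary T y \<le> (\<Sum>i=1..j. Y (\<omega> i) + \<mu>) \<and> (\<Sum>i=1..n. Y (\<omega> i) + \<mu>) \<le> 0}
    else if \<mu> < 0 then {\<omega> \<in> space S. \<exists>n. \<exists>j\<le>n. real j \<le> T \<and>
      boundary T y \<le> (\<Sum>i=1..j. - Y (\<omega> i) + - \<mu>) \<and> (\<Sum>i=1..n. - Y (\<omega> i) + - \<mu>) \<le> 0}
    else {})"
  let ?e = "ennreal (exp (- y))"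
  have [measurable]: "up \<in> sets S" unfolding up_def by measurable
  have [measurable]: "down \<in> sets S" unfolding down_def by measurable
  have [measurable]: "var \<in> sets S" unfolding var_def by measurable
  have [measurable]: "ret \<in> sets S"
  proof (cases "0 < \<mu>")
    case True
    then show ?thesis unfolding ret_def if_P[OF True] by measurable
  next
    case False
    show ?thesis unfolding ret_def if_not_P[OF False] by (cases "\<mu> < 0"; simp only: if_True if_False; measurable)
  qed
  have bounds: "emeasure S up \<le> ?e" "emeasure S down \<le> ?e" "emeasure S var \<le> ?e"
    unfolding up_def down_def var_def boundary_def
    by (rule bernstein_maximal[OF assms] centered_bounded_walk.bernstein_maximal[OF reflected_walk assms]
        variance_maximal[OF assms])+
  have "emeasure S ret \<le> ?e"
  proof -
    consider "0 < \<mu>" | "\<not> 0 < \<mu>" "\<mu> < 0" | "\<not> 0 < \<mu>" "\<not> \<mu> < 0" by blast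
    then show ?thesis
    proof cases
      case 1
      then show ?thesis
        unfolding ret_def if_P[OF 1] boundary_def by (intro excursion_return_maximal assms)
    next
      case 2
      then show ?thesis
        unfolding ret_def if_not_P[OF 2(1)] if_P[OF 2(2)] boundary_def
        by (intro centered_bounded_walk.excursion_return_maximal[OF reflected_walk] assms) simp
    next
      case 3
      then show ?thesis by (simp add: ret_def)
    qed
  qed
  note bounds = bounds this
  have "emeasure S (up \<union> down \<union> var \<union> ret) \<le> emeasure S (up \<union> down \<union> var) + emeasure S ret"
    by (rule emeasure_subadditive) measurable
  also have "emeasure S (up \<union> down \<union> var) \<le> emeasure S (up \<union> down) + emeasure S var"
    by (rule emeasure_subadditive) measurable
  also have "emeasure S (up \<union> down) \<le> emeasure S up + emeasure S down"
    by (rule emeasure_subadditive) measurable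
  finally have "emeasure S (up \<union> down \<union> var \<union> ret) \<le> emeasure S up + emeasure S down + emeasure S var + emeasure S ret"
    by (simp add: add_right_mono)
  also have "\<dots> \<le> ?e + ?e + ?e + ?e" using bounds by (intro add_mono)
  also have "\<dots> = ennreal (4 * exp (- y))" by (simp flip: ennreal_plus)
  finally have "emeasure S (up \<union> down \<union> var \<union> ret) \<le> ennreal (4 * exp (- y))" .
  moreover have "\<forall>\<omega>\<in>space S - (up \<union> down \<union> var \<union> ret). \<forall>t. real t \<le> T \<longrightarrow>
    \<bar>\<Sum>i=1..t. Y (\<omega> i)\<bar> \<le> boundary T y \<and>
    (\<Sum>i=1..t. v - (Y (\<omega> i))\<^sup>2) \<le> b * sqrt (2 * T * v * y) \<and>
    (\<forall>n\<ge>t. 0 < \<mu> \<longrightarrow> boundary T y \<le> (\<Sum>i=1..t. Y (\<omega> i) + \<mu>) \<longrightarrow> 0 < (\<Sum>i=1..n. Y (\<omega> i) + \<mu>)) \<and>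
    (\<forall>n\<ge>t. \<mu> < 0 \<longrightarrow> (\<Sum>i=1..t. Y (\<omega> i) + \<mu>) \<le> - boundary T y \<longrightarrow> (\<Sum>i=1..n. Y (\<omega> i) + \<mu>) < 0)"
  proof (intro ballI allI impI conjI)
    fix \<omega> t assume \<omega>: "\<omega> \<in> space S - (up \<union> down \<union> var \<union> ret)" and t: "real t \<le> T"
    have "\<not> boundary T y \<le> (\<Sum>i=1..t. Y (\<omega> i))" using \<omega> t unfolding up_def by blast
    moreover have "\<not> boundary T y \<le> (\<Sum>i=1..t. - Y (\<omega> i))" using \<omega> t unfolding down_def by blast
    ultimately show "\<bar>\<Sum>i=1..t. Y (\<omega> i)\<bar> \<le> boundary T y" by (simp add: sum_negf)
    have "\<not> b * sqrt (2 * T * v * y) \<le> (\<Sum>i=1..t. v - (Y (\<omega> i))\<^sup>2)" using \<omega> t unfolding var_def by blast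
    then show "(\<Sum>i=1..t. v - (Y (\<omega> i))\<^sup>2) \<le> b * sqrt (2 * T * v * y)" by linarith
    show "0 < (\<Sum>i=1..n. Y (\<omega> i) + \<mu>)" if "t \<le> n" "0 < \<mu>" "boundary T y \<le> (\<Sum>i=1..t. Y (\<omega> i) + \<mu>)" for n
    proof -
      have "\<not> (\<Sum>i=1..n. Y (\<omega> i) + \<mu>) \<le> 0"
        using \<omega> t that unfolding ret_def if_P[OF \<open>0 < \<mu>\<close>] by blast
      then show ?thesis by linarith
    qed
    show "(\<Sum>i=1..n. Y (\<omega> i) + \<mu>) < 0" if "t \<le> n" "\<mu> < 0" "(\<Sum>i=1..t. Y (\<omega> i) + \<mu>) \<le> - boundary T y" for n
    proof (rule ccontr)
      have neg: "(\<Sum>i=1..k. - Y (\<omega> i) + - \<mu>) = - (\<Sum>i=1..k. Y (\<omega> i) + \<mu>)" for k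
        by (simp add: sum.distrib sum_negf sum_subtractf)
      assume "\<not> ?thesis"
      then have "\<exists>n. \<exists>j\<le>n. real j \<le> T \<and>
        boundary T y \<le> (\<Sum>i=1..j. - Y (\<omega> i) + - \<mu>) \<and> (\<Sum>i=1..n. - Y (\<omega> i) + - \<mu>) \<le> 0"
        unfolding neg using that t by (intro exI[of _ n] exI[of _ t]) auto
      moreover have "\<not> 0 < \<mu>" using that by simp
      ultimately show False using \<omega> unfolding ret_def if_not_P[OF \<open>\<not> 0 < \<mu>\<close>] if_P[OF that(2)] by blast
    qed
  qed
  ultimately show ?thesis by (intro bexI[of _ "up \<union> down \<union> var \<union> ret"]) auto
qed

end

text \<open>The value of the counter \<open>h\<close> after \<open>n\<close> samples; the test is
  the one of the procedure at \<open>j = Suc n\<close>.\<close>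

primrec epoch :: "nat \<Rightarrow> nat" where
  "epoch 0 = 0"
| "epoch (Suc n) = (if \<lfloor>procR_beta ^ epoch n\<rfloor> \<le> int (Suc n) then Suc (epoch n) else epoch n)"

definition epoch_ratio :: "nat \<Rightarrow> real" where
  "epoch_ratio h = real_of_int \<lfloor>procR_beta ^ h\<rfloor> / real_of_int \<lfloor>procR_beta ^ (h - 1)\<rfloor>"

definition epoch_level :: "real \<Rightarrow> nat \<Rightarrow> real" where
  "epoch_level \<delta> h = - ln (\<delta> * (procR_p - 1) / (3 * procR_p * real h powr procR_p))"

text \<open>An upper bound for all times of the epoch that exceeds each of them by the factor
  \<open>epoch_ratio\<close> at most; \<open>bonus\<close> passes this factor on to the radius. A
  power of \<open>procR_beta\<close> would not do, since in the early epochs it lies below the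
  number of samples.\<close>

definition epoch_horizon :: "nat \<Rightarrow> real" where
  "epoch_horizon h = epoch_ratio h * real (LEAST n. epoch n = h)"

definition bonus :: "real \<Rightarrow> nat \<Rightarrow> real" where
  "bonus \<delta> n = epoch_ratio (epoch n) * epoch_level \<delta> (epoch n)"

lemma epoch_Suc_le: "epoch n \<le> epoch (Suc n)" by simp

lemma epoch_mono: "m \<le> n \<Longrightarrow> epoch m \<le> epoch n"
  by (rule lift_Suc_mono_le[of epoch, OF epoch_Suc_le])

lemma epoch_le: "epoch n \<le> n"
  by (induction n) auto

lemma floor_beta_ge_1: "1 \<le> \<lfloor>procR_beta ^ h\<rfloor>"
  by (simp add: procR_beta_def le_floor_iff one_le_power)

text \<open>\<open>procR_beta ^ 7\<close> is still below 2, so the first eight tests succeed and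
  each epoch before 8 consists of one sample. Leaving out these epochs means leaving out the samples
  1 to 7.\<close>

lemma epoch_initial: "k \<le> 8 \<Longrightarrow> epoch k = k"
proof (induction k)
  case (Suc k)
  have "procR_beta ^ k \<le> procR_beta ^ 7"
    using Suc.prems by (intro power_increasing) (auto simp: procR_beta_def)
  also have "\<dots> < 2" by (simp add: procR_beta_def power_divide)
  finally have "\<lfloor>procR_beta ^ k\<rfloor> \<le> int (Suc k)" by linarith
  then show ?case using Suc by simp
qed simp

lemma epoch_pos: "1 \<le> n \<Longrightarrow> 1 \<le> epoch n"
  using epoch_mono[of 1 n] epoch_initial[of 1] by simp

lemma floor_beta_epoch_le: "1 \<le> n \<Longrightarrow> \<lfloor>procR_beta ^ (epoch n - 1)\<rfloor> \<le> int n"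
proof (induction n)
  case (Suc n)
  show ?case
  proof (cases "\<lfloor>procR_beta ^ epoch n\<rfloor> \<le> int (Suc n)")
    case False
    then have "1 \<le> n" by (cases n) auto
    then show ?thesis using Suc.IH False by simp
  qed simp
qed simp

lemma epoch_ratio_ge_1: "1 \<le> epoch_ratio h"
proof -
  have "\<lfloor>procR_beta ^ (h - 1)\<rfloor> \<le> \<lfloor>procR_beta ^ h\<rfloor>"
    by (intro floor_mono power_increasing) (auto simp: procR_beta_def)
  then show ?thesis using floor_beta_ge_1[of "h - 1"] by (simp add: epoch_ratio_def)
qed

text \<open>The epoch begins no earlier than the floor of \<open>procR_beta ^ (h - 1)\<close>, as a
  test succeeded there, and its later times stay below the floor of \<open>procR_beta ^ h\<close>,
  as the test fails there. The quotient of the two floors is \<open>epoch_ratio h\<close>.\<close>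

lemma epoch_horizon:
  assumes "1 \<le> n"
  shows "real n \<le> epoch_horizon (epoch n)" "epoch_horizon (epoch n) \<le> epoch_ratio (epoch n) * real n"
proof -
  define h where "h = epoch n"
  define f where "f = (LEAST n. epoch n = h)"
  have f: "epoch f = h" "f \<le> n" unfolding f_def by (auto simp: h_def intro: LeastI Least_le)
  have "1 \<le> f" using f epoch_pos[OF assms] by (cases f) (auto simp: h_def)
  show "epoch_horizon (epoch n) \<le> epoch_ratio (epoch n) * real n"
    using f epoch_ratio_ge_1[of h]
    by (auto simp: epoch_horizon_def f_def[symmetric] h_def[symmetric] intro!: mult_left_mono)
  have "real n \<le> epoch_ratio h * real f"
  proof (cases "n = f")
    case True
    then show ?thesis using mult_right_mono[OF epoch_ratio_ge_1[of h], of "real f"] by simp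
  next
    case False
    then obtain n' where n': "n = Suc n'" "f \<le> n'" using f by (cases n) auto
    have "epoch n' = h" using epoch_mono[OF n'(2)] epoch_Suc_le[of n'] n' f by (simp add: h_def)
    then have "int n < \<lfloor>procR_beta ^ h\<rfloor>" using n' by (auto simp: h_def split: if_splits)
    then have "real n \<le> real_of_int \<lfloor>procR_beta ^ h\<rfloor>" by linarith
    also have "\<dots> = epoch_ratio h * real_of_int \<lfloor>procR_beta ^ (h - 1)\<rfloor>"
    proof -
      have "real_of_int \<lfloor>procR_beta ^ (h - 1)\<rfloor> \<noteq> 0" using floor_beta_ge_1[of "h - 1"] by linarith
      then show ?thesis by (simp add: epoch_ratio_def)
    qed
    also have "real_of_int \<lfloor>procR_beta ^ (h - 1)\<rfloor> \<le> real f"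
      using floor_beta_epoch_le[OF \<open>1 \<le> f\<close>] f by (metis of_int_le_iff of_int_of_nat_eq)
    finally show ?thesis using epoch_ratio_ge_1[of h] by (simp add: mult_left_mono)
  qed
  then show "real n \<le> epoch_horizon (epoch n)" by (simp add: epoch_horizon_def f_def h_def)
qed

text \<open>The constant 33 is \<open>3 * procR_p / (procR_p - 1)\<close>.\<close>

lemma epoch_level_eq:
  assumes "0 < \<delta>" "1 \<le> h"
  shows "epoch_level \<delta> h = ln (33 * real h powr (11/10) / \<delta>)"
proof -
  have "\<delta> * (procR_p - 1) / (3 * procR_p * real h powr procR_p) = inverse (33 * real h powr (11/10) / \<delta>)"
    using assms by (simp add: procR_p_def field_simps)
  then have "epoch_level \<delta> h = - ln (inverse (33 * real h powr (11/10) / \<delta>))"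
    unfolding epoch_level_def by simp
  also have "\<dots> = ln (33 * real h powr (11/10) / \<delta>)"
    using assms by (subst ln_inverse) auto
  finally show ?thesis .
qed

lemma exp_minus_epoch_level:
  assumes "0 < \<delta>" "1 \<le> h"
  shows "exp (- epoch_level \<delta> h) = \<delta> / 33 * real h powr (- 11 / 10)"
  using assms by (simp add: epoch_level_eq exp_minus powr_minus field_simps)

text \<open>The value 7/3 is dictated by \<open>radius_ge_range\<close>, where three times the level
  has to reach 7.\<close>

lemma epoch_level_ge:
  assumes "0 < \<delta>" "\<delta> < 1" "1 \<le> h"
  shows "7 / 3 \<le> epoch_level \<delta> h"
proof -
  have "exp (7 / 3 :: real) \<le> exp 1 ^ 3" by (simp flip: exp_of_nat_mult)
  also have "\<dots> \<le> (272 / 100) ^ 3" using e_less_272 by (intro power_mono) auto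
  also have "\<dots> \<le> 33 * 1 / 1" by (simp add: power_divide)
  also have "\<dots> \<le> 33 * real h powr (11/10) / \<delta>"
    using assms by (intro frac_le mult_left_mono) (auto simp: ge_one_powr_ge_zero)
  finally have "7 / 3 \<le> ln (33 * real h powr (11/10) / \<delta>)"
    using assms by (subst ln_ge_iff) auto
  then show ?thesis using assms by (simp add: epoch_level_eq)
qed

lemma bonus_ge_level: "0 < \<delta> \<Longrightarrow> \<delta> < 1 \<Longrightarrow> 1 \<le> n \<Longrightarrow> epoch_level \<delta> (epoch n) \<le> bonus \<delta> n"
  using epoch_level_ge[of \<delta> "epoch n"] epoch_pos[of n] epoch_ratio_ge_1[of "epoch n"]
  by (simp add: bonus_def mult_le_cancel_right1)

section \<open>The series of failure probabilities\<close>

lemma powr_telescope: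
  assumes "2 \<le> h"
  shows "real h powr (- 11 / 10) \<le> 10 * (real (h - 1) powr (- 1 / 10) - real h powr (- 1 / 10))"
proof -
  have "\<exists>z. real (h - 1) < z \<and> z < real h \<and>
    (- 10 * real h powr (- 1 / 10)) - (- 10 * real (h - 1) powr (- 1 / 10)) = (real h - real (h - 1)) * z powr (- 11 / 10)"
  proof (rule MVT2)
    fix x assume "real (h - 1) \<le> x" "x \<le> real h"
    then have "0 < x" using assms by linarith
    then show "((\<lambda>x. - 10 * x powr (- 1 / 10)) has_real_derivative x powr (- 11 / 10)) (at x)"
      by (auto intro!: derivative_eq_intros simp: powr_diff[symmetric])
  qed (use assms in simp)
  then obtain z where z: "real (h - 1) < z" "z < real h"
    "(- 10 * real h powr (- 1 / 10)) - (- 10 * real (h - 1) powr (- 1 / 10)) = z powr (- 11 / 10)"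
    using assms by (auto simp: of_nat_diff)
  have "real h powr (- 11 / 10) \<le> z powr (- 11 / 10)" using z by (intro powr_mono2') auto
  then show ?thesis using z(3) by simp
qed

text \<open>33/4 is what four events of weight \<open>\<delta> / 33\<close> can afford. Comparison
  with the integral gives \<open>10 * 7 powr (- 1 / 10)\<close>, about 8.23; starting one epoch
  earlier it would give about 8.36, which is too much.\<close>

lemma sum_powr_tail: "(\<Sum>h=8..<N. real h powr (- 11 / 10)) \<le> 33 / 4"
proof (cases "8 \<le> N")
  case True
  have "(\<Sum>h=8..<N. real h powr (- 11 / 10)) \<le> 10 * (7 powr (- 1 / 10) - real (N - 1) powr (- 1 / 10))"
    using True
  proof (induction N rule: dec_induct)
    case (step N)
    then show ?case using powr_telescope[of N] by simp
  qed simp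
  also have "\<dots> \<le> 10 * 7 powr (- 1 / 10)" by simp
  also have "7 powr (- 1 / 10) \<le> (33 / 40 :: real)"
  proof -
    have "(40 / 33 :: real) ^ 10 = (40 / 33) powr 10" by simp
    then have "40 / 33 = ((40 / 33 :: real) ^ 10) powr (1 / 10)" by (simp only: powr_powr) simp
    also have "\<dots> \<le> 7 powr (1 / 10)"
    proof (rule powr_mono2)
      show "(40 / 33 :: real) ^ 10 \<le> 7" by (simp add: power_divide)
    qed simp_all
    finally show ?thesis by (simp add: powr_minus field_simps)
  qed
  finally show ?thesis by simp
qed simp

section \<open>Sample statistics and the confidence radius\<close>

definition sample_mean :: "(nat \<Rightarrow> real) \<Rightarrow> nat \<Rightarrow> real" where
  "sample_mean G n = (\<Sum>i=1..n. G i) / real n"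

definition sample_variance :: "(nat \<Rightarrow> real) \<Rightarrow> nat \<Rightarrow> real" where
  "sample_variance G n = (\<Sum>i=1..n. (G i - sample_mean G n)\<^sup>2) / real n"

definition radius :: "real \<Rightarrow> real \<Rightarrow> (nat \<Rightarrow> real) \<Rightarrow> nat \<Rightarrow> real" where
  "radius \<delta> V G n = sqrt (sample_variance G n) * sqrt (2 * bonus \<delta> n / real n) + 3 * V * bonus \<delta> n / real n"

lemma sample_variance_nonneg: "0 \<le> sample_variance G n"
  unfolding sample_variance_def by (intro divide_nonneg_nonneg sum_nonneg) auto

lemma sum_eq_sample_mean: "1 \<le> n \<Longrightarrow> (\<Sum>i=1..n. G i) = real n * sample_mean G n"
  by (simp add: sample_mean_def)

text \<open>Used with the true mean for \<open>c\<close>: the squared error of the sample mean is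
  the source of the term \<open>D\<^sup>2\<close> in
  \<open>bernstein_radius_le_empirical\<close>.\<close>

lemma sum_square_deviation:
  assumes "1 \<le> n"
  shows "(\<Sum>i=1..n. (G i - c)\<^sup>2) = real n * (sample_variance G n + (sample_mean G n - c)\<^sup>2)"
proof -
  define m where "m = sample_mean G n"
  have "(\<Sum>i=1..n. (G i - c)\<^sup>2) = (\<Sum>i=1..n. (G i - m)\<^sup>2 + (2 * (m - c) * (G i - m) + (m - c)\<^sup>2))"
    by (intro sum.cong) (auto simp: power2_eq_square algebra_simps)
  also have "\<dots> = (\<Sum>i=1..n. (G i - m)\<^sup>2) + 2 * (m - c) * (\<Sum>i=1..n. G i - m) + real n * (m - c)\<^sup>2"
    by (simp add: sum.distrib sum_distrib_left)
  also have "(\<Sum>i=1..n. G i - m) = 0"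
    using sum_eq_sample_mean[OF assms, of G] by (simp add: sum_subtractf m_def)
  also have "(\<Sum>i=1..n. (G i - m)\<^sup>2) = real n * sample_variance G n"
    using assms by (simp add: sample_variance_def m_def)
  finally show ?thesis by (simp add: m_def algebra_simps)
qed

lemma sample_mean_bounds:
  assumes "1 \<le> n" "\<And>i. a \<le> G i" "\<And>i. G i \<le> u"
  shows "a \<le> sample_mean G n" "sample_mean G n \<le> u"
proof -
  have "real n * a \<le> (\<Sum>i=1..n. G i)" "(\<Sum>i=1..n. G i) \<le> real n * u"
    using sum_mono[of "{1..n}" "\<lambda>_. a" G] sum_mono[of "{1..n}" G "\<lambda>_. u"] assms by auto
  then show "a \<le> sample_mean G n" "sample_mean G n \<le> u"
    using assms(1) by (auto simp: sample_mean_def field_simps)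
qed

text \<open>By \<open>T * y \<le> real n * x\<close> the boundary at the horizon, divided by
  \<open>n\<close>, is at most Bernstein's radius with \<open>r = sqrt (x / real n)\<close>, which
  the empirical radius dominates. The second claim serves the sign: a mean beyond its radius belongs
  to a walk beyond its boundary.\<close>

lemma epoch_boundary_le_radius:
  fixes \<delta> \<mu> \<sigma> V :: real and G :: "nat \<Rightarrow> real"
  assumes \<delta>: "0 < \<delta>" "\<delta> < 1" and n: "1 \<le> n" and \<sigma>: "0 < \<sigma>" "\<sigma> \<le> V / 2"
  defines "T \<equiv> epoch_horizon (epoch n)" and "y \<equiv> epoch_level \<delta> (epoch n)"
  assumes mean: "\<bar>\<Sum>i=1..n. G i - \<mu>\<bar> \<le> sqrt (2 * T * \<sigma>\<^sup>2 * y) + V * y / 3"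
    and var: "(\<Sum>i=1..n. \<sigma>\<^sup>2 - (G i - \<mu>)\<^sup>2) \<le> V * sqrt (2 * T * \<sigma>\<^sup>2 * y)"
  shows "\<bar>sample_mean G n - \<mu>\<bar> \<le> radius \<delta> V G n"
    and "sqrt (2 * T * \<sigma>\<^sup>2 * y) + V * y / 3 \<le> real n * radius \<delta> V G n"
proof -
  define x where "x = bonus \<delta> n"
  define r where "r = sqrt (x / real n)"
  define s where "s = sqrt (sample_variance G n)"
  define B where "B = sqrt 2 * \<sigma> * r + V * r\<^sup>2 / 3"
  have V: "0 < V" using \<sigma> by simp
  have y: "0 < y" using epoch_level_ge[OF \<delta> epoch_pos[OF n]] by (simp add: y_def)
  have yx: "y \<le> x" using bonus_ge_level[OF \<delta> n] by (simp add: x_def y_def)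
  have x: "0 < x" using y yx by simp
  have r: "0 \<le> r" "real n * r\<^sup>2 = x" using x n by (simp_all add: r_def)
  have Ty: "T * y \<le> real n * x"
    using mult_right_mono[OF epoch_horizon(2)[OF n], of y] y
    by (simp add: T_def y_def x_def bonus_def mult_ac)
  have rt: "sqrt (2 * T * \<sigma>\<^sup>2 * y) \<le> real n * (sqrt 2 * \<sigma> * r)"
  proof (rule real_le_lsqrt)
    have "2 * T * \<sigma>\<^sup>2 * y = 2 * \<sigma>\<^sup>2 * (T * y)" by simp
    also have "\<dots> \<le> 2 * \<sigma>\<^sup>2 * (real n * x)" using Ty by (intro mult_left_mono) auto
    also have "\<dots> = (real n * (sqrt 2 * \<sigma> * r))\<^sup>2"
      unfolding r(2)[symmetric] by (simp add: power_mult_distrib) (simp add: power2_eq_square)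
    finally show "2 * T * \<sigma>\<^sup>2 * y \<le> (real n * (sqrt 2 * \<sigma> * r))\<^sup>2" .
  qed (use \<sigma> r in auto)
  have "V * y / 3 \<le> real n * (V * r\<^sup>2 / 3)"
    using mult_left_mono[OF yx, of V] V r(2) by (simp add: mult_ac)
  then have bound: "sqrt (2 * T * \<sigma>\<^sup>2 * y) + V * y / 3 \<le> real n * B"
    using rt by (simp add: B_def distrib_left)
  have sum: "(\<Sum>i=1..n. G i - \<mu>) = real n * (sample_mean G n - \<mu>)"
    using sum_eq_sample_mean[OF n, of G] by (simp add: sum_subtractf right_diff_distrib)
  have D: "\<bar>sample_mean G n - \<mu>\<bar> \<le> B"
  proof -
    have "real n * \<bar>sample_mean G n - \<mu>\<bar> \<le> real n * B"
      using mean bound unfolding sum by (simp add: abs_mult)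
    then show ?thesis using n by simp
  qed
  have "real n * \<sigma>\<^sup>2 - real n * (sample_variance G n + (sample_mean G n - \<mu>)\<^sup>2) \<le> V * (real n * (sqrt 2 * \<sigma> * r))"
  proof (rule order_trans)
    show "real n * \<sigma>\<^sup>2 - real n * (sample_variance G n + (sample_mean G n - \<mu>)\<^sup>2) \<le> V * sqrt (2 * T * \<sigma>\<^sup>2 * y)"
      using var sum_square_deviation[OF n, of G \<mu>] by (simp add: sum_subtractf)
    show "V * sqrt (2 * T * \<sigma>\<^sup>2 * y) \<le> V * (real n * (sqrt 2 * \<sigma> * r))"
      using V by (intro mult_left_mono rt) simp
  qed
  then have "real n * \<sigma>\<^sup>2 \<le> real n * (sample_variance G n + (sample_mean G n - \<mu>)\<^sup>2 + sqrt 2 * V * \<sigma> * r)"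
    by (simp add: algebra_simps)
  then have "\<sigma>\<^sup>2 \<le> s\<^sup>2 + (sample_mean G n - \<mu>)\<^sup>2 + sqrt 2 * V * \<sigma> * r"
    using n sample_variance_nonneg[of G n] by (simp add: s_def)
  then have "B \<le> sqrt 2 * s * r + 3 * V * r\<^sup>2"
    using bernstein_radius_le_empirical[of s r V \<sigma> "sample_mean G n - \<mu>"] r V \<sigma> D sample_variance_nonneg[of G n]
    by (simp add: B_def s_def)
  also have "\<dots> = radius \<delta> V G n"
  proof -
    have "sqrt (2 * x / real n) = sqrt 2 * r" by (simp add: r_def flip: real_sqrt_mult)
    moreover have "r\<^sup>2 = x / real n" using x by (simp add: r_def)
    ultimately show ?thesis by (simp add: radius_def s_def x_def[symmetric])
  qed
  finally have B: "B \<le> radius \<delta> V G n" .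
  then show "\<bar>sample_mean G n - \<mu>\<bar> \<le> radius \<delta> V G n" using D by simp
  show "sqrt (2 * T * \<sigma>\<^sup>2 * y) + V * y / 3 \<le> real n * radius \<delta> V G n"
    using bound mult_left_mono[OF B, of "real n"] by simp
qed

text \<open>
  The third clause controls the sign that the procedure returns; it does not follow from the
  second one, since the mean may cross 0 while the confidence intervals are still wide.
\<close>

definition good_samples :: "real \<Rightarrow> real \<Rightarrow> real \<Rightarrow> real \<Rightarrow> (nat \<Rightarrow> real) \<Rightarrow> bool" where
  "good_samples \<delta> V a \<mu> G \<longleftrightarrow>
    (\<forall>i. a \<le> G i \<and> G i \<le> a + V) \<and>
    (\<forall>n\<ge>1. \<bar>sample_mean G n - \<mu>\<bar> \<le> radius \<delta> V G n) \<and>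
    (\<forall>j\<ge>1. \<forall>n\<ge>j. radius \<delta> V G j < \<bar>sample_mean G j\<bar> \<longrightarrow> sgn (sample_mean G n) = sgn \<mu>)"

text \<open>The linear term of the radius suffices, because \<open>bonus \<delta> n\<close> is at
  least 7/3.\<close>

lemma radius_ge_range:
  assumes "0 < \<delta>" "\<delta> < 1" "0 \<le> V" "1 \<le> n" "n \<le> 7"
  shows "V \<le> radius \<delta> V G n"
proof -
  have x: "7 / 3 \<le> bonus \<delta> n"
    using epoch_level_ge[of \<delta> "epoch n"] epoch_pos[of n] bonus_ge_level[of \<delta> n] assms by simp
  have "V * real n \<le> V * (3 * bonus \<delta> n)" using assms x by (intro mult_left_mono) auto
  then have "V \<le> 3 * V * bonus \<delta> n / real n" using assms by (simp add: field_simps)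
  moreover have "0 \<le> sqrt (sample_variance G n) * sqrt (2 * bonus \<delta> n / real n)"
    using x sample_variance_nonneg by simp
  ultimately show ?thesis by (simp add: radius_def)
qed

text \<open>A deterministic statement about one sequence. Up to time 7 the range of the returns
  decides; from time 8 on the hypotheses are what holds outside the failure sets.\<close>

lemma good_samplesI:
  fixes G :: "nat \<Rightarrow> real"
  assumes \<delta>: "0 < \<delta>" "\<delta> < 1" and \<sigma>: "0 < \<sigma>" "\<sigma> \<le> V / 2" and \<mu>: "a \<le> \<mu>" "\<mu> \<le> a + V"
    and range: "\<And>i. a \<le> G i" "\<And>i. G i \<le> a + V"
  defines "B \<equiv> \<lambda>h. sqrt (2 * epoch_horizon h * \<sigma>\<^sup>2 * epoch_level \<delta> h) + V * epoch_level \<delta> h / 3"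
  assumes mean: "\<And>t. 8 \<le> t \<Longrightarrow> \<bar>\<Sum>i=1..t. G i - \<mu>\<bar> \<le> B (epoch t)"
    and var: "\<And>t. 8 \<le> t \<Longrightarrow> (\<Sum>i=1..t. \<sigma>\<^sup>2 - (G i - \<mu>)\<^sup>2)
      \<le> V * sqrt (2 * epoch_horizon (epoch t) * \<sigma>\<^sup>2 * epoch_level \<delta> (epoch t))"
    and pos: "\<And>t n. 8 \<le> t \<Longrightarrow> t \<le> n \<Longrightarrow> 0 < \<mu> \<Longrightarrow> B (epoch t) \<le> (\<Sum>i=1..t. G i) \<Longrightarrow> 0 < (\<Sum>i=1..n. G i)"
    and neg: "\<And>t n. 8 \<le> t \<Longrightarrow> t \<le> n \<Longrightarrow> \<mu> < 0 \<Longrightarrow> (\<Sum>i=1..t. G i) \<le> - B (epoch t) \<Longrightarrow> (\<Sum>i=1..n. G i) < 0"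
  shows "good_samples \<delta> V a \<mu> G"
proof -
  have conf: "\<bar>sample_mean G n - \<mu>\<bar> \<le> radius \<delta> V G n" if "1 \<le> n" for n
  proof (cases "n \<le> 7")
    case True
    have "\<bar>sample_mean G n - \<mu>\<bar> \<le> V" using sample_mean_bounds[of n a G "a + V"] that range \<mu> by fastforce
    also have "V \<le> radius \<delta> V G n" using that True \<delta> \<sigma> by (intro radius_ge_range) auto
    finally show ?thesis .
  next
    case False
    then show ?thesis
      using mean[of n] var[of n] that unfolding B_def
      by (intro epoch_boundary_le_radius(1)[OF \<delta> that \<sigma>]) auto
  qed
  have bound: "B (epoch n) \<le> real n * radius \<delta> V G n" if "8 \<le> n" for n
    using mean[OF that] var[OF that] that unfolding B_def
    by (intro epoch_boundary_le_radius(2)[OF \<delta> _ \<sigma>]) auto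
  have "sgn (sample_mean G n) = sgn \<mu>"
    if j: "1 \<le> j" "j \<le> n" "radius \<delta> V G j < \<bar>sample_mean G j\<bar>" for j n
  proof -
    have n: "1 \<le> n" using j by simp
    have range_j: "a \<le> sample_mean G j" "sample_mean G j \<le> a + V"
      and range_n: "a \<le> sample_mean G n" "sample_mean G n \<le> a + V"
      using sample_mean_bounds[of _ a G "a + V"] range j(1) n by auto
    have small: "V \<le> radius \<delta> V G j" if "j \<le> 7"
      using that j \<delta> \<sigma> by (intro radius_ge_range) auto
    have "\<mu> \<noteq> 0" using conf[OF j(1)] j(3) by auto
    then consider "0 < \<mu>" | "\<mu> < 0" by linarith
    then show ?thesis
    proof cases
      case 1
      then have *: "radius \<delta> V G j < sample_mean G j" using conf[OF j(1)] j(3) by linarith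
      have "0 < sample_mean G n"
      proof (cases "j \<le> 7")
        \<comment> \<open>The mean at \<open>j\<close> exceeds \<open>V\<close> but is at most
          \<open>a + V\<close>, so \<open>a\<close> is positive, and with it every later
          mean.\<close>
        case True
        then show ?thesis using small * range_j range_n by linarith
      next
        case False
        have "B (epoch j) \<le> real j * radius \<delta> V G j" using False by (intro bound) simp
        also have "\<dots> \<le> real j * sample_mean G j" using * by (intro mult_left_mono) auto
        finally have "B (epoch j) \<le> (\<Sum>i=1..j. G i)" using sum_eq_sample_mean[OF j(1)] by simp
        then have "0 < (\<Sum>i=1..n. G i)" using pos[of j n] False j 1 by simp
        then show ?thesis using n by (simp add: sample_mean_def)
      qed
      then show ?thesis using 1 by simp
    next
      case 2
      then have *: "sample_mean G j < - radius \<delta> V G j" using conf[OF j(1)] j(3) by linarith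
      have "sample_mean G n < 0"
      proof (cases "j \<le> 7")
        case True
        then show ?thesis using small * range_j range_n by linarith
      next
        case False
        have "real j * sample_mean G j \<le> real j * (- radius \<delta> V G j)" using * by (intro mult_left_mono) auto
        also have "\<dots> \<le> - B (epoch j)" using False bound[of j] by simp
        finally have "(\<Sum>i=1..j. G i) \<le> - B (epoch j)" using sum_eq_sample_mean[OF j(1)] by simp
        then have "(\<Sum>i=1..n. G i) < 0" using neg[of j n] False j 2 by simp
        then show ?thesis using n by (simp add: sample_mean_def divide_neg_pos)
      qed
      then show ?thesis using 2 by simp
    qed
  qed
  then show ?thesis using range conf by (auto simp: good_samples_def)
qed

text \<open>The case of variance 0, which the locale excludes because \<open>tilt\<close> divides by
  \<open>v\<close>.\<close>

lemma good_samples_const: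
  assumes \<delta>: "0 < \<delta>" "\<delta> < 1" and \<mu>: "a \<le> \<mu>" "\<mu> \<le> a + V" and G: "\<And>i. G i = \<mu>"
  shows "good_samples \<delta> V a \<mu> G"
proof -
  have mean: "sample_mean G n = \<mu>" if "1 \<le> n" for n
    using that by (simp add: sample_mean_def G)
  have "0 \<le> radius \<delta> V G n" if "1 \<le> n" for n
  proof -
    have "0 \<le> bonus \<delta> n"
      using epoch_level_ge[of \<delta> "epoch n"] epoch_pos[of n] bonus_ge_level[of \<delta> n] that \<delta> by simp
    then show ?thesis using \<mu> sample_variance_nonneg by (simp add: radius_def)
  qed
  then show ?thesis using \<mu> by (simp add: good_samples_def mean G)
qed

text \<open>
  Each epoch has four failure events of probability at most \<open>exp (- epoch_level \<delta> h)\<close>; their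
  total stays below \<open>\<delta>\<close> only because the epochs before 8 are left out.
\<close>

lemma sum_epoch_failure:
  assumes "0 < \<delta>"
  shows "(\<Sum>h. if 8 \<le> h then ennreal (4 * exp (- epoch_level \<delta> h)) else 0) \<le> ennreal \<delta>"
proof (rule suminf_le_const)
  fix N
  have "(\<Sum>h<N. if 8 \<le> h then ennreal (4 * exp (- epoch_level \<delta> h)) else 0)
      = (\<Sum>h=8..<N. ennreal (4 * exp (- epoch_level \<delta> h)))"
    by (rule sum.mono_neutral_cong_right) auto
  also have "\<dots> = ennreal (\<Sum>h=8..<N. 4 * \<delta> / 33 * real h powr (- 11 / 10))"
    using assms by (simp add: sum_ennreal exp_minus_epoch_level mult.assoc)
  also have "\<dots> \<le> ennreal (4 * \<delta> / 33 * (33 / 4))"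
    unfolding sum_distrib_left[symmetric] using assms sum_powr_tail by (intro ennreal_leI mult_left_mono) auto
  finally show "(\<Sum>h<N. if 8 \<le> h then ennreal (4 * exp (- epoch_level \<delta> h)) else 0) \<le> ennreal \<delta>" by simp
qed (simp add: summableI)

text \<open>An exceptional set takes the place of the probability of \<open>good_samples\<close>;
  this spares the measurability of that predicate.\<close>

lemma ex_confidence_failure_set:
  fixes \<rho> :: "real measure"
  assumes \<rho>: "prob_space \<rho>" "sets \<rho> = sets borel"
    and range: "AE g in \<rho>. a \<le> g \<and> g \<le> a + V" and \<delta>: "0 < \<delta>" "\<delta> < 1"
  defines "\<mu> \<equiv> \<integral>g. g \<partial>\<rho>" and "P \<equiv> \<Pi>\<^sub>M i\<in>(UNIV :: nat set). \<rho>"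
  shows "\<exists>N\<in>sets P. emeasure P N \<le> ennreal \<delta> \<and> (\<forall>G\<in>space P - N. good_samples \<delta> V a \<mu> G)"
proof -
  interpret \<rho>: prob_space \<rho> by (rule \<rho>(1))
  interpret sequence_space \<rho> ..
  note [measurable_cong] = \<rho>(2)
  have "AE g in \<rho>. norm g \<le> \<bar>a\<bar> + \<bar>V\<bar>" using range by eventually_elim auto
  then have int: "integrable \<rho> (\<lambda>g. g)" by (rule \<rho>.integrable_const_bound) measurable
  have \<mu>: "a \<le> \<mu>" "\<mu> \<le> a + V"
    unfolding \<mu>_def using range
    by (auto intro!: \<rho>.integral_ge_const \<rho>.integral_le_const int elim: eventually_mono)
  have V: "0 \<le> V" using \<mu> by simp
  have AE_seq: "AE G in P. \<forall>i. Q (G i)" if "AE g in \<rho>. Q g" for Q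
    unfolding AE_all_countable P_def using \<rho>(1) that by (intro allI AE_PiM_component) auto
  have Yb: "AE g in \<rho>. \<bar>g - \<mu>\<bar> \<le> V" using range by eventually_elim (use \<mu> in auto)
  have int2: "integrable \<rho> (\<lambda>g. (g - \<mu>)\<^sup>2)"
    by (rule \<rho>.integrable_const_bound[where B = "V\<^sup>2"])
      (use Yb in \<open>auto elim!: eventually_mono simp: abs_le_square_iff[symmetric] V\<close>)
  have centered: "(\<integral>g. g - \<mu> \<partial>\<rho>) = 0"
    using int by (simp add: \<mu>_def \<rho>.prob_space)
  define v where "v = (\<integral>g. (g - \<mu>)\<^sup>2 \<partial>\<rho>)"
  have v_nonneg: "0 \<le> v" unfolding v_def by simp
  show ?thesis
  proof (cases "v = 0")
    case True
    then have "AE g in \<rho>. (g - \<mu>)\<^sup>2 = 0"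
      using integral_nonneg_eq_0_iff_AE[OF int2] by (simp add: v_def)
    then have "AE g in \<rho>. g = \<mu>" by eventually_elim simp
    from AE_seq[OF this] obtain N where N: "{G \<in> space P. \<not> (\<forall>i. G i = \<mu>)} \<subseteq> N" "emeasure P N = 0" "N \<in> sets P"
      by (rule AE_E)
    have "good_samples \<delta> V a \<mu> G" if "G \<in> space P - N" for G
      using N(1) that by (intro good_samples_const \<delta> \<mu>) auto
    then show ?thesis using N by (intro bexI[of _ N]) auto
  next
    case False
    then have vpos: "0 < v" using v_nonneg by simp
    define \<sigma> where "\<sigma> = sqrt v"
    have \<sigma>2: "\<sigma>\<^sup>2 = v" using vpos by (simp add: \<sigma>_def)
    have \<sigma>: "0 < \<sigma>" "\<sigma> \<le> V / 2"
    proof -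
      \<comment> \<open>Popoviciu's inequality: the variance is at most the second moment about the
        midpoint of the range.\<close>
      define e where "e = \<mu> - (a + V / 2)"
      have "v \<le> v + e\<^sup>2" by simp
      also have "\<dots> = (\<integral>g. (g - \<mu>)\<^sup>2 + (2 * e * (g - \<mu>) + e\<^sup>2) \<partial>\<rho>)"
        using int int2 centered by (simp add: v_def \<rho>.prob_space)
      also have "\<dots> \<le> (V / 2)\<^sup>2"
      proof (rule \<rho>.integral_le_const)
        show "AE g in \<rho>. (g - \<mu>)\<^sup>2 + (2 * e * (g - \<mu>) + e\<^sup>2) \<le> (V / 2)\<^sup>2"
          using range
        proof eventually_elim
          case (elim g)
          have "(g - \<mu>)\<^sup>2 + (2 * e * (g - \<mu>) + e\<^sup>2) = (g - (a + V / 2))\<^sup>2"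
            by (simp add: e_def power2_eq_square algebra_simps)
          also have "\<dots> \<le> (V / 2)\<^sup>2"
          proof -
            have "\<bar>g - (a + V / 2)\<bar> \<le> \<bar>V / 2\<bar>" using elim unfolding abs_le_iff by (auto simp: field_simps)
            then show ?thesis by (simp only: abs_le_square_iff)
          qed
          finally show ?case .
        qed
      qed (use int int2 in auto)
      finally show "\<sigma> \<le> V / 2" unfolding \<sigma>_def using V by (intro real_le_lsqrt) auto
      show "0 < \<sigma>" using vpos by (simp add: \<sigma>_def)
    qed
    interpret walk: centered_bounded_walk \<rho> "\<lambda>g. g - \<mu>" V v
      by unfold_locales (use Yb centered vpos in \<open>auto simp: v_def\<close>)
    \<comment> \<open>For an epoch that is reached, the \<open>LEAST\<close> in
      \<open>epoch_horizon\<close> is attained, and the horizon is positive.\<close>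
    define active where "active = {h. 8 \<le> h \<and> (\<exists>n. epoch n = h)}"
    have "\<exists>N\<in>sets P. emeasure P N \<le> (if 8 \<le> h then ennreal (4 * exp (- epoch_level \<delta> h)) else 0) \<and>
      (h \<in> active \<longrightarrow> (\<forall>G\<in>space P - N. \<forall>t. real t \<le> epoch_horizon h \<longrightarrow>
      \<bar>\<Sum>i=1..t. G i - \<mu>\<bar> \<le> walk.boundary (epoch_horizon h) (epoch_level \<delta> h) \<and>
      (\<Sum>i=1..t. v - (G i - \<mu>)\<^sup>2) \<le> V * sqrt (2 * epoch_horizon h * v * epoch_level \<delta> h) \<and>
      (\<forall>n\<ge>t. 0 < \<mu> \<longrightarrow> walk.boundary (epoch_horizon h) (epoch_level \<delta> h) \<le> (\<Sum>i=1..t. G i - \<mu> + \<mu>) \<longrightarrow> 0 < (\<Sum>i=1..n. G i - \<mu> + \<mu>)) \<and>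
      (\<forall>n\<ge>t. \<mu> < 0 \<longrightarrow> (\<Sum>i=1..t. G i - \<mu> + \<mu>) \<le> - walk.boundary (epoch_horizon h) (epoch_level \<delta> h) \<longrightarrow> (\<Sum>i=1..n. G i - \<mu> + \<mu>) < 0)))"
      (is "\<exists>N\<in>_. ?Q h N") for h
    proof (cases "h \<in> active")
      case True
      then obtain n where n: "epoch n = h" "8 \<le> h" by (auto simp: active_def)
      then have "1 \<le> n" by (cases n) auto
      then have "0 < epoch_horizon h" using epoch_horizon(1)[of n] n by simp
      moreover have "0 < epoch_level \<delta> h" using epoch_level_ge[OF \<delta>, of h] n by simp
      ultimately show ?thesis
        using walk.ex_failure_set[of "epoch_horizon h" "epoch_level \<delta> h" \<mu>] n(2) unfolding P_def by auto
    next
      case False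
      then show ?thesis by (intro bexI[of _ "{}"]) auto
    qed
    then obtain F where F: "F h \<in> sets P" "?Q h (F h)" for h by metis
    from AE_seq[OF range] obtain N where N: "{G \<in> space P. \<not> (\<forall>i. a \<le> G i \<and> G i \<le> a + V)} \<subseteq> N"
      "emeasure P N = 0" "N \<in> sets P"
      by (rule AE_E)
    have [measurable]: "N \<in> sets P" "F h \<in> sets P" for h by (fact N F)+
    have "emeasure P (N \<union> (\<Union>h. F h)) \<le> emeasure P N + emeasure P (\<Union>h. F h)"
      by (rule emeasure_subadditive) measurable
    also have "\<dots> \<le> 0 + (\<Sum>h. emeasure P (F h))"
      using N F by (intro add_mono emeasure_subadditive_countably) auto
    also have "(\<Sum>h. emeasure P (F h)) \<le> (\<Sum>h. if 8 \<le> h then ennreal (4 * exp (- epoch_level \<delta> h)) else 0)"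
      using F by (intro suminf_le) (auto simp: summableI)
    also have "\<dots> \<le> ennreal \<delta>" by (rule sum_epoch_failure[OF \<delta>(1)])
    finally have small: "emeasure P (N \<union> (\<Union>h. F h)) \<le> ennreal \<delta>" by simp
    have "good_samples \<delta> V a \<mu> G" if G: "G \<in> space P - (N \<union> (\<Union>h. F h))" for G
    proof -
      have act: "epoch t \<in> active" if "8 \<le> t" for t
        using epoch_mono[OF that] epoch_initial[of 8] by (auto simp: active_def)
      have hor: "real t \<le> epoch_horizon (epoch t)" if "8 \<le> t" for t
        using epoch_horizon(1)[of t] that by simp
      note Q = F(2)[THEN conjunct2, rule_format, OF act _ hor]
      have GF: "G \<in> space P - F h" for h using G by auto
      have "a \<le> G i \<and> G i \<le> a + V" for i using N(1) G by auto
      then show ?thesis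
        using Q[OF _ GF] \<sigma> \<mu> \<delta>
        by (intro good_samplesI[where \<sigma> = \<sigma>]) (auto simp: \<sigma>2 walk.boundary_def)
    qed
    then show ?thesis using small by (intro bexI[of _ "N \<union> (\<Union>h. F h)"]) auto
  qed
qed

section \<open>Correctness of the procedure\<close>

text \<open>The iteration without the guard. Its fields have closed forms for every
  \<open>n\<close>, and the guard merely selects the iterate that is returned.\<close>

definition procR_states ::
    "real \<Rightarrow> real \<Rightarrow> real \<Rightarrow> real \<Rightarrow> (nat \<Rightarrow> real) \<Rightarrow> nat \<Rightarrow> procR_state" where
  "procR_states \<epsilon> \<delta> \<tau> V G n = (procR_body \<epsilon> \<delta> \<tau> V G ^^ n) procR_init"

lemma procR_states_Suc:
  "procR_states \<epsilon> \<delta> \<tau> V G (Suc n) = procR_body \<epsilon> \<delta> \<tau> V G (procR_states \<epsilon> \<delta> \<tau> V G n)"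
  by (simp add: procR_states_def)

lemma sample_mean_Suc:
  "sample_mean G (Suc n) = sample_mean G n + (G (Suc n) - sample_mean G n) / real (Suc n)"
proof -
  define m where "m = sample_mean G n"
  \<comment> \<open>For \<open>n = 0\<close> the convention \<open>x / 0 = 0\<close> gives the mean
    0, which is also the initial mean of the procedure.\<close>
  have sum: "(\<Sum>i=1..n. G i) = real n * m" by (cases "n = 0") (auto simp: sample_mean_def m_def)
  have "sample_mean G (Suc n) = (real n * m + G (Suc n)) / real (Suc n)"
    using sum by (simp add: sample_mean_def)
  also have "\<dots> = m + (G (Suc n) - m) / real (Suc n)" by (simp add: field_simps)
  finally show ?thesis by (simp add: m_def)
qed

lemma sum_sq_dev:
  "(\<Sum>i=1..n. (G i - sample_mean G n)\<^sup>2) = (\<Sum>i=1..n. (G i)\<^sup>2) - real n * (sample_mean G n)\<^sup>2"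
proof -
  define m where "m = sample_mean G n"
  have sum: "(\<Sum>i=1..n. G i) = real n * m" by (cases "n = 0") (auto simp: sample_mean_def m_def)
  have "(\<Sum>i=1..n. (G i - m)\<^sup>2) = (\<Sum>i=1..n. (G i)\<^sup>2 - 2 * m * G i + m\<^sup>2)"
    by (intro sum.cong) (auto simp: power2_eq_square algebra_simps)
  also have "\<dots> = (\<Sum>i=1..n. (G i)\<^sup>2) - 2 * m * (\<Sum>i=1..n. G i) + real n * m\<^sup>2"
    by (simp add: sum.distrib sum_subtractf sum_distrib_left)
  finally show ?thesis unfolding sum by (simp add: m_def power2_eq_square)
qed

text \<open>Welford's update, the form in which the procedure maintains \<open>M\<close>. Expressing
  the new sample by the old and the new mean reduces it to a polynomial identity.\<close>

lemma welford_step: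
  "(\<Sum>i=1..Suc n. (G i - sample_mean G (Suc n))\<^sup>2) =
    (\<Sum>i=1..n. (G i - sample_mean G n)\<^sup>2) + (G (Suc n) - sample_mean G n) * (G (Suc n) - sample_mean G (Suc n))"
proof -
  define m m' g where "m = sample_mean G n" and "m' = sample_mean G (Suc n)" and "g = G (Suc n)"
  have g: "g = real (Suc n) * m' - real n * m"
    by (simp add: m_def m'_def g_def sample_mean_Suc field_simps)
  have "g\<^sup>2 - real (Suc n) * m'\<^sup>2 = - (real n * m\<^sup>2) + (g - m) * (g - m')"
    unfolding g by (simp add: power2_eq_square algebra_simps)
  then show ?thesis unfolding sum_sq_dev by (simp add: m_def m'_def g_def)
qed

lemma procR_states_counters:
  fixes \<epsilon> \<delta> \<tau> V :: real and G :: "nat \<Rightarrow> real"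
  defines "st \<equiv> procR_states \<epsilon> \<delta> \<tau> V G"
  shows "pr_j (st n) = Suc n \<and> pr_h (st n) = epoch n \<and> pr_mean (st n) = sample_mean G n \<and>
    pr_M (st n) = (\<Sum>i=1..n. (G i - sample_mean G n)\<^sup>2) \<and>
    (1 \<le> n \<longrightarrow> pr_alpha (st n) = epoch_ratio (epoch n) \<and> pr_x (st n) = bonus \<delta> n)"
proof (induction n)
  case 0
  show ?case by (simp add: st_def procR_states_def procR_init_def sample_mean_def)
next
  case (Suc n)
  define Q where "Q = (\<lambda>n. \<Sum>i=1..n. (G i - sample_mean G n)\<^sup>2)"
  have Q: "Q (Suc n) = Q n + (G (Suc n) - sample_mean G n) *
      (G (Suc n) - (sample_mean G n + (G (Suc n) - sample_mean G n) / real (Suc n)))"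
    using welford_step[of G n] unfolding Q_def sample_mean_Suc .
  have Q_eq: "(\<Sum>i=1..n. (G i - sample_mean G n)\<^sup>2) = Q n" for n by (simp add: Q_def)
  note IH = Suc[unfolded Q_eq]
  show ?case
  proof (cases "\<lfloor>procR_beta ^ epoch n\<rfloor> \<le> int (Suc n)")
    case True
    then show ?thesis
      unfolding Q_eq unfolding st_def procR_states_Suc procR_body_def Let_def Q sample_mean_Suc
      using IH by (simp add: st_def bonus_def epoch_ratio_def epoch_level_def del: of_nat_Suc)
  next
    case False
    \<comment> \<open>The floor of \<open>procR_beta ^ 0\<close> is 1, so the first sample always
      opens an epoch and replaces the initial values of \<open>pr_alpha\<close> and
      \<open>pr_x\<close>.\<close>
    then have "1 \<le> n" by (cases n) auto
    with False show ?thesis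
      unfolding Q_eq unfolding st_def procR_states_Suc procR_body_def Let_def Q sample_mean_Suc
      using IH by (simp add: st_def bonus_def del: of_nat_Suc)
  qed
qed

lemma procR_states_bounds:
  fixes \<epsilon> \<delta> \<tau> V :: real and G :: "nat \<Rightarrow> real"
  defines "st \<equiv> procR_states \<epsilon> \<delta> \<tau> V G" and "m \<equiv> sample_mean G" and "r \<equiv> radius \<delta> V G"
  shows "pr_LB (st (Suc n)) = max (pr_LB (st n)) (\<bar>m (Suc n)\<bar> - r (Suc n))"
    and "pr_UB (st (Suc n)) = min (pr_UB (st n)) (ereal (\<bar>m (Suc n)\<bar> + r (Suc n)))"
    and "pr_LBhat (st (Suc n)) = max (pr_LBhat (st n)) (ereal (m (Suc n) - r (Suc n)))"
    and "pr_UBhat (st (Suc n)) = min (pr_UBhat (st n)) (ereal (m (Suc n) + r (Suc n)))"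
    and "pr_result (st (Suc n)) =
      (if (pr_UBhat (st (Suc n)) - pr_LBhat (st (Suc n))) / 2 \<le> ereal (\<epsilon> * \<tau>)
       then Some (real_of_ereal ((pr_UBhat (st (Suc n)) + pr_LBhat (st (Suc n))) / 2)) else None)"
proof -
  define s where "s = st n"
  define s' where "s' = procR_body \<epsilon> \<delta> \<tau> V G s"
  have s': "s' = st (Suc n)" by (simp add: s'_def s_def st_def procR_states_Suc)
  note body = s'_def[unfolded procR_body_def Let_def]
  define c where "c = sqrt (pr_M s' / real (pr_j s)) * sqrt (2 * pr_x s' / real (pr_j s)) +
    3 * V * pr_x s' / real (pr_j s)"
  have c: "c = r (Suc n)"
    using procR_states_counters[of \<epsilon> \<delta> \<tau> V G n] procR_states_counters[of \<epsilon> \<delta> \<tau> V G "Suc n"]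
    unfolding c_def s' s_def st_def by (simp add: r_def radius_def sample_variance_def)
  have mean: "pr_mean s' = m (Suc n)"
    using procR_states_counters[of \<epsilon> \<delta> \<tau> V G "Suc n"] unfolding s' st_def by (simp add: m_def)
  have "pr_LB s' = max (pr_LB s) (\<bar>pr_mean s'\<bar> - c)"
    "pr_UB s' = min (pr_UB s) (ereal (\<bar>pr_mean s'\<bar> + c))"
    "pr_LBhat s' = max (pr_LBhat s) (ereal (pr_mean s' - c))"
    "pr_UBhat s' = min (pr_UBhat s) (ereal (pr_mean s' + c))"
    "pr_result s' = (if (pr_UBhat s' - pr_LBhat s') / 2 \<le> ereal (\<epsilon> * \<tau>)
       then Some (real_of_ereal ((pr_UBhat s' + pr_LBhat s') / 2)) else None)"
    unfolding c_def by (simp_all only: body procR_state.simps)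
  note eqs = this[unfolded c mean, unfolded s' s_def]
  show "pr_LB (st (Suc n)) = max (pr_LB (st n)) (\<bar>m (Suc n)\<bar> - r (Suc n))" by (fact eqs)
  show "pr_UB (st (Suc n)) = min (pr_UB (st n)) (ereal (\<bar>m (Suc n)\<bar> + r (Suc n)))" by (fact eqs)
  show "pr_LBhat (st (Suc n)) = max (pr_LBhat (st n)) (ereal (m (Suc n) - r (Suc n)))" by (fact eqs)
  show "pr_UBhat (st (Suc n)) = min (pr_UBhat (st n)) (ereal (m (Suc n) + r (Suc n)))" by (fact eqs)
  show "pr_result (st (Suc n)) =
      (if (pr_UBhat (st (Suc n)) - pr_LBhat (st (Suc n))) / 2 \<le> ereal (\<epsilon> * \<tau>)
       then Some (real_of_ereal ((pr_UBhat (st (Suc n)) + pr_LBhat (st (Suc n))) / 2)) else None)"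
    by (fact eqs)
qed

lemma procR_states_0:
  "pr_LB (procR_states \<epsilon> \<delta> \<tau> V G 0) = 0" "pr_UB (procR_states \<epsilon> \<delta> \<tau> V G 0) = \<infinity>"
  "pr_LBhat (procR_states \<epsilon> \<delta> \<tau> V G 0) = - \<infinity>" "pr_UBhat (procR_states \<epsilon> \<delta> \<tau> V G 0) = \<infinity>"
  "pr_result (procR_states \<epsilon> \<delta> \<tau> V G 0) = None" "pr_mean (procR_states \<epsilon> \<delta> \<tau> V G 0) = 0"
  by (simp_all add: procR_states_def procR_init_def)

definition procR_return :: "real \<Rightarrow> procR_state \<Rightarrow> real" where
  "procR_return \<epsilon> st = (case pr_result st of
      Some v \<Rightarrow> v
    | None \<Rightarrow> sgn (pr_mean st) / 2 * ((1 + \<epsilon>) * pr_LB st + (1 - \<epsilon>) * real_of_ereal (pr_UB st)))"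

lemma procR_output_eq:
  "procR_output \<epsilon> \<delta> \<tau> V G =
    (if \<exists>k. \<not> procR_guard \<epsilon> \<tau> (procR_states \<epsilon> \<delta> \<tau> V G k)
     then procR_return \<epsilon> (procR_states \<epsilon> \<delta> \<tau> V G (LEAST k. \<not> procR_guard \<epsilon> \<tau> (procR_states \<epsilon> \<delta> \<tau> V G k)))
     else 0)"
  by (simp add: procR_output_def while_option_def procR_return_def procR_states_def)

text \<open>A number \<open>z \<ge> 1\<close> is at most twice its floor. Any constant would serve,
  since the lemma only has to make the radius vanish in the limit.\<close>

lemma epoch_ratio_le: "1 \<le> h \<Longrightarrow> epoch_ratio h \<le> 11 / 5"
proof -
  assume "1 \<le> h"
  define z where "z = procR_beta ^ (h - 1)"
  have z: "procR_beta ^ h = 11 / 10 * z"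
    using \<open>1 \<le> h\<close> by (cases h) (auto simp: z_def procR_beta_def)
  have f: "1 \<le> real_of_int \<lfloor>z\<rfloor>" using floor_beta_ge_1[of "h - 1"] unfolding z_def by linarith
  have "real_of_int \<lfloor>procR_beta ^ h\<rfloor> \<le> 11 / 10 * z" unfolding z[symmetric] by linarith
  also have "\<dots> \<le> 11 / 5 * real_of_int \<lfloor>z\<rfloor>" using f by linarith
  finally show ?thesis
    unfolding epoch_ratio_def z_def[symmetric] using f by (subst pos_divide_le_eq) auto
qed

text \<open>By \<open>epoch n \<le> n\<close> the level grows at most logarithmically in
  \<open>n\<close>.\<close>

lemma bonus_over_n_tendsto_0:
  assumes "0 < \<delta>" "\<delta> < 1"
  shows "(\<lambda>n. bonus \<delta> n / real n) \<longlonglongrightarrow> 0"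
proof (rule tendsto_sandwich)
  let ?u = "\<lambda>n. 11 / 5 * (ln (33 / \<delta>) * (1 / real n) + 11 / 10 * (ln (real n) / real n))"
  have level: "0 < epoch_level \<delta> (epoch n)" if "1 \<le> n" for n
    using epoch_level_ge[of \<delta> "epoch n"] epoch_pos[OF that] assms by simp
  have "0 \<le> bonus \<delta> n / real n" if "1 \<le> n" for n
    using bonus_ge_level[OF assms that] level[OF that] by simp
  then show "\<forall>\<^sub>F n in sequentially. 0 \<le> bonus \<delta> n / real n"
    by (intro eventually_sequentiallyI)
  have "bonus \<delta> n / real n \<le> ?u n" if n: "1 \<le> n" for n
  proof -
    have h: "1 \<le> epoch n" using epoch_pos[OF n] .
    have "epoch_level \<delta> (epoch n) = ln (33 / \<delta>) + 11 / 10 * ln (real (epoch n))"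
      using assms h by (simp add: epoch_level_eq ln_mult ln_div ln_powr)
    also have "\<dots> \<le> ln (33 / \<delta>) + 11 / 10 * ln (real n)"
      using h epoch_le[of n] by simp
    finally have "bonus \<delta> n \<le> 11 / 5 * (ln (33 / \<delta>) + 11 / 10 * ln (real n))"
      unfolding bonus_def using epoch_ratio_le[OF h] level[OF n] epoch_ratio_ge_1[of "epoch n"]
      by (intro mult_mono) auto
    then have "bonus \<delta> n / real n \<le> 11 / 5 * (ln (33 / \<delta>) + 11 / 10 * ln (real n)) / real n"
      by (rule divide_right_mono) simp
    then show ?thesis by (simp add: add_divide_distrib)
  qed
  then show "\<forall>\<^sub>F n in sequentially. bonus \<delta> n / real n \<le> ?u n"
    by (intro eventually_sequentiallyI)
  have "?u \<longlonglongrightarrow> 11 / 5 * (ln (33 / \<delta>) * 0 + 11 / 10 * 0)"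
    by (intro tendsto_intros lim_ln_over_n lim_1_over_n)
  then show "?u \<longlonglongrightarrow> 0" by simp
qed simp

lemma radius_tendsto_0:
  assumes "0 < \<delta>" "\<delta> < 1" and range: "\<And>i. a \<le> G i" "\<And>i. G i \<le> a + V"
  shows "radius \<delta> V G \<longlonglongrightarrow> 0"
proof (rule tendsto_sandwich)
  have V: "0 \<le> V" using range(1)[of 0] range(2)[of 0] by linarith
  let ?b = "\<lambda>n. bonus \<delta> n / real n"
  let ?u = "\<lambda>n. V * sqrt (2 * ?b n) + 3 * V * ?b n"
  have b: "0 \<le> ?b n" if "1 \<le> n" for n
    using bonus_ge_level[OF assms(1,2) that] epoch_level_ge[of \<delta> "epoch n"] epoch_pos[OF that] assms by simp
  have var: "sqrt (sample_variance G n) \<le> V" if "1 \<le> n" for n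
  proof (rule real_le_lsqrt)
    have m: "a \<le> sample_mean G n" "sample_mean G n \<le> a + V"
      using sample_mean_bounds[of n a G "a + V"] range that by auto
    have "(\<Sum>i=1..n. (G i - sample_mean G n)\<^sup>2) \<le> (\<Sum>i=1..n. V\<^sup>2)"
    proof (rule sum_mono)
      fix i
      have "\<bar>G i - sample_mean G n\<bar> \<le> \<bar>V\<bar>" using range(1)[of i] range(2)[of i] m by linarith
      then show "(G i - sample_mean G n)\<^sup>2 \<le> V\<^sup>2" by (simp only: abs_le_square_iff)
    qed
    then show "sample_variance G n \<le> V\<^sup>2"
      using that by (simp add: sample_variance_def field_simps)
  qed (use V in auto)
  have radius: "radius \<delta> V G n = sqrt (sample_variance G n) * sqrt (2 * ?b n) + 3 * V * ?b n" for n
    by (simp add: radius_def)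
  have "0 \<le> radius \<delta> V G n" if "1 \<le> n" for n
    unfolding radius using b[OF that] V sample_variance_nonneg[of G n]
    by (intro add_nonneg_nonneg mult_nonneg_nonneg) simp_all
  then show "\<forall>\<^sub>F n in sequentially. 0 \<le> radius \<delta> V G n" by (intro eventually_sequentiallyI)
  have "radius \<delta> V G n \<le> ?u n" if "1 \<le> n" for n
  proof -
    have "sqrt (sample_variance G n) * sqrt (2 * ?b n) \<le> V * sqrt (2 * ?b n)"
      using var[OF that] b[OF that] by (intro mult_right_mono) auto
    then show ?thesis by (simp add: radius)
  qed
  then show "\<forall>\<^sub>F n in sequentially. radius \<delta> V G n \<le> ?u n" by (intro eventually_sequentiallyI)
  have "?u \<longlonglongrightarrow> V * sqrt (2 * 0) + 3 * V * 0"
    by (intro tendsto_intros bonus_over_n_tendsto_0 assms)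
  then show "?u \<longlonglongrightarrow> 0" by simp
qed simp

text \<open>There are three ways to an output. Without halting, the vanishing radii force
  \<open>\<mu> = 0\<close> and \<open>\<tau> = 0\<close>, where the default 0 is exact. A return
  from inside the loop is the midpoint of a short interval around \<open>\<mu>\<close>. At the exit
  of the loop the bounds locate the magnitude, and \<open>good_samples\<close> supplies the
  sign.\<close>

lemma procR_output_accuracy:
  assumes \<epsilon>: "0 < \<epsilon>" "\<epsilon> < 1" and \<delta>: "0 < \<delta>" "\<delta> < 1" and \<tau>: "0 \<le> \<tau>"
    and good: "good_samples \<delta> V a \<mu> G"
  shows "\<bar>procR_output \<epsilon> \<delta> \<tau> V G - \<mu>\<bar> \<le> \<epsilon> * (\<bar>\<mu>\<bar> + \<tau>)"
proof -
  define st where "st = procR_states \<epsilon> \<delta> \<tau> V G"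
  define m where "m = sample_mean G"
  define r where "r = radius \<delta> V G"
  have conf: "\<bar>m n - \<mu>\<bar> \<le> r n" if "1 \<le> n" for n
    using good that by (simp add: good_samples_def m_def r_def)
  have sign: "sgn (m n) = sgn \<mu>" if "1 \<le> j" "j \<le> n" "r j < \<bar>m j\<bar>" for j n
    using good that by (simp add: good_samples_def m_def r_def)
  note init = procR_states_0[of \<epsilon> \<delta> \<tau> V G, folded st_def]
  note step = procR_states_bounds[of \<epsilon> \<delta> \<tau> V G, folded st_def m_def r_def]
  \<comment> \<open>A nonzero \<open>pr_LB\<close> is evidence of an earlier mean beyond its radius,
    the premise of the sign clause of \<open>good_samples\<close>. The guard demands such a value
    before the loop exits.\<close>
  have inv: "0 \<le> pr_LB (st n) \<and> pr_LB (st n) \<le> \<bar>\<mu>\<bar> \<and> (pr_LB (st n) \<noteq> 0 \<longrightarrow> (\<exists>j\<ge>1. j \<le> n \<and> r j < \<bar>m j\<bar>)) \<and>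
    ereal \<bar>\<mu>\<bar> \<le> pr_UB (st n) \<and> ereal \<mu> \<le> pr_UBhat (st n) \<and> pr_LBhat (st n) \<le> ereal \<mu>" for n
  proof (induction n)
    case 0
    then show ?case by (simp add: init)
  next
    case (Suc n)
    have c: "\<bar>m (Suc n) - \<mu>\<bar> \<le> r (Suc n)" by (rule conf) simp
    have "\<exists>j\<ge>1. j \<le> Suc n \<and> r j < \<bar>m j\<bar>" if "pr_LB (st (Suc n)) \<noteq> 0"
    proof (cases "pr_LB (st n) = 0")
      case True
      then have "r (Suc n) < \<bar>m (Suc n)\<bar>" using that unfolding step(1) by (auto simp: max_def split: if_splits)
      then show ?thesis by (intro exI[of _ "Suc n"]) auto
    next
      case False
      then show ?thesis using Suc by (meson le_SucI)
    qed
    then show ?case using Suc c unfolding step(1-4) by auto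
  qed
  have fin: "\<exists>u l' u'. pr_UB (st n) = ereal u \<and> pr_LBhat (st n) = ereal l' \<and> pr_UBhat (st n) = ereal u' \<and>
      \<bar>\<mu>\<bar> \<le> u \<and> u \<le> \<bar>m n\<bar> + r n \<and> l' \<le> \<mu> \<and> m n - r n \<le> l' \<and> \<mu> \<le> u' \<and> u' \<le> m n + r n \<and>
      \<bar>m n\<bar> - r n \<le> pr_LB (st n)" if n: "1 \<le> n" for n
  proof -
    obtain k where k: "n = Suc k" using n by (cases n) auto
    have "pr_UB (st n) \<le> ereal (\<bar>m n\<bar> + r n)" "pr_UBhat (st n) \<le> ereal (m n + r n)"
      "ereal (m n - r n) \<le> pr_LBhat (st n)" "\<bar>m n\<bar> - r n \<le> pr_LB (st n)"
      unfolding k step(1-4) by auto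
    then show ?thesis
      using inv[of n] by (cases "pr_UB (st n)"; cases "pr_LBhat (st n)"; cases "pr_UBhat (st n)") auto
  qed
  have result: "pr_result (st n) = (if (u' - l') / 2 \<le> \<epsilon> * \<tau> then Some ((u' + l') / 2) else None)"
    if n: "1 \<le> n" and hats: "pr_LBhat (st n) = ereal l'" "pr_UBhat (st n) = ereal u'" for n l' u'
  proof -
    obtain k where k: "n = Suc k" using n by (cases n) auto
    show ?thesis using step(5)[of k] hats unfolding k by simp
  qed
  show ?thesis
  proof (cases "\<exists>k. \<not> procR_guard \<epsilon> \<tau> (st k)")
    case False
    have "\<mu> = 0 \<and> \<tau> = 0"
    proof (rule ccontr)
      assume "\<not> (\<mu> = 0 \<and> \<tau> = 0)"
      \<comment> \<open>A radius below \<open>\<epsilon> * \<tau>\<close> triggers the return inside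
        the loop. For \<open>\<tau> = 0\<close> the bounds are off by at most two radii, one from
        the mean and one from the interval, hence the half.\<close>
      then have "0 < (if 0 < \<tau> then \<epsilon> * \<tau> else \<epsilon> * \<bar>\<mu>\<bar> / 2)" using \<epsilon> \<tau> by auto
      moreover have "r \<longlonglongrightarrow> 0"
        using good \<delta> unfolding r_def good_samples_def by (intro radius_tendsto_0) auto
      ultimately have "\<forall>\<^sub>F n in sequentially. r n < (if 0 < \<tau> then \<epsilon> * \<tau> else \<epsilon> * \<bar>\<mu>\<bar> / 2)"
        by (metis order_tendstoD(2))
      then have "\<forall>\<^sub>F n in sequentially. r n < (if 0 < \<tau> then \<epsilon> * \<tau> else \<epsilon> * \<bar>\<mu>\<bar> / 2) \<and> 1 \<le> n"
        using eventually_ge_at_top by (rule eventually_conj)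
      then obtain n where n: "1 \<le> n" and r: "r n < (if 0 < \<tau> then \<epsilon> * \<tau> else \<epsilon> * \<bar>\<mu>\<bar> / 2)"
        by (auto dest: eventually_happens'[OF sequentially_bot])
      obtain u l' u' where f: "pr_UB (st n) = ereal u" "pr_LBhat (st n) = ereal l'" "pr_UBhat (st n) = ereal u'"
        "\<bar>\<mu>\<bar> \<le> u" "u \<le> \<bar>m n\<bar> + r n" "l' \<le> \<mu>" "m n - r n \<le> l'" "\<mu> \<le> u'" "u' \<le> m n + r n"
        "\<bar>m n\<bar> - r n \<le> pr_LB (st n)"
        using fin[OF n] by blast
      have g: "procR_guard \<epsilon> \<tau> (st n)" using False by blast
      then have none: "\<not> (u' - l') / 2 \<le> \<epsilon> * \<tau>"
        using result[OF n f(2,3)] by (auto simp: procR_guard_def split: if_splits)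
      show False
      proof (cases "0 < \<tau>")
        case True
        then show False using r none f by simp
      next
        case False
        then have \<tau>0: "\<tau> = 0" and \<mu>0: "\<mu> \<noteq> 0" using \<tau> \<open>\<not> (\<mu> = 0 \<and> \<tau> = 0)\<close> by auto
        have r: "r n < \<epsilon> * \<bar>\<mu>\<bar> / 2" using r False by simp
        have "\<epsilon> * \<bar>\<mu>\<bar> < 1 * \<bar>\<mu>\<bar>" using \<epsilon> \<mu>0 by (intro mult_strict_right_mono) auto
        then have LB: "\<bar>\<mu>\<bar> - \<epsilon> * \<bar>\<mu>\<bar> \<le> pr_LB (st n)" "0 < pr_LB (st n)" "u \<le> \<bar>\<mu>\<bar> + \<epsilon> * \<bar>\<mu>\<bar>"
          using f conf[OF n] r by linarith+
        have "(1 - \<epsilon>) * u \<le> (1 - \<epsilon>) * ((1 + \<epsilon>) * \<bar>\<mu>\<bar>)"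
          using LB \<epsilon> by (intro mult_left_mono) (auto simp: algebra_simps)
        also have "\<dots> = (1 + \<epsilon>) * (\<bar>\<mu>\<bar> - \<epsilon> * \<bar>\<mu>\<bar>)" by (simp add: algebra_simps)
        also have "\<dots> \<le> (1 + \<epsilon>) * pr_LB (st n)" using LB \<epsilon> by (intro mult_left_mono) auto
        finally show False using g LB by (simp add: procR_guard_def f \<tau>0)
      qed
    qed
    moreover have "procR_output \<epsilon> \<delta> \<tau> V G = 0"
      using False unfolding procR_output_eq st_def[symmetric] by simp
    ultimately show ?thesis by simp
  next
    case True
    define n where "n = (LEAST k. \<not> procR_guard \<epsilon> \<tau> (st k))"
    have ng: "\<not> procR_guard \<epsilon> \<tau> (st n)" unfolding n_def using True by (rule LeastI_ex)
    have "procR_guard \<epsilon> \<tau> (st 0)" by (simp add: procR_guard_def init)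
    then have n: "1 \<le> n" using ng by (cases n) auto
    obtain u l' u' where f: "pr_UB (st n) = ereal u" "pr_LBhat (st n) = ereal l'" "pr_UBhat (st n) = ereal u'"
      "\<bar>\<mu>\<bar> \<le> u" "l' \<le> \<mu>" "\<mu> \<le> u'"
      using fin[OF n] by blast
    have out: "procR_output \<epsilon> \<delta> \<tau> V G = procR_return \<epsilon> (st n)"
      using True unfolding procR_output_eq st_def[symmetric] n_def by simp
    show ?thesis
    proof (cases "(u' - l') / 2 \<le> \<epsilon> * \<tau>")
      case True
      then have "procR_output \<epsilon> \<delta> \<tau> V G = (u' + l') / 2"
        using result[OF n f(2,3)] by (simp add: out procR_return_def)
      moreover have "\<epsilon> * \<tau> \<le> \<epsilon> * (\<bar>\<mu>\<bar> + \<tau>)" using \<epsilon> by simp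
      ultimately show ?thesis using True f by (auto simp: abs_le_iff field_simps)
    next
      case False
      then have none: "pr_result (st n) = None" using result[OF n f(2,3)] by simp
      define L where "L = pr_LB (st n)"
      have L: "L \<noteq> 0" "(1 - \<epsilon>) * u \<le> (1 + \<epsilon>) * L + 2 * \<epsilon> * \<tau>"
        using ng none by (auto simp: procR_guard_def f L_def)
      obtain j where "1 \<le> j" "j \<le> n" "r j < \<bar>m j\<bar>" using inv[of n] L(1) unfolding L_def by blast
      then have sgn: "sgn (m n) = sgn \<mu>" by (rule sign)
      have "0 < L" "L \<le> \<bar>\<mu>\<bar>" using inv[of n] L(1) by (auto simp: L_def)
      then have "\<mu> \<noteq> 0" by auto
      define w where "w = ((1 + \<epsilon>) * L + (1 - \<epsilon>) * u) / 2"
      have "pr_mean (st n) = m n"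
        using procR_states_counters[of \<epsilon> \<delta> \<tau> V G n] by (simp add: st_def m_def)
      then have outw: "procR_output \<epsilon> \<delta> \<tau> V G = sgn \<mu> * w"
        by (simp add: out procR_return_def none f(1) w_def sgn L_def)
      \<comment> \<open>The exit condition makes the two averaged terms interchangeable up to
        \<open>2 * \<epsilon> * \<tau>\<close>: the first bounds \<open>w\<close> from above, the
        second from below.\<close>
      have "(1 + \<epsilon>) * L \<le> (1 + \<epsilon>) * \<bar>\<mu>\<bar>" using \<epsilon> \<open>L \<le> \<bar>\<mu>\<bar>\<close> by (intro mult_left_mono) auto
      moreover have "(1 - \<epsilon>) * \<bar>\<mu>\<bar> \<le> (1 - \<epsilon>) * u" using \<epsilon> f(4) by (intro mult_left_mono) auto
      ultimately have "\<bar>w - \<bar>\<mu>\<bar>\<bar> \<le> \<epsilon> * (\<bar>\<mu>\<bar> + \<tau>)"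
        using L(2) by (simp add: w_def abs_le_iff field_simps)
      moreover have "sgn \<mu> * w - \<mu> = sgn \<mu> * (w - \<bar>\<mu>\<bar>)"
        using \<open>\<mu> \<noteq> 0\<close> by (cases "0 < \<mu>") (auto simp: algebra_simps)
      ultimately show ?thesis
        using \<open>\<mu> \<noteq> 0\<close> by (simp add: outw abs_mult abs_sgn_eq)
    qed
  qed
qed

section \<open>Measurability of the output\<close>

lemma sample_mean_measurable [measurable]:
  "(\<lambda>G. sample_mean G n) \<in> borel_measurable (\<Pi>\<^sub>M i\<in>(UNIV :: nat set). borel)"
  unfolding sample_mean_def by measurable

lemma radius_measurable [measurable]:
  "(\<lambda>G. radius \<delta> V G n) \<in> borel_measurable (\<Pi>\<^sub>M i\<in>(UNIV :: nat set). borel)"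
  unfolding radius_def sample_variance_def by measurable

lemma procR_states_measurable [measurable]:
  fixes \<epsilon> \<delta> \<tau> V :: real
  defines "P \<equiv> \<Pi>\<^sub>M i\<in>(UNIV :: nat set). (borel :: real measure)"
  shows "(\<lambda>G. pr_LB (procR_states \<epsilon> \<delta> \<tau> V G n)) \<in> borel_measurable P"
    and "(\<lambda>G. pr_UB (procR_states \<epsilon> \<delta> \<tau> V G n)) \<in> borel_measurable P"
    and "(\<lambda>G. pr_LBhat (procR_states \<epsilon> \<delta> \<tau> V G n)) \<in> borel_measurable P"
    and "(\<lambda>G. pr_UBhat (procR_states \<epsilon> \<delta> \<tau> V G n)) \<in> borel_measurable P"
  unfolding P_def by (induction n) (simp_all add: procR_states_0 procR_states_bounds)

lemma procR_result_None_measurable [measurable]: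
  "Measurable.pred (\<Pi>\<^sub>M i\<in>(UNIV :: nat set). borel) (\<lambda>G. pr_result (procR_states \<epsilon> \<delta> \<tau> V G n) = None)"
proof (cases n)
  case 0
  then show ?thesis by (simp add: procR_states_0)
next
  case (Suc k)
  have "(pr_result (procR_states \<epsilon> \<delta> \<tau> V G (Suc k)) = None) =
    (\<not> (pr_UBhat (procR_states \<epsilon> \<delta> \<tau> V G (Suc k)) - pr_LBhat (procR_states \<epsilon> \<delta> \<tau> V G (Suc k))) / 2 \<le> ereal (\<epsilon> * \<tau>))" for G
    unfolding procR_states_bounds(5) by simp
  note eq = this
  show ?thesis unfolding Suc eq by measurable
qed

lemma procR_guard_measurable [measurable]:
  "Measurable.pred (\<Pi>\<^sub>M i\<in>(UNIV :: nat set). borel) (\<lambda>G. procR_guard \<epsilon> \<tau> (procR_states \<epsilon> \<delta> \<tau> V G n))"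
  unfolding procR_guard_def by measurable

text \<open>The value inside the option \<open>pr_result\<close> is rewritten through the interval
  bounds, which are measurable extended reals.\<close>

lemma procR_return_measurable [measurable]:
  "(\<lambda>G. procR_return \<epsilon> (procR_states \<epsilon> \<delta> \<tau> V G n)) \<in> borel_measurable (\<Pi>\<^sub>M i\<in>(UNIV :: nat set). borel)"
proof -
  have mean: "pr_mean (procR_states \<epsilon> \<delta> \<tau> V G n) = sample_mean G n" for G n
    using procR_states_counters by blast
  have "procR_return \<epsilon> (procR_states \<epsilon> \<delta> \<tau> V G n) =
    (if pr_result (procR_states \<epsilon> \<delta> \<tau> V G n) = None
     then sgn (sample_mean G n) / 2 * ((1 + \<epsilon>) * pr_LB (procR_states \<epsilon> \<delta> \<tau> V G n) +
       (1 - \<epsilon>) * real_of_ereal (pr_UB (procR_states \<epsilon> \<delta> \<tau> V G n)))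
     else real_of_ereal ((pr_UBhat (procR_states \<epsilon> \<delta> \<tau> V G n) + pr_LBhat (procR_states \<epsilon> \<delta> \<tau> V G n)) / 2))" for G
  proof (cases n)
    case 0
    then show ?thesis by (simp add: procR_return_def procR_states_0 sample_mean_def)
  next
    case (Suc k)
    show ?thesis
      using procR_states_bounds(5)[of \<epsilon> \<delta> \<tau> V G k]
      by (auto simp: procR_return_def Suc mean split: if_splits)
  qed
  then show ?thesis by simp
qed

lemma procR_output_measurable [measurable]:
  "procR_output \<epsilon> \<delta> \<tau> V \<in> borel_measurable (\<Pi>\<^sub>M i\<in>(UNIV :: nat set). borel)"
proof -
  have "(\<lambda>G. procR_return \<epsilon> (procR_states \<epsilon> \<delta> \<tau> V G (LEAST k. \<not> procR_guard \<epsilon> \<tau> (procR_states \<epsilon> \<delta> \<tau> V G k))))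
    \<in> borel_measurable (\<Pi>\<^sub>M i\<in>(UNIV :: nat set). borel)"
    by (rule measurable_compose_countable) measurable
  then show ?thesis unfolding procR_output_eq[abs_def] by measurable
qed

section \<open>The clipped loss\<close>

text \<open>If \<open>\<mu>\<close> is larger in magnitude than both \<open>x\<close> and
  \<open>v\<close>, these lie on the same side of \<open>\<mu>\<close>, so the two errors do not add
  and their maximum counts. The denominator of \<open>\<mu>\<close> is then at most twice that of
  \<open>v\<close>, because \<open>\<epsilon> < 1\<close>. Otherwise the triangle inequality
  suffices.\<close>

lemma two_step_relative_error:
  fixes x \<mu> v \<epsilon> \<tau> :: real
  assumes \<epsilon>: "0 < \<epsilon>" "\<epsilon> < 1" and \<tau>: "0 \<le> \<tau>"
    and x: "\<bar>x - \<mu>\<bar> \<le> \<epsilon> * (\<bar>\<mu>\<bar> + \<tau>)" and v: "\<bar>\<mu> - v\<bar> \<le> \<epsilon> * (\<bar>v\<bar> + \<tau>)"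
  shows "\<bar>x - v\<bar> \<le> 2 * \<epsilon> * max (\<bar>x\<bar> + \<tau>) (\<bar>v\<bar> + \<tau>)"
proof -
  define R where "R = max (\<bar>x\<bar> + \<tau>) (\<bar>v\<bar> + \<tau>)"
  have vR: "\<epsilon> * (\<bar>v\<bar> + \<tau>) \<le> \<epsilon> * R" using \<epsilon> by (intro mult_left_mono) (auto simp: R_def)
  show ?thesis
  proof (cases "\<bar>\<mu>\<bar> + \<tau> \<le> R")
    case True
    then have "\<epsilon> * (\<bar>\<mu>\<bar> + \<tau>) \<le> \<epsilon> * R" using \<epsilon> by (intro mult_left_mono) auto
    then show ?thesis using x v vR unfolding R_def[symmetric] by linarith
  next
    case False
    then have "\<bar>x\<bar> < \<bar>\<mu>\<bar>" "\<bar>v\<bar> < \<bar>\<mu>\<bar>" by (auto simp: R_def)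
    then have le: "\<bar>x - v\<bar> \<le> max \<bar>x - \<mu>\<bar> \<bar>\<mu> - v\<bar>" by (cases "0 \<le> \<mu>") auto
    have "\<epsilon> * (\<bar>v\<bar> + \<tau>) \<le> 1 * (\<bar>v\<bar> + \<tau>)" using \<epsilon> \<tau> by (intro mult_right_mono) auto
    then have "\<bar>\<mu> - v\<bar> \<le> \<bar>v\<bar> + \<tau>" using v by simp
    then have "\<bar>\<mu>\<bar> + \<tau> \<le> 2 * (\<bar>v\<bar> + \<tau>)"
      using \<tau> abs_triangle_ineq2[of \<mu> v] by simp
    also have "\<dots> \<le> 2 * R" unfolding R_def by (intro mult_left_mono) auto
    finally have "\<epsilon> * (\<bar>\<mu>\<bar> + \<tau>) \<le> \<epsilon> * (2 * R)" using \<epsilon> by (intro mult_left_mono) auto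
    moreover have "0 \<le> \<epsilon> * (\<bar>v\<bar> + \<tau>)" using \<epsilon> \<tau> by simp
    ultimately show ?thesis using le x v vR unfolding R_def[symmetric] by linarith
  qed
qed

text \<open>The numerators contribute \<open>e\<close>. The change of the denominator contributes
  \<open>c * e\<close>, since it is multiplied by a clipped ratio. Where the ratio to be bounded
  from below is itself clipped, monotonicity suffices.\<close>

lemma clipped_ratio_diff:
  fixes p q A B c e :: real
  assumes "0 < A" "0 < B" "0 \<le> p" "0 \<le> q" "0 < c" "\<bar>p - q\<bar> \<le> e" "\<bar>A - B\<bar> \<le> e"
  shows "\<bar>min c (p / A) - min c (q / B)\<bar> * B \<le> (1 + c) * e"
proof -
  define X where "X = min c (p / A)"
  define Y where "Y = min c (q / B)"
  have X: "0 \<le> X" "X \<le> c" using assms by (auto simp: X_def)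
  have Xe: "X * \<bar>A - B\<bar> \<le> c * e" using X assms by (intro mult_mono) auto
  have XAB: "\<bar>X * A - X * B\<bar> \<le> c * e" using Xe X by (simp add: abs_mult flip: right_diff_distrib)
  have "X * A \<le> p / A * A" unfolding X_def using assms by (intro mult_right_mono) auto
  then have XA: "X * A \<le> p" using assms by simp
  have "Y * B \<le> q / B * B" unfolding Y_def using assms by (intro mult_right_mono) auto
  then have YB: "Y * B \<le> q" using assms by simp
  have e: "0 \<le> e" using assms by linarith
  have "X * B - Y * B \<le> (1 + c) * e"
  proof (cases "c \<le> q / B")
    case True
    then have "X * B \<le> Y * B" using X assms by (intro mult_right_mono) (auto simp: Y_def)
    moreover have "0 \<le> (1 + c) * e" using e assms by simp
    ultimately show ?thesis by linarith
  next
    case False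
    then have "Y * B = q" using assms by (simp add: Y_def)
    then show ?thesis using XA XAB assms by (simp add: distrib_right)
  qed
  moreover have "Y * B - X * B \<le> (1 + c) * e"
  proof (cases "c \<le> p / A")
    case True
    then have "Y * B \<le> X * B" using assms by (intro mult_right_mono) (auto simp: Y_def X_def)
    moreover have "0 \<le> (1 + c) * e" using e assms by simp
    ultimately show ?thesis by linarith
  next
    case False
    then have "X * A = p" using assms by (simp add: X_def)
    then show ?thesis using YB XAB assms by (simp add: distrib_right)
  qed
  moreover have "\<bar>X - Y\<bar> * B = \<bar>X * B - Y * B\<bar>"
    using assms by (simp add: abs_mult flip: left_diff_distrib)
  ultimately show ?thesis by (simp add: X_def[symmetric] Y_def[symmetric] abs_le_iff)
qed

lemma clipped_loss_range:
  assumes "0 < c" "0 \<le> \<tau>"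
  shows "0 \<le> clipped_loss c \<tau> u v" "clipped_loss c \<tau> u v \<le> c"
  using assms by (auto simp: clipped_loss_def)

text \<open>\<open>clipped_ratio_diff\<close> is applied in both orders, which yields the bound
  relative to the larger denominator.\<close>

lemma clipped_loss_target_perturbation:
  fixes x v \<kappa> \<tau> c u :: real
  assumes \<tau>: "0 \<le> \<tau>" and c: "0 < c" and \<kappa>: "0 \<le> \<kappa>"
    and err: "\<bar>x - v\<bar> \<le> \<kappa> * max (\<bar>x\<bar> + \<tau>) (\<bar>v\<bar> + \<tau>)"
  shows "\<bar>clipped_loss c \<tau> u x - clipped_loss c \<tau> u v\<bar> \<le> (1 + c) * \<kappa>"
proof -
  define A B where "A = \<bar>x\<bar> + \<tau>" and "B = \<bar>v\<bar> + \<tau>"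
  have AB: "0 \<le> A" "0 \<le> B" "\<bar>A - B\<bar> \<le> \<bar>x - v\<bar>" using \<tau> by (auto simp: A_def B_def)
  \<comment> \<open>This settles the degenerate denominators: if \<open>\<tau> = 0\<close> and
    exactly one of \<open>x\<close> and \<open>v\<close> is 0, the hypothesis forces
    \<open>\<kappa> \<ge> 1\<close>.\<close>
  have trivial: ?thesis if "1 \<le> \<kappa>"
  proof -
    have "(1 + c) * 1 \<le> (1 + c) * \<kappa>" using that c by (intro mult_left_mono) auto
    moreover have "\<bar>clipped_loss c \<tau> u x - clipped_loss c \<tau> u v\<bar> \<le> c"
      using clipped_loss_range[OF c \<tau>, of u x] clipped_loss_range[OF c \<tau>, of u v] by (simp add: abs_le_iff)
    ultimately show ?thesis by simp
  qed
  consider "A = 0" "B = 0" | "A = 0" "0 < B" | "0 < A" "B = 0" | "0 < A" "0 < B"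
    using AB by linarith
  then show ?thesis
  proof cases
    case 1
    then have "x = v" using \<tau> by (auto simp: A_def B_def)
    then show ?thesis using \<kappa> c by simp
  next
    case 2
    then have "x = 0" "\<tau> = 0" using \<tau> by (auto simp: A_def)
    then have "B \<le> \<kappa> * B" using err 2 by (simp add: B_def)
    then show ?thesis using 2 trivial by simp
  next
    case 3
    then have "v = 0" "\<tau> = 0" using \<tau> by (auto simp: B_def)
    then have "A \<le> \<kappa> * A" using err 3 by (simp add: A_def)
    then show ?thesis using 3 trivial by simp
  next
    case 4
    have loss: "clipped_loss c \<tau> u x = min c (\<bar>u - x\<bar> / A)" "clipped_loss c \<tau> u v = min c (\<bar>u - v\<bar> / B)"
      using 4 by (simp_all add: clipped_loss_def A_def B_def)
    have d: "\<bar>\<bar>u - x\<bar> - \<bar>u - v\<bar>\<bar> \<le> \<bar>x - v\<bar>" "\<bar>\<bar>u - v\<bar> - \<bar>u - x\<bar>\<bar> \<le> \<bar>x - v\<bar>" "\<bar>B - A\<bar> \<le> \<bar>x - v\<bar>"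
      using AB by linarith+
    let ?d = "\<bar>min c (\<bar>u - x\<bar> / A) - min c (\<bar>u - v\<bar> / B)\<bar>"
    have "?d * B \<le> (1 + c) * \<bar>x - v\<bar>"
      using 4 c d AB by (intro clipped_ratio_diff) auto
    moreover have "\<bar>min c (\<bar>u - v\<bar> / B) - min c (\<bar>u - x\<bar> / A)\<bar> * A \<le> (1 + c) * \<bar>x - v\<bar>"
      using 4 c d AB by (intro clipped_ratio_diff) auto
    ultimately have "?d * max A B \<le> (1 + c) * \<bar>x - v\<bar>"
      by (auto simp: max_def abs_minus_commute)
    also have "\<dots> \<le> (1 + c) * (\<kappa> * max A B)"
      using err c unfolding A_def B_def by (intro mult_left_mono) auto
    finally have "?d * max A B \<le> ((1 + c) * \<kappa>) * max A B" by (simp add: mult.assoc)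
    then have "?d \<le> (1 + c) * \<kappa>" using 4 by (subst (asm) mult_le_cancel_right) auto
    then show ?thesis unfolding loss .
  qed
qed

lemma clipped_loss_measurable [measurable (raw)]:
  assumes [measurable]: "f \<in> borel_measurable M" "g \<in> borel_measurable M"
  shows "(\<lambda>x. clipped_loss c \<tau> (f x) (g x)) \<in> borel_measurable M"
  unfolding clipped_loss_def by measurable

section \<open>Products of kernels and Hoeffding's inequality\<close>

lemma PiM_kernel_measurable:
  assumes K: "K \<in> M \<rightarrow>\<^sub>M prob_algebra N"
  shows "(\<lambda>x. \<Pi>\<^sub>M i\<in>I. K x) \<in> M \<rightarrow>\<^sub>M prob_algebra (\<Pi>\<^sub>M i\<in>I. N)"
proof (rule measurable_prob_algebraI)
  have K': "prob_space (K x)" "sets (K x) = sets N" "space (K x) = space N" if "x \<in> space M" for x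
    using measurable_space[OF K that] by (auto simp: space_prob_algebra dest: sets_eq_imp_space_eq)
  show prob: "prob_space (\<Pi>\<^sub>M i\<in>I. K x)" if "x \<in> space M" for x
    using K' that by (intro prob_space_PiM) auto
  have sets: "sets (\<Pi>\<^sub>M i\<in>I. K x) = sets (\<Pi>\<^sub>M i\<in>I. N)" if "x \<in> space M" for x
    using K' that by (intro sets_PiM_cong) auto
  have [measurable]: "K \<in> M \<rightarrow>\<^sub>M subprob_algebra N" using K by (rule measurable_prob_algebraD)
  show "(\<lambda>x. \<Pi>\<^sub>M i\<in>I. K x) \<in> M \<rightarrow>\<^sub>M subprob_algebra (\<Pi>\<^sub>M i\<in>I. N)"
  proof (rule measurable_subprob_algebra_generated[OF sets_PiM Int_stable_prod_algebra prod_algebra_sets_into_space])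
    show "subprob_space (\<Pi>\<^sub>M i\<in>I. K x)" if "x \<in> space M" for x
      by (rule prob_space_imp_subprob_space) (rule prob[OF that])
    show "sets (\<Pi>\<^sub>M i\<in>I. K x) = sets (\<Pi>\<^sub>M i\<in>I. N)" if "x \<in> space M" for x by (rule sets[OF that])
    \<comment> \<open>Cylinders form an intersection-stable generator, and the mass of a cylinder is
      a finite product of kernel masses.\<close>
    fix A assume "A \<in> prod_algebra I (\<lambda>i. N)"
    then obtain J E where A: "A = prod_emb I (\<lambda>i. N) J (\<Pi>\<^sub>E j\<in>J. E j)"
      and J: "finite J" "J \<subseteq> I" and E: "\<And>i. i \<in> J \<Longrightarrow> E i \<in> sets N"
      by (rule prod_algebraE) blast
    have "emeasure (\<Pi>\<^sub>M i\<in>I. K x) A = (\<Prod>i\<in>J. emeasure (K x) (E i))" if "x \<in> space M" for x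
    proof -
      have "A = prod_emb I (\<lambda>i. K x) J (\<Pi>\<^sub>E j\<in>J. E j)"
        unfolding A prod_emb_def using K'(3)[OF that] by simp
      then show ?thesis using K' that J E by (simp add: emeasure_PiM_emb)
    qed
    moreover have "(\<lambda>x. \<Prod>i\<in>J. emeasure (K x) (E i)) \<in> borel_measurable M" using E by measurable
    ultimately show "(\<lambda>x. emeasure (\<Pi>\<^sub>M i\<in>I. K x) A) \<in> borel_measurable M"
      by (subst measurable_cong) auto
  next
    have "emeasure (\<Pi>\<^sub>M i\<in>I. K x) (\<Pi>\<^sub>E i\<in>I. space N) = 1" if "x \<in> space M" for x
      using prob_space.emeasure_space_1[OF prob[OF that]] K'(3)[OF that] by (simp add: space_PiM)
    then show "(\<lambda>x. emeasure (\<Pi>\<^sub>M i\<in>I. K x) (\<Pi>\<^sub>E i\<in>I. space N)) \<in> borel_measurable M"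
      by (subst measurable_cong) auto
  qed
qed

lemma hoeffding_iid_mean:
  fixes Y :: "'a \<Rightarrow> real"
  assumes D: "prob_space D" and [measurable]: "Y \<in> borel_measurable D"
    and range: "\<And>x. 0 \<le> Y x" "\<And>x. Y x \<le> c" and c: "0 < c" and m: "0 < m" and e: "0 \<le> e"
  shows "measure (\<Pi>\<^sub>M i\<in>{..<m}. D) {\<omega> \<in> space (\<Pi>\<^sub>M i\<in>{..<m}. D).
      e \<le> \<bar>(1 / real m) * (\<Sum>i<m. Y (\<omega> i)) - (\<integral>x. Y x \<partial>D)\<bar>} \<le> 2 * exp (- 2 * real m * e\<^sup>2 / c\<^sup>2)"
proof -
  let ?P = "\<Pi>\<^sub>M i\<in>{..<m}. D"
  interpret P: prob_space ?P by (intro prob_space_PiM D)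
  have coord: "P.indep_vars (\<lambda>_. D) (\<lambda>i \<omega>. \<omega> i) {..<m}"
  proof (subst P.indep_vars_iff_distr_eq_PiM')
    have "distr ?P ?P (\<lambda>x. \<lambda>i\<in>{..<m}. x i) = distr ?P ?P (\<lambda>x. x)"
      by (intro distr_cong) (auto simp: space_PiM PiE_def extensional_def restrict_def fun_eq_iff)
    also have "\<dots> = (\<Pi>\<^sub>M i\<in>{..<m}. distr ?P D (\<lambda>\<omega>. \<omega> i))"
      using D distr_PiM_component[of "{..<m}" "\<lambda>_. D"] by (simp add: distr_id2) (intro PiM_cong, auto)
    finally show "distr ?P ?P (\<lambda>x. \<lambda>i\<in>{..<m}. x i) = (\<Pi>\<^sub>M i\<in>{..<m}. distr ?P D (\<lambda>\<omega>. \<omega> i))" .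
  qed (use m in auto)
  have indep: "P.indep_vars (\<lambda>_. borel) (\<lambda>i \<omega>. Y (\<omega> i)) {..<m}"
    using P.indep_vars_compose2[OF coord, of "\<lambda>_. Y" "\<lambda>_. borel"] by simp
  interpret H: Hoeffding_ineq ?P "{..<m}" "\<lambda>i \<omega>. Y (\<omega> i)" "\<lambda>_. 0" "\<lambda>_. c"
      "\<Sum>i<m. \<integral>\<omega>. Y (\<omega> i) \<partial>?P"
    by unfold_locales (use indep range in auto)
  have mean: "(\<integral>\<omega>. Y (\<omega> i) \<partial>?P) = (\<integral>x. Y x \<partial>D)" if "i < m" for i
  proof -
    have "(\<integral>\<omega>. Y (\<omega> i) \<partial>?P) = (\<integral>x. Y x \<partial>distr ?P D (\<lambda>\<omega>. \<omega> i))"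
      by (rule integral_distr[symmetric]) (use that in auto)
    then show ?thesis using that D distr_PiM_component[of "{..<m}" "\<lambda>_. D" i] by simp
  qed
  have "measure ?P {\<omega> \<in> space ?P. e \<le> \<bar>(1 / real m) * (\<Sum>i<m. Y (\<omega> i)) - (\<integral>x. Y x \<partial>D)\<bar>}
    = measure ?P {\<omega> \<in> space ?P. real m * e \<le> \<bar>(\<Sum>i<m. Y (\<omega> i)) - (\<Sum>i<m. \<integral>\<omega>. Y (\<omega> i) \<partial>?P)\<bar>}"
  proof -
    have "e \<le> \<bar>(1 / real m) * S - t\<bar> \<longleftrightarrow> real m * e \<le> \<bar>S - real m * t\<bar>" for S t
    proof -
      have "S - real m * t = real m * ((1 / real m) * S - t)"
        using m by (simp add: right_diff_distrib)
      then have "\<bar>S - real m * t\<bar> = real m * \<bar>(1 / real m) * S - t\<bar>"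
        by (simp only: abs_mult abs_of_nat)
      then show ?thesis using m by simp
    qed
    then show ?thesis using mean by simp
  qed
  also have "\<dots> \<le> 2 * exp (- 2 * (real m * e)\<^sup>2 / (\<Sum>i<m. (c - 0)\<^sup>2))"
    using m c e by (intro H.Hoeffding_ineq_abs_ge) auto
  also have "- 2 * (real m * e)\<^sup>2 / (\<Sum>i<m. (c - 0)\<^sup>2) = - 2 * real m * e\<^sup>2 / c\<^sup>2"
    using m c by (simp add: power2_eq_square field_simps)
  finally show ?thesis .
qed

section \<open>Sampling states and returns\<close>

lemma state_sample_kernel:
  assumes \<rho>: "\<rho> \<in> d \<rightarrow>\<^sub>M prob_algebra borel"
  shows "(\<lambda>s. distr (\<Pi>\<^sub>M j\<in>(UNIV :: nat set). \<rho> s) (d \<Otimes>\<^sub>M (\<Pi>\<^sub>M j\<in>(UNIV :: nat set). borel)) (\<lambda>G. (s, G)))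
    \<in> d \<rightarrow>\<^sub>M prob_algebra (d \<Otimes>\<^sub>M (\<Pi>\<^sub>M j\<in>(UNIV :: nat set). borel))"
proof (rule measurable_prob_algebraI)
  note kernel = PiM_kernel_measurable[OF \<rho>, of "UNIV :: nat set"]
  fix s assume s: "s \<in> space d"
  have "prob_space (\<Pi>\<^sub>M j\<in>(UNIV :: nat set). \<rho> s)"
    and [measurable_cong]: "sets (\<Pi>\<^sub>M j\<in>(UNIV :: nat set). \<rho> s) = sets (\<Pi>\<^sub>M j\<in>(UNIV :: nat set). borel)"
    using measurable_space[OF kernel s] by (auto simp: space_prob_algebra)
  then show "prob_space (distr (\<Pi>\<^sub>M j\<in>(UNIV :: nat set). \<rho> s) (d \<Otimes>\<^sub>M (\<Pi>\<^sub>M j\<in>(UNIV :: nat set). borel)) (\<lambda>G. (s, G)))"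
    using s by (intro prob_space.prob_space_distr) measurable
next
  show "(\<lambda>s. distr (\<Pi>\<^sub>M j\<in>(UNIV :: nat set). \<rho> s) (d \<Otimes>\<^sub>M (\<Pi>\<^sub>M j\<in>(UNIV :: nat set). borel)) (\<lambda>G. (s, G)))
    \<in> d \<rightarrow>\<^sub>M subprob_algebra (d \<Otimes>\<^sub>M (\<Pi>\<^sub>M j\<in>(UNIV :: nat set). borel))"
    by (rule measurable_distr2[OF _ measurable_prob_algebraD[OF PiM_kernel_measurable[OF \<rho>]]]) simp
qed

lemma state_sample_law:
  assumes d: "prob_space d" and \<rho>: "\<rho> \<in> d \<rightarrow>\<^sub>M prob_algebra borel"
  shows "prob_space (state_sample_law d \<rho>)"
    and "sets (state_sample_law d \<rho>) = sets (d \<Otimes>\<^sub>M (\<Pi>\<^sub>M j\<in>(UNIV :: nat set). borel))"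
    and "A \<in> sets (d \<Otimes>\<^sub>M (\<Pi>\<^sub>M j\<in>(UNIV :: nat set). borel)) \<Longrightarrow>
      emeasure (state_sample_law d \<rho>) A = (\<integral>\<^sup>+s. emeasure (\<Pi>\<^sub>M j\<in>(UNIV :: nat set). \<rho> s)
        {G \<in> space (\<Pi>\<^sub>M j\<in>(UNIV :: nat set). \<rho> s). (s, G) \<in> A} \<partial>d)"
proof -
  note kernel = state_sample_kernel[OF \<rho>]
  have d': "d \<in> space (prob_algebra d)" using d by (simp add: space_prob_algebra)
  show "prob_space (state_sample_law d \<rho>)"
    unfolding state_sample_law_def by (rule prob_space_bind'[OF d' kernel])
  show "sets (state_sample_law d \<rho>) = sets (d \<Otimes>\<^sub>M (\<Pi>\<^sub>M j\<in>(UNIV :: nat set). borel))"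
    unfolding state_sample_law_def by (rule sets_bind'[OF d' kernel])
  assume A: "A \<in> sets (d \<Otimes>\<^sub>M (\<Pi>\<^sub>M j\<in>(UNIV :: nat set). borel))"
  have "emeasure (state_sample_law d \<rho>) A = (\<integral>\<^sup>+s. emeasure (distr (\<Pi>\<^sub>M j\<in>(UNIV :: nat set). \<rho> s)
      (d \<Otimes>\<^sub>M (\<Pi>\<^sub>M j\<in>(UNIV :: nat set). borel)) (\<lambda>G. (s, G))) A \<partial>d)"
    unfolding state_sample_law_def
    by (rule emeasure_bind[OF prob_space.not_empty[OF d] measurable_prob_algebraD[OF kernel] A])
  also have "\<dots> = (\<integral>\<^sup>+s. emeasure (\<Pi>\<^sub>M j\<in>(UNIV :: nat set). \<rho> s)
        {G \<in> space (\<Pi>\<^sub>M j\<in>(UNIV :: nat set). \<rho> s). (s, G) \<in> A} \<partial>d)"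
  proof (rule nn_integral_cong)
    fix s assume s: "s \<in> space d"
    have [measurable_cong]: "sets (\<Pi>\<^sub>M j\<in>(UNIV :: nat set). \<rho> s) = sets (\<Pi>\<^sub>M j\<in>(UNIV :: nat set). borel)"
      using measurable_space[OF PiM_kernel_measurable[OF \<rho>, of "UNIV :: nat set"] s]
      by (auto simp: space_prob_algebra)
    have "(\<lambda>G. (s, G)) \<in> (\<Pi>\<^sub>M j\<in>(UNIV :: nat set). \<rho> s) \<rightarrow>\<^sub>M (d \<Otimes>\<^sub>M (\<Pi>\<^sub>M j\<in>(UNIV :: nat set). borel))"
      using s by measurable
    moreover have "(\<lambda>G. (s, G)) -` A \<inter> space (\<Pi>\<^sub>M j\<in>(UNIV :: nat set). \<rho> s) =
      {G \<in> space (\<Pi>\<^sub>M j\<in>(UNIV :: nat set). \<rho> s). (s, G) \<in> A}" by blast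
    ultimately show "emeasure (distr (\<Pi>\<^sub>M j\<in>(UNIV :: nat set). \<rho> s)
        (d \<Otimes>\<^sub>M (\<Pi>\<^sub>M j\<in>(UNIV :: nat set). borel)) (\<lambda>G. (s, G))) A =
      emeasure (\<Pi>\<^sub>M j\<in>(UNIV :: nat set). \<rho> s) {G \<in> space (\<Pi>\<^sub>M j\<in>(UNIV :: nat set). \<rho> s). (s, G) \<in> A}"
      using A by (simp only: emeasure_distr)
  qed
  finally show "emeasure (state_sample_law d \<rho>) A = (\<integral>\<^sup>+s. emeasure (\<Pi>\<^sub>M j\<in>(UNIV :: nat set). \<rho> s)
        {G \<in> space (\<Pi>\<^sub>M j\<in>(UNIV :: nat set). \<rho> s). (s, G) \<in> A} \<partial>d)" .
qed

text \<open>Identifies the mean loss under the joint law of state and returns with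
  \<open>expected_loss\<close>, an integral over \<open>d\<close> alone.\<close>

lemma distr_fst_state_sample_law:
  assumes d: "prob_space d" and \<rho>: "\<rho> \<in> d \<rightarrow>\<^sub>M prob_algebra borel"
  shows "distr (state_sample_law d \<rho>) d fst = d"
proof (rule measure_eqI)
  note law = state_sample_law[OF assms]
  note [measurable_cong] = law(2)
  fix B assume "B \<in> sets (distr (state_sample_law d \<rho>) d fst)"
  then have B [measurable]: "B \<in> sets d" by simp
  let ?A = "fst -` B \<inter> space (state_sample_law d \<rho>)"
  have A: "?A \<in> sets (d \<Otimes>\<^sub>M (\<Pi>\<^sub>M j\<in>(UNIV :: nat set). borel))"
    unfolding law(2)[symmetric] by measurable
  have "emeasure (distr (state_sample_law d \<rho>) d fst) B = emeasure (state_sample_law d \<rho>) ?A"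
    by (rule emeasure_distr) measurable
  also have "\<dots> = (\<integral>\<^sup>+s. indicator B s \<partial>d)"
    unfolding law(3)[OF A]
  proof (rule nn_integral_cong)
    fix s assume s: "s \<in> space d"
    have K: "prob_space (\<Pi>\<^sub>M j\<in>(UNIV :: nat set). \<rho> s)"
      "sets (\<Pi>\<^sub>M j\<in>(UNIV :: nat set). \<rho> s) = sets (\<Pi>\<^sub>M j\<in>(UNIV :: nat set). borel)"
      using measurable_space[OF PiM_kernel_measurable[OF \<rho>, of "UNIV :: nat set"] s]
      by (auto simp: space_prob_algebra)
    have "{G \<in> space (\<Pi>\<^sub>M j\<in>(UNIV :: nat set). \<rho> s). (s, G) \<in> ?A} =
      (if s \<in> B then space (\<Pi>\<^sub>M j\<in>(UNIV :: nat set). \<rho> s) else {})"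
      using s sets_eq_imp_space_eq[OF law(2)] sets_eq_imp_space_eq[OF K(2)]
      by (auto simp: space_pair_measure)
    then show "emeasure (\<Pi>\<^sub>M j\<in>(UNIV :: nat set). \<rho> s) {G \<in> space (\<Pi>\<^sub>M j\<in>(UNIV :: nat set). \<rho> s). (s, G) \<in> ?A} =
      indicator B s"
      using prob_space.emeasure_space_1[OF K(1)] by simp
  qed
  finally show "emeasure (distr (state_sample_law d \<rho>) d fst) B = emeasure d B" by simp
qed simp

lemma truncated_return_law_measurable:
  assumes T: "T \<in> Ms \<rightarrow>\<^sub>M prob_algebra (count_space UNIV \<Otimes>\<^sub>M (\<Pi>\<^sub>M k\<in>(UNIV :: nat set). borel \<Otimes>\<^sub>M Ms))"
  shows "truncated_return_law \<gamma> T \<in> Ms \<rightarrow>\<^sub>M prob_algebra borel"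
proof -
  have "(\<lambda>x. \<Sum>k<fst x. \<gamma> ^ k * fst (snd x k)) \<in>
      borel_measurable (count_space (UNIV :: nat set) \<Otimes>\<^sub>M (\<Pi>\<^sub>M k\<in>(UNIV :: nat set). borel \<Otimes>\<^sub>M Ms))"
    by (rule measurable_compose_countable[where f = "\<lambda>l x. \<Sum>k<l. \<gamma> ^ k * fst (snd x k)" and g = fst]) measurable
  then have "(\<lambda>(l, \<omega>). \<Sum>k<l. \<gamma> ^ k * fst (\<omega> k)) \<in>
      borel_measurable (count_space (UNIV :: nat set) \<Otimes>\<^sub>M (\<Pi>\<^sub>M k\<in>(UNIV :: nat set). borel \<Otimes>\<^sub>M Ms))"
    by (simp add: case_prod_beta')
  from measurable_compose[OF T measurable_distr_prob_space[OF this]]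
  show ?thesis by (simp add: truncated_return_law_def[abs_def])
qed

text \<open>The trajectory law depends measurably on the state because it is a marginal of the
  kernel \<open>T\<close>; this avoids the Ionescu-Tulcea construction.\<close>

lemma true_value_measurable:
  assumes T: "truncation_scheme Ms \<kappa> \<pi> T"
  shows "true_value Ms \<kappa> \<pi> \<gamma> \<in> borel_measurable Ms"
proof -
  let ?P = "\<Pi>\<^sub>M k\<in>(UNIV :: nat set). (borel :: real measure) \<Otimes>\<^sub>M Ms"
  have kernel: "T \<in> Ms \<rightarrow>\<^sub>M prob_algebra (count_space UNIV \<Otimes>\<^sub>M ?P)"
    and law: "\<And>s. s \<in> space Ms \<Longrightarrow> distr (T s) ?P snd = trajectory_law Ms \<kappa> \<pi> s"
    using T by (auto simp: truncation_scheme_def)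
  have "(\<lambda>s. distr (T s) ?P snd) \<in> Ms \<rightarrow>\<^sub>M subprob_algebra ?P"
    by (intro measurable_prob_algebraD measurable_compose[OF kernel measurable_distr_prob_space]) simp
  moreover have "(\<lambda>\<omega>. \<Sum>k. \<gamma> ^ k * fst (\<omega> k)) \<in> borel_measurable ?P" by measurable
  ultimately have "(\<lambda>s. \<integral>\<omega>. (\<Sum>k. \<gamma> ^ k * fst (\<omega> k)) \<partial>distr (T s) ?P snd) \<in> borel_measurable Ms"
    by (intro measurable_compose[OF _ integral_measurable_subprob_algebra])
  moreover have "true_value Ms \<kappa> \<pi> \<gamma> s = (\<integral>\<omega>. (\<Sum>k. \<gamma> ^ k * fst (\<omega> k)) \<partial>distr (T s) ?P snd)"
    if "s \<in> space Ms" for s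
    by (simp add: true_value_def law[OF that])
  ultimately show ?thesis by (subst measurable_cong) auto
qed

text \<open>The exceptional set is chosen for each state separately, with no control over how it
  varies. The event \<open>bad\<close> is jointly measurable and each of its sections lies in the
  exceptional set, so the bound can be integrated over \<open>d\<close>.\<close>

lemma procR_failure_probability:
  assumes d: "prob_space d" "sets d = sets Ms"
    and trunc: "truncation_scheme Ms \<kappa> \<pi> T"
    and V: "return_spread_bound Ms \<gamma> T V"
    and trunc_error: "\<And>s. s \<in> space Ms \<Longrightarrow>
        \<bar>truncated_value \<gamma> T s - true_value Ms \<kappa> \<pi> \<gamma> s\<bar> \<le> \<epsilon> * (\<bar>true_value Ms \<kappa> \<pi> \<gamma> s\<bar> + \<tau>)"
    and \<epsilon>: "0 < \<epsilon>" "\<epsilon> < 1" and \<delta>: "0 < \<delta>" "\<delta> < 1" and \<tau>: "0 \<le> \<tau>"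
  defines "D \<equiv> state_sample_law d (truncated_return_law \<gamma> T)"
    and "bad \<equiv> \<lambda>(s, G). 2 * \<epsilon> * max (\<bar>procR_output \<epsilon> \<delta> \<tau> V G\<bar> + \<tau>) (\<bar>true_value Ms \<kappa> \<pi> \<gamma> s\<bar> + \<tau>)
      < \<bar>procR_output \<epsilon> \<delta> \<tau> V G - true_value Ms \<kappa> \<pi> \<gamma> s\<bar>"
  shows "{x \<in> space D. bad x} \<in> sets D" "measure D {x \<in> space D. bad x} \<le> \<delta>"
proof -
  let ?\<rho> = "truncated_return_law \<gamma> T" and ?v = "true_value Ms \<kappa> \<pi> \<gamma>"
  let ?B = "d \<Otimes>\<^sub>M (\<Pi>\<^sub>M j\<in>(UNIV :: nat set). (borel :: real measure))"
  note [measurable_cong] = d(2)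
  have sp: "space d = space Ms" by (rule sets_eq_imp_space_eq[OF d(2)])
  have "?\<rho> \<in> Ms \<rightarrow>\<^sub>M prob_algebra borel"
    using trunc by (intro truncated_return_law_measurable) (simp add: truncation_scheme_def)
  then have \<rho>: "?\<rho> \<in> d \<rightarrow>\<^sub>M prob_algebra borel" by (simp cong: measurable_cong_sets)
  note law = state_sample_law[OF d(1) \<rho>, folded D_def]
  have [measurable]: "?v \<in> borel_measurable Ms" by (rule true_value_measurable[OF trunc])
  have bad_B: "{x \<in> space ?B. bad x} \<in> sets ?B"
    unfolding bad_def by measurable
  have eq: "{x \<in> space D. bad x} = {x \<in> space ?B. bad x}" using sets_eq_imp_space_eq[OF law(2)] by simp
  then show sets: "{x \<in> space D. bad x} \<in> sets D" using bad_B law(2) by simp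
  have "emeasure D {x \<in> space ?B. bad x} = (\<integral>\<^sup>+s. emeasure (\<Pi>\<^sub>M j\<in>(UNIV :: nat set). ?\<rho> s)
      {G \<in> space (\<Pi>\<^sub>M j\<in>(UNIV :: nat set). ?\<rho> s). (s, G) \<in> {x \<in> space ?B. bad x}} \<partial>d)"
    by (rule law(3)[OF bad_B])
  also have "\<dots> \<le> (\<integral>\<^sup>+s. ennreal \<delta> \<partial>d)"
  proof (rule nn_integral_mono)
    fix s assume "s \<in> space d"
    then have s: "s \<in> space Ms" by (simp add: sp)
    have \<rho>s: "prob_space (?\<rho> s)" "sets (?\<rho> s) = sets borel"
      using measurable_space[OF \<rho> \<open>s \<in> space d\<close>] by (auto simp: space_prob_algebra)
    obtain a where a: "AE g in ?\<rho> s. a \<le> g \<and> g \<le> a + V"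
      using V s by (auto simp: return_spread_bound_def)
    obtain N where N: "N \<in> sets (\<Pi>\<^sub>M j\<in>(UNIV :: nat set). ?\<rho> s)"
      "emeasure (\<Pi>\<^sub>M j\<in>(UNIV :: nat set). ?\<rho> s) N \<le> ennreal \<delta>"
      "\<And>G. G \<in> space (\<Pi>\<^sub>M j\<in>(UNIV :: nat set). ?\<rho> s) - N \<Longrightarrow> good_samples \<delta> V a (truncated_value \<gamma> T s) G"
      using ex_confidence_failure_set[OF \<rho>s a \<delta>] unfolding truncated_value_def by blast
    have "{G \<in> space (\<Pi>\<^sub>M j\<in>(UNIV :: nat set). ?\<rho> s). (s, G) \<in> {x \<in> space ?B. bad x}} \<subseteq> N"
    proof safe
      fix G assume G: "G \<in> space (\<Pi>\<^sub>M j\<in>(UNIV :: nat set). ?\<rho> s)" "bad (s, G)"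
      show "G \<in> N"
      proof (rule ccontr)
        assume "G \<notin> N"
        then have "good_samples \<delta> V a (truncated_value \<gamma> T s) G" using N(3) G by blast
        then have "\<bar>procR_output \<epsilon> \<delta> \<tau> V G - truncated_value \<gamma> T s\<bar> \<le> \<epsilon> * (\<bar>truncated_value \<gamma> T s\<bar> + \<tau>)"
          by (rule procR_output_accuracy[OF \<epsilon> \<delta> \<tau>])
        from two_step_relative_error[OF \<epsilon> \<tau> this trunc_error[OF s]] G(2)
        show False by (simp add: bad_def)
      qed
    qed
    then have "emeasure (\<Pi>\<^sub>M j\<in>(UNIV :: nat set). ?\<rho> s)
        {G \<in> space (\<Pi>\<^sub>M j\<in>(UNIV :: nat set). ?\<rho> s). (s, G) \<in> {x \<in> space ?B. bad x}}
      \<le> emeasure (\<Pi>\<^sub>M j\<in>(UNIV :: nat set). ?\<rho> s) N"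
      using N(1) by (rule emeasure_mono)
    then show "emeasure (\<Pi>\<^sub>M j\<in>(UNIV :: nat set). ?\<rho> s)
        {G \<in> space (\<Pi>\<^sub>M j\<in>(UNIV :: nat set). ?\<rho> s). (s, G) \<in> {x \<in> space ?B. bad x}} \<le> ennreal \<delta>"
      using N(2) by (rule order_trans)
  qed
  also have "\<dots> = ennreal \<delta>" using prob_space.emeasure_space_1[OF d(1)] by simp
  finally show "measure D {x \<in> space D. bad x} \<le> \<delta>"
    using \<delta> unfolding eq measure_def by (simp add: enn2real_leI)
qed

theorem corollary1:
  fixes Ms :: "'s measure"
    and Ma :: "'a measure"
    and \<kappa> :: "'s \<times> 'a \<Rightarrow> (real \<times> 's) measure"
    and \<pi> :: "'s \<Rightarrow> 'a measure"
    and d :: "'s measure"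
    and T :: "'s \<Rightarrow> (nat \<times> (nat \<Rightarrow> real \<times> 's)) measure"
    and vhat :: "nat \<Rightarrow> 's \<Rightarrow> real"
    and \<gamma> Vmax \<epsilon>\<^sub>m \<epsilon>bar \<delta> \<tau> c :: real
    and K m :: nat
  assumes mdp: "mdp_policy Ms Ma \<kappa> \<pi> \<gamma>"
    and d: "prob_space d" "sets d = sets Ms"
    and trunc: "truncation_scheme Ms \<kappa> \<pi> T"
    and Vmax: "return_spread_bound Ms \<gamma> T Vmax"
    and trunc_error:
      "\<And>s. s \<in> space Ms \<Longrightarrow>
        \<bar>truncated_value \<gamma> T s - true_value Ms \<kappa> \<pi> \<gamma> s\<bar>
          \<le> \<epsilon>bar * (\<bar>true_value Ms \<kappa> \<pi> \<gamma> s\<bar> + \<tau>)"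
    and params: "\<epsilon>\<^sub>m > 0" "0 < \<epsilon>bar" "\<epsilon>bar < 1" "0 < \<delta>" "\<delta> < 1" "\<tau> \<ge> 0" "c > 0" "K \<ge> 1"
    and m: "m = nat \<lceil>ln (4 * real K / \<delta>) * c\<^sup>2 / (2 * \<epsilon>\<^sub>m\<^sup>2)\<rceil>"
    and vhat: "\<And>k. k < K \<Longrightarrow> vhat k \<in> borel_measurable Ms"
  shows
    "measure (sample_law m d (truncated_return_law \<gamma> T))
      {\<omega> \<in> space (sample_law m d (truncated_return_law \<gamma> T)).
        \<forall>k<K. \<bar>expected_loss d c \<tau> (vhat k) (true_value Ms \<kappa> \<pi> \<gamma>)
                 - loss_estimate m c \<tau> (vhat k)
                     (\<lambda>(s, G). procR_output \<epsilon>bar (\<delta> / (2 * real m)) \<tau> Vmax G) \<omega>\<bar>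
               \<le> \<epsilon>\<^sub>m + 2 * (1 + c) * \<epsilon>bar}
      \<ge> 1 - \<delta>"
proof -
  define \<rho> where "\<rho> = truncated_return_law \<gamma> T"
  define D where "D = state_sample_law d \<rho>"
  define P where "P = sample_law m d \<rho>"
  define v where "v = true_value Ms \<kappa> \<pi> \<gamma>"
  define out where "out = (\<lambda>x :: 's \<times> (nat \<Rightarrow> real). case x of (s, G) \<Rightarrow> procR_output \<epsilon>bar (\<delta> / (2 * real m)) \<tau> Vmax G)"
  define bad where "bad = (\<lambda>x. 2 * \<epsilon>bar * max (\<bar>out x\<bar> + \<tau>) (\<bar>v (fst x)\<bar> + \<tau>) < \<bar>out x - v (fst x)\<bar>)"
  define loss where "loss = (\<lambda>k (x :: 's \<times> (nat \<Rightarrow> real)). clipped_loss c \<tau> (vhat k (fst x)) (v (fst x)))"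
  let ?B = "d \<Otimes>\<^sub>M (\<Pi>\<^sub>M j\<in>(UNIV :: nat set). (borel :: real measure))"
  note [measurable_cong] = d(2)
  have K: "1 \<le> real K" using params by simp
  have ln_pos: "0 < ln (4 * real K / \<delta>)" using params K by (intro ln_gt_zero) (simp add: field_simps)
  have m_ge: "ln (4 * real K / \<delta>) * c\<^sup>2 / (2 * \<epsilon>\<^sub>m\<^sup>2) \<le> real m" unfolding m by linarith
  have "0 < ln (4 * real K / \<delta>) * c\<^sup>2 / (2 * \<epsilon>\<^sub>m\<^sup>2)" using ln_pos params by simp
  then have m_pos: "0 < m" using m_ge by (cases m) auto
  define \<delta>' where "\<delta>' = \<delta> / (2 * real m)"
  have \<delta>': "0 < \<delta>'" "\<delta>' < 1"
  proof -
    show "0 < \<delta>'" using params m_pos by (simp add: \<delta>'_def)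
    have "\<delta> < 2 * real m" using params m_pos by linarith
    then show "\<delta>' < 1" using m_pos by (simp add: \<delta>'_def)
  qed
  have "\<rho> \<in> Ms \<rightarrow>\<^sub>M prob_algebra borel"
    unfolding \<rho>_def using trunc by (intro truncated_return_law_measurable) (simp add: truncation_scheme_def)
  then have \<rho>: "\<rho> \<in> d \<rightarrow>\<^sub>M prob_algebra borel" by (simp cong: measurable_cong_sets)
  note law = state_sample_law[OF d(1) \<rho>, folded D_def]
  note [measurable_cong] = law(2)
  have P: "P = (\<Pi>\<^sub>M i\<in>{..<m}. D)" by (simp add: P_def sample_law_def D_def)
  interpret P: prob_space P unfolding P by (intro prob_space_PiM law(1))
  have v [measurable]: "v \<in> borel_measurable Ms" unfolding v_def by (rule true_value_measurable[OF trunc])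
  note [measurable] = vhat
  have out [measurable]: "out \<in> borel_measurable D" unfolding out_def by measurable
  have loss [measurable]: "loss k \<in> borel_measurable D" if "k < K" for k
    unfolding loss_def using that by measurable
  have failure: "{x \<in> space D. bad x} \<in> sets D" "measure D {x \<in> space D. bad x} \<le> \<delta>'"
  proof -
    have bad: "bad = (\<lambda>(s, G). 2 * \<epsilon>bar * max (\<bar>procR_output \<epsilon>bar \<delta>' \<tau> Vmax G\<bar> + \<tau>) (\<bar>v s\<bar> + \<tau>)
        < \<bar>procR_output \<epsilon>bar \<delta>' \<tau> Vmax G - v s\<bar>)"
      unfolding bad_def out_def \<delta>'_def by (intro ext) (simp only: split_beta fst_conv snd_conv)
    note failure = procR_failure_probability[OF d trunc Vmax trunc_error params(2,3) \<delta>' params(6)]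
    show "{x \<in> space D. bad x} \<in> sets D" "measure D {x \<in> space D. bad x} \<le> \<delta>'"
      unfolding bad D_def \<rho>_def v_def by (rule failure; assumption)+
  qed
  have mean_loss: "(\<integral>x. loss k x \<partial>D) = expected_loss d c \<tau> (vhat k) v" if k: "k < K" for k
  proof -
    have "expected_loss d c \<tau> (vhat k) v = (\<integral>s. clipped_loss c \<tau> (vhat k s) (v s) \<partial>distr D d fst)"
      unfolding expected_loss_def D_def distr_fst_state_sample_law[OF d(1) \<rho>] ..
    also have "\<dots> = (\<integral>x. loss k x \<partial>D)"
      unfolding loss_def by (rule integral_distr) (use k in measurable)
    finally show ?thesis ..
  qed
  \<comment> \<open>Hoeffding's inequality is applied to the loss against the true value, whose mean
    is \<open>expected_loss\<close>; the output of the procedure enters only through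
    \<open>bad\<close>.\<close>
  define H where "H = (\<lambda>k. {\<omega> \<in> space P. \<epsilon>\<^sub>m \<le> \<bar>(1 / real m) * (\<Sum>i<m. loss k (\<omega> i)) - (\<integral>x. loss k x \<partial>D)\<bar>})"
  define F where "F = (\<lambda>i. {\<omega> \<in> space P. bad (\<omega> i)})"
  have H_sets: "H k \<in> sets P" if "k < K" for k
    using that unfolding H_def P by measurable
  have coord: "(\<lambda>\<omega>. \<omega> i) \<in> P \<rightarrow>\<^sub>M D" if "i < m" for i
    using that unfolding P by (intro measurable_component_singleton) simp
  have F_eq: "F i = (\<lambda>\<omega>. \<omega> i) -` {x \<in> space D. bad x} \<inter> space P" if "i < m" for i
    using measurable_space[OF coord[OF that]] by (auto simp: F_def)
  have F_sets: "F i \<in> sets P" if "i < m" for i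
    unfolding F_eq[OF that] by (rule measurable_sets[OF coord[OF that] failure(1)])
  have F_le: "measure P (F i) \<le> \<delta>'" if "i < m" for i
  proof -
    have "distr P D (\<lambda>\<omega>. \<omega> i) = D"
      using distr_PiM_component[of "{..<m}" "\<lambda>_. D" i] law(1) that by (simp add: P)
    then have "measure D {x \<in> space D. bad x} = measure P (F i)"
      using measure_distr[OF coord[OF that] failure(1)] by (simp add: F_eq[OF that])
    then show ?thesis using failure(2) by simp
  qed
  have H_le: "measure P (H k) \<le> \<delta> / (2 * real K)" if k: "k < K" for k
  proof -
    \<comment> \<open>\<open>m\<close> makes the exponent at least
      \<open>ln (4 * real K / \<delta>)\<close>: two tails for each of \<open>K\<close> functions
      then cost \<open>\<delta> / 2\<close> in total, and the \<open>m\<close> runs of the procedure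
      cost the other half.\<close>
    have "measure P (H k) \<le> 2 * exp (- 2 * real m * \<epsilon>\<^sub>m\<^sup>2 / c\<^sup>2)"
      unfolding H_def P using k params m_pos clipped_loss_range[of c \<tau>] law(1)
      by (intro hoeffding_iid_mean) (auto simp: loss_def[of] intro: loss[OF k, unfolded loss_def])
    also have "exp (- 2 * real m * \<epsilon>\<^sub>m\<^sup>2 / c\<^sup>2) \<le> exp (- ln (4 * real K / \<delta>))"
      using m_ge params by (simp add: field_simps)
    also have "exp (- ln (4 * real K / \<delta>)) = \<delta> / (4 * real K)"
      using params K by (simp add: exp_minus)
    finally show ?thesis by simp
  qed
  let ?U = "(\<Union>k<K. H k) \<union> (\<Union>i<m. F i)"
  have U_sets: "?U \<in> sets P" using H_sets F_sets by (intro sets.Un sets.finite_UN) auto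
  have "measure P ?U \<le> measure P (\<Union>k<K. H k) + measure P (\<Union>i<m. F i)"
    using H_sets F_sets by (intro measure_Un_le sets.finite_UN) auto
  also have "\<dots> \<le> (\<Sum>k<K. measure P (H k)) + (\<Sum>i<m. measure P (F i))"
    using H_sets F_sets by (intro add_mono P.finite_measure_subadditive_finite) auto
  also have "\<dots> \<le> (\<Sum>k<K. \<delta> / (2 * real K)) + (\<Sum>i<m. \<delta>')"
    using H_le F_le by (intro add_mono sum_mono) auto
  also have "\<dots> = \<delta>" using K m_pos by (simp add: \<delta>'_def)
  finally have U_le: "measure P ?U \<le> \<delta>" .
  let ?good = "{\<omega> \<in> space P. \<forall>k<K. \<bar>expected_loss d c \<tau> (vhat k) v - loss_estimate m c \<tau> (vhat k) out \<omega>\<bar>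
      \<le> \<epsilon>\<^sub>m + 2 * (1 + c) * \<epsilon>bar}"
  have good_sets: "?good \<in> sets P"
    unfolding P loss_estimate_def by measurable
  have "space P - ?U \<subseteq> ?good"
  proof safe
    fix \<omega> k assume \<omega>: "\<omega> \<in> space P" "\<omega> \<notin> (\<Union>k<K. H k)" "\<omega> \<notin> (\<Union>i<m. F i)" and k: "k < K"
    let ?S = "(1 / real m) * (\<Sum>i<m. loss k (\<omega> i))"
    have "\<bar>?S - expected_loss d c \<tau> (vhat k) v\<bar> \<le> \<epsilon>\<^sub>m"
    proof -
      have "\<omega> \<notin> H k" using \<omega>(2) k by blast
      then have "\<not> \<epsilon>\<^sub>m \<le> \<bar>?S - (\<integral>x. loss k x \<partial>D)\<bar>" using \<omega>(1) unfolding H_def by blast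
      then show ?thesis unfolding mean_loss[OF k] by linarith
    qed
    moreover have "\<bar>?S - loss_estimate m c \<tau> (vhat k) out \<omega>\<bar> \<le> 2 * (1 + c) * \<epsilon>bar"
    proof -
      have diff: "\<bar>loss k (\<omega> i) - clipped_loss c \<tau> (vhat k (fst (\<omega> i))) (out (\<omega> i))\<bar> \<le> (1 + c) * (2 * \<epsilon>bar)"
        if "i < m" for i
      proof -
        have "\<not> bad (\<omega> i)" using \<omega> that by (auto simp: F_def)
        then have "\<bar>out (\<omega> i) - v (fst (\<omega> i))\<bar> \<le> 2 * \<epsilon>bar * max (\<bar>out (\<omega> i)\<bar> + \<tau>) (\<bar>v (fst (\<omega> i))\<bar> + \<tau>)"
          by (simp add: bad_def)
        then show ?thesis
          using clipped_loss_target_perturbation[of \<tau> c "2 * \<epsilon>bar" "out (\<omega> i)" "v (fst (\<omega> i))" "vhat k (fst (\<omega> i))"] params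
          by (simp add: loss_def abs_minus_commute)
      qed
      have "?S - loss_estimate m c \<tau> (vhat k) out \<omega> =
        (1 / real m) * (\<Sum>i<m. loss k (\<omega> i) - clipped_loss c \<tau> (vhat k (fst (\<omega> i))) (out (\<omega> i)))"
        by (simp add: loss_estimate_def sum_subtractf diff_divide_distrib)
      then have "\<bar>?S - loss_estimate m c \<tau> (vhat k) out \<omega>\<bar> =
        (1 / real m) * \<bar>\<Sum>i<m. loss k (\<omega> i) - clipped_loss c \<tau> (vhat k (fst (\<omega> i))) (out (\<omega> i))\<bar>"
        by (simp add: abs_mult)
      also have "\<dots> \<le> (1 / real m) * (\<Sum>i<m. (1 + c) * (2 * \<epsilon>bar))"
        using diff by (intro mult_left_mono order_trans[OF sum_abs] sum_mono) auto
      also have "\<dots> = 2 * (1 + c) * \<epsilon>bar" using m_pos by simp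
      finally show ?thesis .
    qed
    ultimately show "\<bar>expected_loss d c \<tau> (vhat k) v - loss_estimate m c \<tau> (vhat k) out \<omega>\<bar>
      \<le> \<epsilon>\<^sub>m + 2 * (1 + c) * \<epsilon>bar" by linarith
  qed
  then have "measure P (space P - ?U) \<le> measure P ?good"
    using good_sets by (rule P.finite_measure_mono)
  then have "1 - \<delta> \<le> measure P ?good"
    using P.prob_compl[OF U_sets] U_le by simp
  then show ?thesis unfolding P_def \<rho>_def v_def out_def .
qed

end
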